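(* Assume $G=1$ (a single support set), that the breakpoint grid $Z$ is permutation invariant with $\boldsymbol{0}\in Z$, and that the embedded support $\Theta$ satisfies: (a) $\boldsymbol{S}\boldsymbol\theta\in\Theta$ for all $\boldsymbol\theta\in\Theta$ and all signed permutation matrices $\boldsymbol{S}\in\mathcal{S}$; (b) $\eta(i+1)-\eta(i)\le\eta(i)-\eta(i-1)$ for all $i\in[I-1]$. Let $s>0$ and $\boldsymbol{\xi}'$ be such that $\boldsymbol{\xi}'/s\in\overline{\Xi}'$, and consider the separation problem $$\max_{[\boldsymbol{z}^-,\boldsymbol{z}^+]\in\mathcal{Z}}\ d'(\boldsymbol{\xi}'/s,[\boldsymbol{z}^-,\boldsymbol{z}^+])-\overline{d}([\boldsymbol{z}^-,\boldsymbol{z}^+]).$$ Then: (i) The separation problem can be solved in time $\mathcal{O}(IJ\log I)$. (ii) If for every $j\in[J]$ there is at most one $i\in[I]$ such that $\eta(i)-\eta(i-1)\in[z_{j-1},z_j)$, then the separation problem has a square (optimal) solution $[z_j\boldsymbol{e},-z_j\boldsymbol{e}]$ for some $j\in[J/2]=\{1,\dots,J/2\}$.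
   Context: Notation: $[n]=\{1,\dots,n\}$, $[n]_0=[n]\cup\{0\}$; $\boldsymbol{e}$ is the all-ones vector; $[\boldsymbol{a},\boldsymbol{b}]$ is the hyperrectangle $\{\boldsymbol{x}:\boldsymbol{a}\le\boldsymbol{x}\le\boldsymbol{b}\}$. Let $\Theta\subseteq\mathbb{R}^I$ be the embedded support, i.e. the image $\boldsymbol{E}\Xi$ of a compact convex support $\Xi\subseteq\mathbb{R}^N$ under an injective linear map $\boldsymbol{E}$ (here $G=1$, i.e. there is a single support set). For each $i\in[I]$ let $\underline{\theta}_i=\min_{\boldsymbol\theta\in\Theta}\theta_i$, $\overline{\theta}_i=\max_{\boldsymbol\theta\in\Theta}\theta_i$ and let $\underline{\theta}_i=z_{i0}<z_{i1}<\dots<z_{iJ_i}=\overline{\theta}_i$ be chosen breakpoints. The breakpoint grid is $Z=\times_{i\in[I]}\{z_{ij}:j\in[J_i]_0\}$, and $\mathcal{Z}=\{[\boldsymbol{z}^-,\boldsymbol{z}^+]:\boldsymbol{z}^-,\boldsymbol{z}^+\in Z,\ \boldsymbol{z}^-\le\boldsymbol{z}^+\}$. Folding: for $i\in[I],j\in[J_i]$, $F_{ij}(\theta_i)=0$ if $\theta_i<z_{i,j-1}$; $F_{ij}(\theta_i)=\theta_i-z_{i,j-1}$ if $\theta_i\in[z_{i,j-1},z_{ij}]$; $F_{ij}(\theta_i)=z_{ij}-z_{i,j-1}$ if $\theta_i>z_{ij}$; $F(\boldsymbol\theta)$ collects all these components. Lifted vectors $\boldsymbol{\xi}'$ have components $\xi'_{ij}$,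 $i\in[I],j\in[J_i]$, and $F^+$ is defined componentwise by $F^+_i(\boldsymbol{\xi}')=\underline{\theta}_i+\sum_{j\in[J_i]}\xi'_{ij}$. The outer approximation of the lifted support is $\overline{\Xi}'=\{\boldsymbol{\xi}':F^+(\boldsymbol{\xi}')\in\Theta\}\cap\mathrm{conv}(F([\underline{\boldsymbol\theta},\overline{\boldsymbol\theta}]))$. Distances: for $[\boldsymbol{z}^-,\boldsymbol{z}^+]\in\mathcal{Z}$, $$\overline{d}([\boldsymbol{z}^-,\boldsymbol{z}^+])=\max_{\boldsymbol\theta\in\Theta}\ \min_{\boldsymbol\theta'\in[\boldsymbol{z}^-,\boldsymbol{z}^+]}\|\boldsymbol\theta-\boldsymbol\theta'\|_1,\qquad d'(\boldsymbol{\xi}',[\boldsymbol{z}^-,\boldsymbol{z}^+])=\sum_{i\in[I]}\Big(\sum_{j\in J_i^+}\xi'_{ij}+z_i^--\underline{\theta}_i-\sum_{j\in J_i^-}\xi'_{ij}\Big),$$ where $J_i^+=\{j\in[J_i]:z_i^+<z_{ij}\}$ and $J_i^-=\{j\in[J_i]:z_i^-\ge z_{ij}\}$. $\mathcal{S}$ is the set of signed permutation matrices in $\mathbb{R}^{I\times I}$ (entries in $\{-1,0,1\}$, exactly one non-zero entry in each row and each column). $Z$ is permutation invariant if $\boldsymbol{S}\boldsymbol{z}\in Z$ for all $\boldsymbol{z}\in Z$, $\boldsymbol{S}\in\mathcal{S}$; then $J_i=J$ and $z_{ij}=z_j$ do not depend on $i$, the breakpoints are symmetric around $0$, and (as $\boldsymbol{0}\in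 Z$) $J$ is even with $z_{J/2}=0$. Further, $\eta(i)=\max_{\boldsymbol\theta\in\Theta}\sum_{i'\in[i]}|\theta_{i'}|$ for $i\in[I]$ is the maximal $l_1$-norm of the first $i$ components over $\Theta$, and $\eta(0)=0$. In (i), running time counts elementary operations (arithmetic, comparisons), with $\boldsymbol{\xi}'$, $s$, the breakpoints and the values $\eta(1),\dots,\eta(I)$ available as input.
   Formalization: In (ii) the optimal square is claimed for some j in {0,...,J/2}, where j=0 is the whole box, and for some j in {1,...,J/2} only if the optimal value is positive; as printed (ii) fails, e.g. for I=1, Θ=[-1,1], breakpoints -1,0,1, s=1, ξ'=(1,0). *)

theory Defs
  imports "HOL-Analysis.Analysis" "HOL-Library.Function_Algebras"
begin

section \<open>Coordinate spaces\<close>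

text \<open>
  The dimensions are data that one algorithm has to handle uniformly, so they cannot be types.
  A vector of \<open>\<real>\<^sup>n\<close> is a function \<^typ>\<open>nat \<Rightarrow> real\<close> vanishing outside \<open>{1..n}\<close>, and a lifted
  vector is a function \<^typ>\<open>nat \<Rightarrow> nat \<Rightarrow> real\<close> vanishing at all \<open>(i, j)\<close> that are not indices.
  On these subspaces the pointwise order, the pointwise vector space structure and the product
  topology are the usual ones.
\<close>

instantiation "fun" :: (type, real_vector) real_vector
begin

definition scaleR_fun :: "real \<Rightarrow> ('a \<Rightarrow> 'b) \<Rightarrow> 'a \<Rightarrow> 'b"
  where "scaleR_fun c f = (\<lambda>x. c *\<^sub>R f x)"

instance
  by standard (simp_all add: scaleR_fun_def plus_fun_def fun_eq_iff scaleR_add_right scaleR_add_left)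

end

definition rspace :: "nat \<Rightarrow> (nat \<Rightarrow> real) set"
  where "rspace n = {x. \<forall>i. i \<notin> {1..n} \<longrightarrow> x i = 0}"

definition restrict_vec :: "nat \<Rightarrow> (nat \<Rightarrow> real) \<Rightarrow> nat \<Rightarrow> real"
  where "restrict_vec n x = (\<lambda>i. if i \<in> {1..n} then x i else 0)"

definition l1_dist :: "nat \<Rightarrow> (nat \<Rightarrow> real) \<Rightarrow> (nat \<Rightarrow> real) \<Rightarrow> real"
  where "l1_dist n x y = (\<Sum>i\<in>{1..n}. \<bar>x i - y i\<bar>)"

definition mat_vec :: "nat \<Rightarrow> (nat \<Rightarrow> nat \<Rightarrow> real) \<Rightarrow> (nat \<Rightarrow> real) \<Rightarrow> nat \<Rightarrow> real"
  where "mat_vec n A x = restrict_vec n (\<lambda>i. \<Sum>k\<in>{1..n}. A i k * x k)"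

definition signed_permutation_matrices :: "nat \<Rightarrow> (nat \<Rightarrow> nat \<Rightarrow> real) set"
  where "signed_permutation_matrices n = {S.
    (\<forall>i\<in>{1..n}. \<forall>k\<in>{1..n}. S i k \<in> {-1, 0, 1}) \<and>
    (\<forall>i\<in>{1..n}. \<exists>!k. k \<in> {1..n} \<and> S i k \<noteq> 0) \<and>
    (\<forall>k\<in>{1..n}. \<exists>!i. i \<in> {1..n} \<and> S i k \<noteq> 0)}"

definition signed_permutation_invariant :: "nat \<Rightarrow> (nat \<Rightarrow> real) set \<Rightarrow> bool"
  where "signed_permutation_invariant n A \<longleftrightarrow>
    (\<forall>S\<in>signed_permutation_matrices n. \<forall>x\<in>A. mat_vec n S x \<in> A)"


section \<open>Supports, breakpoints and lifting\<close>

text \<open>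
  \<open>E\<close> is a linear map from \<open>\<real>\<^sup>N\<close> to \<open>\<real>\<^sup>I\<close>, given by some linear extension to all functions.
\<close>

definition embedding :: "nat \<Rightarrow> nat \<Rightarrow> ((nat \<Rightarrow> real) \<Rightarrow> nat \<Rightarrow> real) \<Rightarrow> bool"
  where "embedding N I E \<longleftrightarrow> linear E \<and> E ` rspace N \<subseteq> rspace I \<and> inj_on E (rspace N)"

definition support :: "nat \<Rightarrow> (nat \<Rightarrow> real) set \<Rightarrow> bool"
  where "support N \<Xi> \<longleftrightarrow> \<Xi> \<subseteq> rspace N \<and> \<Xi> \<noteq> {} \<and> compact \<Xi> \<and> convex \<Xi>"

definition lower :: "nat \<Rightarrow> (nat \<Rightarrow> real) set \<Rightarrow> nat \<Rightarrow> real"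
  where "lower I \<Theta> = restrict_vec I (\<lambda>i. INF \<theta>\<in>\<Theta>. \<theta> i)"

definition upper :: "nat \<Rightarrow> (nat \<Rightarrow> real) set \<Rightarrow> nat \<Rightarrow> real"
  where "upper I \<Theta> = restrict_vec I (\<lambda>i. SUP \<theta>\<in>\<Theta>. \<theta> i)"

definition breakpoints ::
  "nat \<Rightarrow> (nat \<Rightarrow> real) set \<Rightarrow> (nat \<Rightarrow> nat) \<Rightarrow> (nat \<Rightarrow> nat \<Rightarrow> real) \<Rightarrow> bool"
  where "breakpoints I \<Theta> J z \<longleftrightarrow> (\<forall>i\<in>{1..I}. 1 \<le> J i \<and>
    z i 0 = lower I \<Theta> i \<and> z i (J i) = upper I \<Theta> i \<and> (\<forall>j\<in>{1..J i}. z i (j - 1) < z i j))"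

definition grid :: "nat \<Rightarrow> (nat \<Rightarrow> nat) \<Rightarrow> (nat \<Rightarrow> nat \<Rightarrow> real) \<Rightarrow> (nat \<Rightarrow> real) set"
  where "grid I J z = {x \<in> rspace I. \<forall>i\<in>{1..I}. x i \<in> z i ` {0..J i}}"

text \<open>
  A hyperrectangle of \<open>\<Z>\<close> is represented by its pair of corners \<open>(zm, zp)\<close>; as a set it is the
  order interval \<open>{zm..zp}\<close>, which determines the corners.
\<close>

definition rectangles ::
  "nat \<Rightarrow> (nat \<Rightarrow> nat) \<Rightarrow> (nat \<Rightarrow> nat \<Rightarrow> real) \<Rightarrow> ((nat \<Rightarrow> real) \<times> (nat \<Rightarrow> real)) set"
  where "rectangles I J z = {(zm, zp). zm \<in> grid I J z \<and> zp \<in> grid I J z \<and> zm \<le> zp}"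

definition folding ::
  "nat \<Rightarrow> (nat \<Rightarrow> nat) \<Rightarrow> (nat \<Rightarrow> nat \<Rightarrow> real) \<Rightarrow> (nat \<Rightarrow> real) \<Rightarrow> nat \<Rightarrow> nat \<Rightarrow> real"
  where "folding I J z \<theta> = (\<lambda>i j.
    if i \<in> {1..I} \<and> j \<in> {1..J i} then
      if \<theta> i < z i (j - 1) then 0
      else if \<theta> i \<le> z i j then \<theta> i - z i (j - 1)
      else z i j - z i (j - 1)
    else 0)"

definition unfolding_map ::
  "nat \<Rightarrow> (nat \<Rightarrow> real) set \<Rightarrow> (nat \<Rightarrow> nat) \<Rightarrow> (nat \<Rightarrow> nat \<Rightarrow> real) \<Rightarrow> nat \<Rightarrow> real"
  where "unfolding_map I \<Theta> J \<xi> = restrict_vec I (\<lambda>i. lower I \<Theta> i + (\<Sum>j\<in>{1..J i}. \<xi> i j))"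

definition outer_lifted_support ::
  "nat \<Rightarrow> (nat \<Rightarrow> real) set \<Rightarrow> (nat \<Rightarrow> nat) \<Rightarrow> (nat \<Rightarrow> nat \<Rightarrow> real) \<Rightarrow> (nat \<Rightarrow> nat \<Rightarrow> real) set"
  where "outer_lifted_support I \<Theta> J z =
    {\<xi>. unfolding_map I \<Theta> J \<xi> \<in> \<Theta>} \<inter>
    convex hull (folding I J z ` {lower I \<Theta>..upper I \<Theta>})"


section \<open>The separation problem\<close>

definition dbar :: "nat \<Rightarrow> (nat \<Rightarrow> real) set \<Rightarrow> (nat \<Rightarrow> real) set \<Rightarrow> real"
  where "dbar I \<Theta> R = (SUP \<theta>\<in>\<Theta>. INF \<theta>'\<in>R. l1_dist I \<theta> \<theta>')"

definition dlift ::
  "nat \<Rightarrow> (nat \<Rightarrow> real) set \<Rightarrow> (nat \<Rightarrow> nat) \<Rightarrow> (nat \<Rightarrow> nat \<Rightarrow> real) \<Rightarrow>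
   (nat \<Rightarrow> nat \<Rightarrow> real) \<Rightarrow> (nat \<Rightarrow> real) \<times> (nat \<Rightarrow> real) \<Rightarrow> real"
  where "dlift I \<Theta> J z \<xi> = (\<lambda>(zm, zp). \<Sum>i\<in>{1..I}.
    (\<Sum>j | j \<in> {1..J i} \<and> zp i < z i j. \<xi> i j) + zm i - lower I \<Theta> i
    - (\<Sum>j | j \<in> {1..J i} \<and> zm i \<ge> z i j. \<xi> i j))"

definition separation_objective ::
  "nat \<Rightarrow> (nat \<Rightarrow> real) set \<Rightarrow> (nat \<Rightarrow> nat) \<Rightarrow> (nat \<Rightarrow> nat \<Rightarrow> real) \<Rightarrow>
   (nat \<Rightarrow> nat \<Rightarrow> real) \<Rightarrow> real \<Rightarrow> (nat \<Rightarrow> real) \<times> (nat \<Rightarrow> real) \<Rightarrow> real"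
  where "separation_objective I \<Theta> J z \<xi> s R =
    dlift I \<Theta> J z (\<xi> /\<^sub>R s) R - dbar I \<Theta> {fst R..snd R}"

definition separation_solution ::
  "nat \<Rightarrow> (nat \<Rightarrow> real) set \<Rightarrow> (nat \<Rightarrow> nat) \<Rightarrow> (nat \<Rightarrow> nat \<Rightarrow> real) \<Rightarrow>
   (nat \<Rightarrow> nat \<Rightarrow> real) \<Rightarrow> real \<Rightarrow> (nat \<Rightarrow> real) \<times> (nat \<Rightarrow> real) \<Rightarrow> bool"
  where "separation_solution I \<Theta> J z \<xi> s R \<longleftrightarrow>
    is_arg_max (separation_objective I \<Theta> J z \<xi> s) (\<lambda>R. R \<in> rectangles I J z) R"

definition eta :: "(nat \<Rightarrow> real) set \<Rightarrow> nat \<Rightarrow> real"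
  where "eta \<Theta> i = (SUP \<theta>\<in>\<Theta>. \<Sum>k\<in>{1..i}. \<bar>\<theta> k\<bar>)"

definition separation_instance ::
  "nat \<Rightarrow> (nat \<Rightarrow> real) set \<Rightarrow> nat \<Rightarrow> ((nat \<Rightarrow> real) \<Rightarrow> nat \<Rightarrow> real) \<Rightarrow> (nat \<Rightarrow> real) set \<Rightarrow>
   (nat \<Rightarrow> nat) \<Rightarrow> (nat \<Rightarrow> nat \<Rightarrow> real) \<Rightarrow> (nat \<Rightarrow> nat \<Rightarrow> real) \<Rightarrow> real \<Rightarrow> bool"
  where "separation_instance N \<Xi> I E \<Theta> J z \<xi> s \<longleftrightarrow>
    1 \<le> I \<and> support N \<Xi> \<and> embedding N I E \<and> \<Theta> = E ` \<Xi> \<and> breakpoints I \<Theta> J z \<and>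
    0 < s \<and> \<xi> /\<^sub>R s \<in> outer_lifted_support I \<Theta> J z"

definition symmetric_instance ::
  "nat \<Rightarrow> (nat \<Rightarrow> real) set \<Rightarrow> (nat \<Rightarrow> nat) \<Rightarrow> (nat \<Rightarrow> nat \<Rightarrow> real) \<Rightarrow> bool"
  where "symmetric_instance I \<Theta> J z \<longleftrightarrow>
    signed_permutation_invariant I (grid I J z) \<and> 0 \<in> grid I J z \<and>
    signed_permutation_invariant I \<Theta> \<and>
    (\<forall>i\<in>{1..I - 1}. eta \<Theta> (i + 1) - eta \<Theta> i \<le> eta \<Theta> i - eta \<Theta> (i - 1))"

text \<open>
  For a permutation invariant grid the breakpoints do not depend on the coordinate and are
  symmetric around 0, so the corners of a square are read off the first coordinate. The square for \<open>j = 0\<close> is the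
  whole box \<open>[lower, upper]\<close>; its objective value is 0.
\<close>

definition square ::
  "nat \<Rightarrow> (nat \<Rightarrow> nat \<Rightarrow> real) \<Rightarrow> nat \<Rightarrow> (nat \<Rightarrow> real) \<times> (nat \<Rightarrow> real)"
  where "square I z j = (restrict_vec I (\<lambda>_. z 1 j), restrict_vec I (\<lambda>_. - z 1 j))"


section \<open>A real random access machine\<close>

text \<open>
  Running times refer to programs of a uniform machine with exact real arithmetic. A state has
  named one-dimensional arrays of natural numbers and named two-dimensional arrays of reals;
  scalars are arrays read at index 0. Every constant, memory access, arithmetic operation,
  comparison, logical connective and assignment costs one unit. Reals cannot be converted to
  indices, indices are only added and subtracted (truncated at 0), and the only real constants
  are 0 and 1, so that no unit-cost operation is stronger than the elementary ones.
\<close>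

datatype nexp = NConst nat | NGet string nexp | NAdd nexp nexp | NSub nexp nexp

datatype rexp = RZero | ROne | RGet string nexp nexp
  | RAdd rexp rexp | RSub rexp rexp | RMul rexp rexp | RDiv rexp rexp

datatype bexp = NLess nexp nexp | RLess rexp rexp | BNot bexp | BAnd bexp bexp

datatype com = Skip
  | NSet string nexp nexp
  | RSet string nexp nexp rexp
  | Seq com com
  | Cond bexp com com
  | While bexp com

type_synonym state = "(string \<Rightarrow> nat \<Rightarrow> nat) \<times> (string \<Rightarrow> nat \<Rightarrow> nat \<Rightarrow> real)"

fun nval :: "nexp \<Rightarrow> state \<Rightarrow> nat" where
  "nval (NConst n) st = n"
| "nval (NGet x e) st = fst st x (nval e st)"
| "nval (NAdd e1 e2) st = nval e1 st + nval e2 st"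
| "nval (NSub e1 e2) st = nval e1 st - nval e2 st"

fun rval :: "rexp \<Rightarrow> state \<Rightarrow> real" where
  "rval RZero st = 0"
| "rval ROne st = 1"
| "rval (RGet x e1 e2) st = snd st x (nval e1 st) (nval e2 st)"
| "rval (RAdd r1 r2) st = rval r1 st + rval r2 st"
| "rval (RSub r1 r2) st = rval r1 st - rval r2 st"
| "rval (RMul r1 r2) st = rval r1 st * rval r2 st"
| "rval (RDiv r1 r2) st = rval r1 st / rval r2 st"

fun bval :: "bexp \<Rightarrow> state \<Rightarrow> bool" where
  "bval (NLess e1 e2) st \<longleftrightarrow> nval e1 st < nval e2 st"
| "bval (RLess r1 r2) st \<longleftrightarrow> rval r1 st < rval r2 st"
| "bval (BNot b) st \<longleftrightarrow> \<not> bval b st"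
| "bval (BAnd b1 b2) st \<longleftrightarrow> bval b1 st \<and> bval b2 st"

fun ncost :: "nexp \<Rightarrow> nat" where
  "ncost (NConst n) = 1"
| "ncost (NGet x e) = ncost e + 1"
| "ncost (NAdd e1 e2) = ncost e1 + ncost e2 + 1"
| "ncost (NSub e1 e2) = ncost e1 + ncost e2 + 1"

fun rcost :: "rexp \<Rightarrow> nat" where
  "rcost RZero = 1"
| "rcost ROne = 1"
| "rcost (RGet x e1 e2) = ncost e1 + ncost e2 + 1"
| "rcost (RAdd r1 r2) = rcost r1 + rcost r2 + 1"
| "rcost (RSub r1 r2) = rcost r1 + rcost r2 + 1"
| "rcost (RMul r1 r2) = rcost r1 + rcost r2 + 1"
| "rcost (RDiv r1 r2) = rcost r1 + rcost r2 + 1"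

fun bcost :: "bexp \<Rightarrow> nat" where
  "bcost (NLess e1 e2) = ncost e1 + ncost e2 + 1"
| "bcost (RLess r1 r2) = rcost r1 + rcost r2 + 1"
| "bcost (BNot b) = bcost b + 1"
| "bcost (BAnd b1 b2) = bcost b1 + bcost b2 + 1"

definition nupdate :: "string \<Rightarrow> nat \<Rightarrow> nat \<Rightarrow> state \<Rightarrow> state"
  where "nupdate x i v st = ((fst st)(x := (fst st x)(i := v)), snd st)"

definition rupdate :: "string \<Rightarrow> nat \<Rightarrow> nat \<Rightarrow> real \<Rightarrow> state \<Rightarrow> state"
  where "rupdate x i j v st = (fst st, (snd st)(x := (snd st x)(i := (snd st x i)(j := v))))"

text \<open>\<open>exec c st t st'\<close>: started in \<open>st\<close>, \<open>c\<close> terminates in \<open>st'\<close> after \<open>t\<close> elementary operations.\<close>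

inductive exec :: "com \<Rightarrow> state \<Rightarrow> nat \<Rightarrow> state \<Rightarrow> bool" where
  Skip: "exec Skip st 1 st"
| NSet: "exec (NSet x e1 e2) st (ncost e1 + ncost e2 + 1) (nupdate x (nval e1 st) (nval e2 st) st)"
| RSet: "exec (RSet x e1 e2 r) st (ncost e1 + ncost e2 + rcost r + 1)
    (rupdate x (nval e1 st) (nval e2 st) (rval r st) st)"
| Seq: "exec c1 st1 t1 st2 \<Longrightarrow> exec c2 st2 t2 st3 \<Longrightarrow> exec (Seq c1 c2) st1 (t1 + t2) st3"
| CondTrue: "bval b st \<Longrightarrow> exec c1 st t st' \<Longrightarrow> exec (Cond b c1 c2) st (bcost b + t) st'"
| CondFalse: "\<not> bval b st \<Longrightarrow> exec c2 st t st' \<Longrightarrow> exec (Cond b c1 c2) st (bcost b + t) st'"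
| WhileFalse: "\<not> bval b st \<Longrightarrow> exec (While b c) st (bcost b) st"
| WhileTrue: "bval b st1 \<Longrightarrow> exec c st1 t1 st2 \<Longrightarrow> exec (While b c) st2 t2 st3 \<Longrightarrow>
    exec (While b c) st1 (bcost b + t1 + t2) st3"

inductive_cases exec_elims:
  "exec Skip st t st'"
  "exec (NSet x e1 e2) st t st'"
  "exec (RSet x e1 e2 r) st t st'"
  "exec (Seq c1 c2) st t st'"
  "exec (Cond b c1 c2) st t st'"

inductive_cases exec_While_elim: "exec (While b c) st t st'"

text \<open>Execution is deterministic, so the existence of a good run is a claim about the only run.\<close>

lemma exec_deterministic:
  "exec c st t st' \<Longrightarrow> exec c st u st'' \<Longrightarrow> u = t \<and> st'' = st'"
proof (induction arbitrary: u st'' rule: exec.induct)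
  case (Skip st)
  then show ?case by (rule exec_elims) simp
next
  case (NSet x e1 e2 st)
  then show ?case by (rule exec_elims) simp
next
  case (RSet x e1 e2 r st)
  then show ?case by (rule exec_elims) simp
next
  case (Seq c1 st1 t1 st2 c2 t2 st3)
  from Seq.prems show ?case by (rule exec_elims) (use Seq.IH in blast)
next
  case (CondTrue b st c1 t st' c2)
  from CondTrue.prems show ?case by (rule exec_elims) (use CondTrue.hyps CondTrue.IH in blast)+
next
  case (CondFalse b st c2 t st' c1)
  from CondFalse.prems show ?case by (rule exec_elims) (use CondFalse.hyps CondFalse.IH in blast)+
next
  case (WhileFalse b st c)
  from WhileFalse.prems show ?case by (rule exec_While_elim) (use WhileFalse.hyps in blast)+
next
  case (WhileTrue b st1 c t1 st2 t2 st3)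
  from WhileTrue.prems show ?case
    by (rule exec_While_elim) (use WhileTrue.hyps WhileTrue.IH in blast)+
qed


text \<open>Memory that is neither input nor written by the program has arbitrary contents.\<close>

definition separation_input ::
  "nat \<Rightarrow> (nat \<Rightarrow> real) set \<Rightarrow> (nat \<Rightarrow> nat) \<Rightarrow> (nat \<Rightarrow> nat \<Rightarrow> real) \<Rightarrow>
   (nat \<Rightarrow> nat \<Rightarrow> real) \<Rightarrow> real \<Rightarrow> state \<Rightarrow> bool"
  where "separation_input I \<Theta> J z \<xi> s st \<longleftrightarrow>
    fst st ''I'' 0 = I \<and> snd st ''s'' 0 0 = s \<and>
    (\<forall>i\<in>{1..I}. fst st ''J'' i = J i \<and> snd st ''eta'' i 0 = eta \<Theta> i \<and>
      (\<forall>j\<in>{0..J i}. snd st ''z'' i j = z i j) \<and>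
      (\<forall>j\<in>{1..J i}. snd st ''xi'' i j = \<xi> i j))"

definition output_rectangle :: "nat \<Rightarrow> state \<Rightarrow> (nat \<Rightarrow> real) \<times> (nat \<Rightarrow> real)"
  where "output_rectangle I st =
    (restrict_vec I (\<lambda>i. snd st ''zminus'' i 0), restrict_vec I (\<lambda>i. snd st ''zplus'' i 0))"

definition output_value :: "state \<Rightarrow> real"
  where "output_value st = snd st ''value'' 0 0"

end

theory Submission
  imports Defs "HOL-Library.Log_Nat"
begin

text \<open>
  Write \<open>\<delta> u = eta u - eta (u - 1)\<close>, and let \<open>y j = - z 1 j\<close> be the half-width of the square of
  level \<open>j\<close>; it decreases in \<open>j\<close>, from the whole box at \<open>j = 0\<close> to the origin at \<open>j = J 1 div 2\<close>.

  \<^emph>\<open>The distance term.\<close> For a box with corners \<open>zm\<close>, \<open>zp\<close> put \<open>a i = min (zp i) (- zm i)\<close>. Since signs and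
  coordinates of points of \<open>\<Theta>\<close> can be changed freely, the farthest point lies at distance at least
  \<open>eta (card T) - sum a T\<close> for every set \<open>T\<close> of coordinates. Concavity of \<open>eta\<close> makes the \<open>\<delta> u\<close>
  decreasing, so if \<open>\<sigma>\<close> sorts \<open>a\<close> increasingly, the best \<open>T\<close> yields the sum of the positive parts of
  \<open>\<delta> u - a (\<sigma> u)\<close> (\<open>dbar_ge_sorted\<close>). For boxes symmetric about 0 this is the exact value
  (\<open>dbar_symmetric_box\<close>).

  \<^emph>\<open>The lifted distance\<close> is a sum of contributions of single coordinates. The components of a point
  in the hull of the folded box fill up in order, and therefore narrowing one coordinate from level
  \<open>j - 1\<close> to level \<open>j\<close> gains something between 0 and the decrease in half-width (\<open>gain_bounds\<close>).

  \<^emph>\<open>Exchange.\<close> A coordinate that is matched with a larger \<open>\<delta> u\<close> may be widened, for the distance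
  term falls by at least what is lost; one that is matched with a smaller \<open>\<delta> u\<close> may be narrowed at
  no cost. As half-widths increase and the \<open>\<delta> u\<close> decrease, the two cases meet at a single level, and
  every box is dominated by one whose half-widths take two adjacent values \<open>y j\<close> and \<open>y (j - 1)\<close>
  (\<open>rectangle_le_two_level\<close>). If both values occur and the two neighbouring \<open>\<delta> u\<close> are not both in
  \<open>[y j, y (j - 1))\<close>, one of the two groups can be moved to the other value, which gives a square
  (\<open>rectangle_le_square\<close>).

  \<^emph>\<open>The algorithm.\<close> For a fixed level \<open>j\<close> the distance term of a two-level box depends only on the number
  \<open>t\<close> of narrow coordinates, so the best choice is to narrow those with the \<open>t\<close> largest gains. For each of
  the \<open>J 1 div 2\<close> levels the program extracts the gains in decreasing order from a tournament tree, at
  logarithmic cost each, and updates the value of the box by one increment per extraction. A box is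
  written out only once per level, after the best \<open>t\<close> is known.
\<close>

(* Levels are written with the numeral 1 throughout, as in z 1 j; rewriting it to Suc 0 would keep
   the lemmas about the first coordinate from applying. *)
declare One_nat_def [simp del]

section \<open>Sorted sequences and symmetric enumerations\<close>

lemma sorting_permutation:
  fixes f :: "nat \<Rightarrow> real"
  shows "\<exists>\<sigma>. bij_betw \<sigma> {1..n} {1..n} \<and> mono_on {1..n} (\<lambda>u. f (\<sigma> u))"
proof -
  define xs where "xs = sort_key f [1..<Suc n]"
  have xs: "distinct xs" "set xs = {1..n}" "length xs = n" "sorted (map f xs)"
    by (auto simp: xs_def)
  have "bij_betw ((!) xs) {..<n} {1..n}"
    using xs by (intro bij_betw_nth) auto
  moreover have "bij_betw (\<lambda>u. u - 1) {1..n} {..<n}"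
    by (rule bij_betw_byWitness[where f' = Suc]) auto
  ultimately have "bij_betw ((!) xs \<circ> (\<lambda>u. u - 1)) {1..n} {1..n}"
    by (rule bij_betw_trans[rotated])
  moreover have "mono_on {1..n} (\<lambda>u. f (((!) xs \<circ> (\<lambda>u. u - 1)) u))"
  proof (rule mono_onI)
    fix u v assume "u \<in> {1..n}" "v \<in> {1..n}" "u \<le> v"
    then have "map f xs ! (u - 1) \<le> map f xs ! (v - 1)"
      using xs by (intro sorted_nth_mono) auto
    then show "f (((!) xs \<circ> (\<lambda>u. u - 1)) u) \<le> f (((!) xs \<circ> (\<lambda>u. u - 1)) v)"
      using \<open>u \<in> {1..n}\<close> \<open>v \<in> {1..n}\<close> xs by auto
  qed
  ultimately show ?thesis by blast
qed

lemma bij_betw_preimage: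
  assumes \<sigma>: "bij_betw \<sigma> A B" and T: "T \<subseteq> B"
  shows "bij_betw \<sigma> {u \<in> A. \<sigma> u \<in> T} T"
proof (rule bij_betw_subset[OF \<sigma>])
  have "T \<subseteq> \<sigma> ` A" using bij_betw_imp_surj_on[OF \<sigma>] T by simp
  then show "\<sigma> ` {u \<in> A. \<sigma> u \<in> T} = T" by blast
qed simp

lemma down_closed_eq_initial_segment:
  fixes X :: "nat set"
  assumes "X \<subseteq> {1..n}" and down: "\<And>u v. v \<in> X \<Longrightarrow> 1 \<le> u \<Longrightarrow> u \<le> v \<Longrightarrow> u \<in> X"
  shows "X = {1..card X}"
proof (cases "X = {}")
  case False
  have fin: "finite X" using assms(1) finite_subset by blast
  then have mx: "Max X \<in> X" using False by simp
  have "X = {1..Max X}"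
  proof
    show "X \<subseteq> {1..Max X}" using assms(1) fin by auto
    show "{1..Max X} \<subseteq> X" using down[OF mx] by auto
  qed
  then show ?thesis by (metis card_atLeastAtMost diff_Suc_1)
qed simp

text \<open>
  The elements of \<open>T\<close> beyond \<open>card T\<close> are as many as the elements missing below, and \<open>h (card T)\<close>
  separates their values.
\<close>
lemma sum_initial_segment_le:
  fixes h :: "nat \<Rightarrow> real"
  assumes mono: "mono_on {1..n} h" and T: "T \<subseteq> {1..n}"
  shows "sum h {1..card T} \<le> sum h T"
proof -
  have fin: "finite T" using T finite_subset by blast
  have cn: "card T \<le> n" using card_mono[OF _ T] by simp
  define m where "m = card T"
  define D1 where "D1 = {1..m} - T"
  define D2 where "D2 = T - {1..m}"
  have card_eq: "card D1 = card D2"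
    using card_le_sym_Diff[of "{1..m}" T] card_le_sym_Diff[of T "{1..m}"] fin
    by (simp add: D1_def D2_def m_def)
  have "sum h D1 \<le> of_nat (card D1) * h m"
  proof (rule sum_bounded_above)
    fix u assume "u \<in> D1"
    then show "h u \<le> h m" using cn by (intro mono_onD[OF mono]) (auto simp: D1_def m_def)
  qed
  also have "\<dots> = of_nat (card D2) * h m" by (simp add: card_eq)
  also have "\<dots> \<le> sum h D2"
  proof (rule sum_bounded_below)
    fix u assume "u \<in> D2"
    then have "m \<noteq> 0" using fin by (auto simp: D2_def m_def)
    then show "h m \<le> h u"
      using \<open>u \<in> D2\<close> cn T by (intro mono_onD[OF mono]) (auto simp: D2_def m_def)
  qed
  finally have le: "sum h D1 \<le> sum h D2" .
  have "sum h {1..m} = sum h ({1..m} \<inter> T) + sum h D1"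
    unfolding D1_def by (simp add: sum.Int_Diff)
  moreover have "sum h T = sum h ({1..m} \<inter> T) + sum h D2"
    unfolding D2_def using sum.Int_Diff[OF fin, of h "{1..m}"] by (simp add: Int_commute)
  ultimately show ?thesis using le by (simp add: m_def)
qed

text \<open>
  Turns the sorted formula for the distance into the value of a single set of coordinates.
\<close>
lemma sum_positive_part_antimono:
  fixes c :: "nat \<Rightarrow> real"
  assumes "\<And>u v. 1 \<le> u \<Longrightarrow> u \<le> v \<Longrightarrow> v \<le> n \<Longrightarrow> c v \<le> c u"
  shows "\<exists>t\<le>n. (\<Sum>u\<in>{1..n}. max 0 (c u)) = sum c {1..t}"
proof -
  define X where "X = {u \<in> {1..n}. 0 < c u}"
  have sub: "X \<subseteq> {1..n}" by (auto simp: X_def)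
  have X: "X = {1..card X}"
    by (rule down_closed_eq_initial_segment[OF sub])
      (use assms in \<open>force simp: X_def\<close>)
  have "(\<Sum>u\<in>{1..n}. max 0 (c u)) = (\<Sum>u\<in>X. max 0 (c u))"
    by (rule sum.mono_neutral_right) (auto simp: X_def max_def)
  also have "\<dots> = sum c X" by (rule sum.cong) (auto simp: X_def)
  finally show ?thesis using X card_mono[OF _ sub] by auto
qed

text \<open>
  At the first difference the smaller value would be skipped by one of the two enumerations. This
  identifies the breakpoints of different coordinates, and also the
  breakpoints with their mirror images.
\<close>
lemma strict_enumeration_unique:
  fixes f g :: "nat \<Rightarrow> real"
  assumes f: "strict_mono_on {0..m} f" and g: "strict_mono_on {0..n} g"
    and img: "f ` {0..m} = g ` {0..n}"
  shows "m = n \<and> (\<forall>j\<le>m. f j = g j)"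
proof -
  have "card (f ` {0..m}) = Suc m" "card (g ` {0..n}) = Suc n"
    using f g by (simp_all add: card_image strict_mono_on_imp_inj_on)
  then have mn: "m = n" using img by simp
  have le: "q j \<le> p j"
    if p: "strict_mono_on {0..m} p" and q: "strict_mono_on {0..m} q"
      and pq: "p ` {0..m} = q ` {0..m}" and IH: "\<forall>k<j. p k = q k" and j: "j \<le> m"
    for p q :: "nat \<Rightarrow> real" and j
  proof -
    have "p j \<in> q ` {0..m}" using pq j by auto
    then obtain k where k: "k \<le> m" "p j = q k" by auto
    have "\<not> k < j"
    proof
      assume "k < j"
      then have "p k < p j" using p k j by (intro strict_mono_onD[OF p]) auto
      then show False using IH \<open>k < j\<close> k by simp
    qed
    then show ?thesis using k j q by (cases "k = j") (auto intro!: less_imp_le strict_mono_onD[OF q])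
  qed
  have "f j = g j" if "j \<le> m" for j
    using that
  proof (induction j rule: less_induct)
    case (less j)
    then have IH: "\<forall>k<j. f k = g k" by auto
    have "g j \<le> f j" by (rule le[OF f _ _ IH less.prems]) (use g img mn in auto)
    moreover have "f j \<le> g j"
      by (rule le[OF _ f _ _ less.prems]) (use g img mn IH in auto)
    ultimately show ?case by simp
  qed
  then show ?thesis using mn by blast
qed

lemma signed_permutation_image:
  assumes inv: "signed_permutation_invariant n A" and x: "x \<in> A"
    and \<pi>: "bij_betw \<pi> {1..n} {1..n}" and e: "\<And>i. e i \<in> {-1, 1}"
  shows "restrict_vec n (\<lambda>i. e i * x (\<pi> i)) \<in> A"
proof -
  define S where "S = (\<lambda>i k. if k = \<pi> i then e i else (0::real))"
  have ne: "e i \<noteq> 0" for i using e[of i] by auto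
  have "S \<in> signed_permutation_matrices n"
    unfolding signed_permutation_matrices_def
  proof (intro CollectI conjI ballI)
    fix i k
    show "S i k \<in> {-1, 0, 1}" using e[of i] by (auto simp: S_def)
  next
    fix i assume "i \<in> {1..n}"
    then have "\<pi> i \<in> {1..n}" using bij_betwE[OF \<pi>] by blast
    then show "\<exists>!k. k \<in> {1..n} \<and> S i k \<noteq> 0"
      using ne by (intro ex1I[of _ "\<pi> i"]) (auto simp: S_def split: if_splits)
  next
    fix k assume k: "k \<in> {1..n}"
    then obtain i where i: "i \<in> {1..n}" "\<pi> i = k"
      using \<pi> by (metis bij_betw_iff_bijections)
    show "\<exists>!i. i \<in> {1..n} \<and> S i k \<noteq> 0"
    proof (rule ex1I[of _ i])
      show "i \<in> {1..n} \<and> S i k \<noteq> 0" using i ne by (auto simp: S_def)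
      fix i' assume "i' \<in> {1..n} \<and> S i' k \<noteq> 0"
      then have "i' \<in> {1..n}" "\<pi> i' = k" by (auto simp: S_def split: if_splits)
      then show "i' = i" using i \<pi> by (metis bij_betw_imp_inj_on inj_onD)
    qed
  qed
  then have "mat_vec n S x \<in> A"
    using inv x unfolding signed_permutation_invariant_def by blast
  moreover have "mat_vec n S x = restrict_vec n (\<lambda>i. e i * x (\<pi> i))"
  proof
    fix i
    show "mat_vec n S x i = restrict_vec n (\<lambda>i. e i * x (\<pi> i)) i"
    proof (cases "i \<in> {1..n}")
      case True
      then have "\<pi> i \<in> {1..n}" using bij_betwE[OF \<pi>] by blast
      moreover have "(\<Sum>k\<in>{1..n}. S i k * x k) = (\<Sum>k\<in>{1..n}. if k = \<pi> i then e i * x k else 0)"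
        by (rule sum.cong) (auto simp: S_def)
      ultimately show ?thesis
        using True by (simp add: mat_vec_def restrict_vec_def)
    qed (auto simp: mat_vec_def restrict_vec_def)
  qed
  ultimately show ?thesis by simp
qed

lemma sum_fun_apply: "sum f A x = (\<Sum>a\<in>A. f a x)"
  by (induction A rule: infinite_finite_induct) (auto simp: plus_fun_def zero_fun_def)

text \<open>
  The ambient function space is infinite dimensional, where a linear map may be discontinuous, so
  the image is bounded by expanding \<open>E\<close> in the \<open>N\<close> unit vectors that span \<open>rspace N\<close>.
\<close>
lemma linear_image_of_compact_bounded:
  assumes E: "linear E" and comp: "compact \<Xi>" and sub: "\<Xi> \<subseteq> rspace N"
  shows "\<exists>B. \<forall>\<theta>\<in>E ` \<Xi>. \<bar>\<theta> i\<bar> \<le> (B::real)"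
proof -
  define e where "e = (\<lambda>k (i::nat). if i = k then 1 else (0::real))"
  have expand: "x = (\<Sum>k\<in>{1..N}. x k *\<^sub>R e k)" if "x \<in> rspace N" for x
  proof
    fix i
    have "(\<Sum>k\<in>{1..N}. x k *\<^sub>R e k) i = (\<Sum>k\<in>{1..N}. if k = i then x k else 0)"
      unfolding sum_fun_apply by (rule sum.cong) (auto simp: scaleR_fun_def e_def)
    also have "\<dots> = x i" using that by (auto simp: rspace_def)
    finally show "x i = (\<Sum>k\<in>{1..N}. x k *\<^sub>R e k) i" ..
  qed
  have "\<exists>b. \<forall>x\<in>\<Xi>. \<bar>x k\<bar> \<le> b" for k
  proof -
    have "continuous_on \<Xi> (\<lambda>x. x k)"
      by (rule continuous_on_subset[OF continuous_on_product_coordinates]) simp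
    then have "bounded ((\<lambda>x. x k) ` \<Xi>)"
      by (intro compact_imp_bounded compact_continuous_image comp)
    then show ?thesis unfolding bounded_iff by auto
  qed
  then obtain b where b: "\<And>k x. x \<in> \<Xi> \<Longrightarrow> \<bar>x k\<bar> \<le> b k" by metis
  have "\<bar>E x i\<bar> \<le> (\<Sum>k\<in>{1..N}. b k * \<bar>E (e k) i\<bar>)" if x: "x \<in> \<Xi>" for x
  proof -
    have "E x = E (\<Sum>k\<in>{1..N}. x k *\<^sub>R e k)"
      using x sub by (intro arg_cong[where f = E] expand) auto
    also have "\<dots> = (\<Sum>k\<in>{1..N}. x k *\<^sub>R E (e k))"
      by (simp add: linear_sum[OF E] linear_scale[OF E])
    finally have "E x = (\<Sum>k\<in>{1..N}. x k *\<^sub>R E (e k))" .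
    then have "E x i = (\<Sum>k\<in>{1..N}. x k * E (e k) i)"
      by (simp add: sum_fun_apply scaleR_fun_def)
    also have "\<bar>\<dots>\<bar> \<le> (\<Sum>k\<in>{1..N}. \<bar>x k * E (e k) i\<bar>)" by (rule sum_abs)
    also have "\<dots> \<le> (\<Sum>k\<in>{1..N}. b k * \<bar>E (e k) i\<bar>)"
      using b[OF x] by (intro sum_mono) (simp add: abs_mult mult_right_mono)
    finally show ?thesis .
  qed
  then show ?thesis by blast
qed

section \<open>The symmetric separation problem\<close>

text \<open>
  The index \<open>K\<close> of the last breakpoint is even and \<open>h\<close> is the index of the breakpoint 0; \<open>x\<close> is the
  scaled lifted point that is to be separated.
\<close>
locale symmetric_separation =
  fixes N :: nat and \<Xi> :: "(nat \<Rightarrow> real) set" and I :: nat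
    and E :: "(nat \<Rightarrow> real) \<Rightarrow> nat \<Rightarrow> real" and \<Theta> :: "(nat \<Rightarrow> real) set"
    and J :: "nat \<Rightarrow> nat" and z :: "nat \<Rightarrow> nat \<Rightarrow> real" and \<xi> :: "nat \<Rightarrow> nat \<Rightarrow> real" and s :: real
  assumes sep: "separation_instance N \<Xi> I E \<Theta> J z \<xi> s"
    and sym: "symmetric_instance I \<Theta> J z"
begin

abbreviation K :: nat where "K \<equiv> J 1"
abbreviation h :: nat where "h \<equiv> J 1 div 2"
abbreviation x :: "nat \<Rightarrow> nat \<Rightarrow> real" where "x \<equiv> \<xi> /\<^sub>R s"
abbreviation obj :: "(nat \<Rightarrow> real) \<times> (nat \<Rightarrow> real) \<Rightarrow> real"
  where "obj \<equiv> separation_objective I \<Theta> J z \<xi> s"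

definition \<delta> :: "nat \<Rightarrow> real" where "\<delta> u = eta \<Theta> u - eta \<Theta> (u - 1)"

lemma I_pos: "1 \<le> I"
  using sep by (simp add: separation_instance_def)

lemma \<Theta>_rspace: "\<theta> \<in> \<Theta> \<Longrightarrow> \<theta> \<in> rspace I"
  using sep unfolding separation_instance_def support_def embedding_def by blast

lemma \<Theta>_nonempty: "\<Theta> \<noteq> {}"
  using sep unfolding separation_instance_def support_def by blast

lemma \<Theta>_bounded: "\<exists>B. \<forall>\<theta>\<in>\<Theta>. \<forall>i. \<bar>\<theta> i\<bar> \<le> B"
proof -
  have "\<exists>B. \<forall>\<theta>\<in>\<Theta>. \<bar>\<theta> i\<bar> \<le> B" for i
    using linear_image_of_compact_bounded[of E \<Xi> N i] sep
    unfolding separation_instance_def support_def embedding_def by blast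
  then obtain B where B: "\<And>\<theta> i. \<theta> \<in> \<Theta> \<Longrightarrow> \<bar>\<theta> i\<bar> \<le> B i" by metis
  have "\<bar>\<theta> i\<bar> \<le> (\<Sum>i\<in>{1..I}. \<bar>B i\<bar>)" if \<theta>: "\<theta> \<in> \<Theta>" for \<theta> i
  proof (cases "i \<in> {1..I}")
    case True
    then have "\<bar>B i\<bar> \<le> (\<Sum>i\<in>{1..I}. \<bar>B i\<bar>)" by (intro member_le_sum) auto
    then show ?thesis using B[OF \<theta>, of i] by linarith
  next
    case False
    then have "\<theta> i = 0" using \<Theta>_rspace[OF \<theta>] unfolding rspace_def by blast
    then show ?thesis by (simp add: sum_nonneg)
  qed
  then show ?thesis by blast
qed

lemma \<Theta>_signed_permutation:
  assumes "\<theta> \<in> \<Theta>" "bij_betw \<pi> {1..I} {1..I}" "\<And>i. e i \<in> {-1, 1}"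
  shows "restrict_vec I (\<lambda>i. e i * \<theta> (\<pi> i)) \<in> \<Theta>"
  using signed_permutation_image assms sym unfolding symmetric_instance_def by blast

subsection \<open>Breakpoints\<close>

lemma breakpoints_strict: "i \<in> {1..I} \<Longrightarrow> strict_mono_on {0..J i} (z i)"
proof -
  assume i: "i \<in> {1..I}"
  have step: "z i (j - 1) < z i j" if "j \<in> {1..J i}" for j
    using sep i that unfolding separation_instance_def breakpoints_def by blast
  have "z i j < z i k" if "j < k" "k \<le> J i" for j k
    using that
  proof (induction k)
    case (Suc k)
    have "z i k < z i (Suc k)" using step[of "Suc k"] Suc.prems by simp
    then show ?case using Suc by (cases "j = k") auto
  qed simp
  then show ?thesis by (auto simp: strict_mono_on_def)
qed

text \<open>
  A breakpoint of one coordinate, completed by zeros, is a grid point; moving it by a signed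
  transposition shows that all coordinates have the same symmetric set of breakpoints.
\<close>
lemma signed_breakpoint:
  assumes i: "i \<in> {1..I}" and i': "i' \<in> {1..I}" and v: "v \<in> z i ` {0..J i}" and e: "e \<in> {-1, 1}"
  shows "e * v \<in> z i' ` {0..J i'}"
proof -
  define p where "p = (\<lambda>k. if k = i then v else 0)"
  have zero: "\<forall>k\<in>{1..I}. 0 \<in> z k ` {0..J k}"
    using sym by (auto simp: symmetric_instance_def grid_def zero_fun_def)
  have "p \<in> grid I J z" using zero i v by (auto simp: grid_def rspace_def p_def)
  moreover have "bij_betw (Transposition.transpose i i') {1..I} {1..I}"
    using i i' by (simp add: bij_betw_transpose_iff)
  ultimately have "restrict_vec I (\<lambda>k. (\<lambda>_. e) k * p (Transposition.transpose i i' k)) \<in> grid I J z"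
    using e sym by (intro signed_permutation_image) (auto simp: symmetric_instance_def)
  then have "\<forall>k\<in>{1..I}. restrict_vec I (\<lambda>k. e * p (Transposition.transpose i i' k)) k \<in> z k ` {0..J k}"
    unfolding grid_def by blast
  then have "e * p (Transposition.transpose i i' i') \<in> z i' ` {0..J i'}"
    using i' unfolding restrict_vec_def by presburger
  then show ?thesis by (simp add: p_def)
qed

lemma breakpoints_same:
  assumes "i \<in> {1..I}" shows "J i = K" "j \<le> K \<Longrightarrow> z i j = z 1 j"
proof -
  have "z i ` {0..J i} = z 1 ` {0..J 1}"
    using signed_breakpoint[OF assms, of 1 _ 1] signed_breakpoint[OF _ assms, of 1 _ 1] I_pos by force
  then have "J i = J 1 \<and> (\<forall>j\<le>J i. z i j = z 1 j)"
    by (intro strict_enumeration_unique breakpoints_strict) (use assms I_pos in auto)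
  then show "J i = K" "j \<le> K \<Longrightarrow> z i j = z 1 j" by auto
qed

lemma z_less: "j < k \<Longrightarrow> k \<le> K \<Longrightarrow> z 1 j < z 1 k"
  using breakpoints_strict[of 1] I_pos by (auto simp: strict_mono_on_def)

lemma z_le: "j \<le> k \<Longrightarrow> k \<le> K \<Longrightarrow> z 1 j \<le> z 1 k"
  using z_less[of j k] by (cases "j = k") auto

lemma z_less_iff: "j \<le> K \<Longrightarrow> k \<le> K \<Longrightarrow> z 1 j < z 1 k \<longleftrightarrow> j < k"
  using z_less[of j k] z_le[of k j] by linarith

lemma z_reflect: "j \<le> K \<Longrightarrow> z 1 (K - j) = - z 1 j"
proof -
  define g where "g = (\<lambda>j. - z 1 (K - j))"
  have g: "strict_mono_on {0..K} g"
    unfolding g_def strict_mono_on_def by (auto intro!: z_less)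
  have "z 1 ` {0..K} = g ` {0..K}"
  proof
    show "z 1 ` {0..K} \<subseteq> g ` {0..K}"
    proof
      fix v assume "v \<in> z 1 ` {0..K}"
      then have "-1 * v \<in> z 1 ` {0..K}" using signed_breakpoint[of 1 1 v "-1"] I_pos by simp
      then obtain j where "j \<le> K" "- v = z 1 j" by auto
      then have "v = g (K - j)" by (simp add: g_def)
      then show "v \<in> g ` {0..K}" by simp
    qed
    show "g ` {0..K} \<subseteq> z 1 ` {0..K}"
    proof
      fix v assume "v \<in> g ` {0..K}"
      then have "- v \<in> z 1 ` {0..K}" by (auto simp: g_def)
      then show "v \<in> z 1 ` {0..K}" using signed_breakpoint[of 1 1 "-v" "-1"] I_pos by simp
    qed
  qed
  then have "\<forall>j\<le>K. z 1 j = g j"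
    using strict_enumeration_unique[OF _ g, of K "z 1"] breakpoints_strict[of 1] I_pos by auto
  moreover assume "j \<le> K"
  ultimately have "z 1 j = g j" by blast
  then show ?thesis unfolding g_def by linarith
qed

lemma K_even: "K = 2 * h" and z_middle: "z 1 h = 0" and h_pos: "1 \<le> h"
proof -
  have K1: "1 \<le> K" using sep I_pos by (auto simp: separation_instance_def breakpoints_def)
  have "0 \<in> z 1 ` {0..K}"
    using sym I_pos by (auto simp: symmetric_instance_def grid_def zero_fun_def)
  then obtain j where j: "j \<le> K" "z 1 j = 0" by auto
  then have "z 1 (K - j) = 0" by (simp add: z_reflect)
  then have jj: "K - j = j" using z_less[of j "K - j"] z_less[of "K - j" j] j by force
  then have Kj: "K = 2 * j" using j by linarith
  then show "K = 2 * h" by simp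
  then have "j = h" using Kj by simp
  then show "z 1 h = 0" using j by simp
  show "1 \<le> h" using K1 \<open>K = 2 * h\<close> by auto
qed

lemma extreme_breakpoints: "i \<in> {1..I} \<Longrightarrow> z i 0 = lower I \<Theta> i \<and> z i (J i) = upper I \<Theta> i"
  using sep unfolding separation_instance_def breakpoints_def by blast

lemma lower_eq: "i \<in> {1..I} \<Longrightarrow> lower I \<Theta> i = z 1 0"
  using extreme_breakpoints[of i] breakpoints_same(2)[of i 0] by simp

lemma upper_eq: "i \<in> {1..I} \<Longrightarrow> upper I \<Theta> i = - z 1 0"
  using extreme_breakpoints[of i] breakpoints_same(1)[of i] breakpoints_same(2)[of i K] z_reflect[of 0] by simp

subsection \<open>The lifted point and its gains\<close>

text \<open>
  A later segment receives something only when the earlier ones are full. Segments of equal length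
  are compared because the inequality will be used for mirror images.
\<close>
lemma folding_monotone_fill:
  assumes "i \<in> {1..I}" and "j \<in> {1..K}" "k \<in> {1..K}" "j \<le> k"
    and "z 1 k - z 1 (k - 1) = z 1 j - z 1 (j - 1)"
  shows "folding I J z \<theta> i k \<le> folding I J z \<theta> i j"
proof (cases "j = k")
  case False
  have "z 1 j \<le> z 1 (k - 1)" using assms False by (intro z_le) auto
  moreover have "z 1 (j - 1) \<le> z 1 j" "z 1 (k - 1) \<le> z 1 k" using assms by (auto intro!: z_le)
  ultimately show ?thesis
    using assms breakpoints_same[of i]
    by (auto simp: folding_def)
qed simp

lemma x_hull: "x \<in> convex hull (folding I J z ` {lower I \<Theta>..upper I \<Theta>})"
  using sep by (auto simp: separation_instance_def outer_lifted_support_def)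

lemma x_bounds:
  assumes i: "i \<in> {1..I}" and j: "j \<in> {1..K}"
  shows "0 \<le> x i j" "x i j \<le> z 1 j - z 1 (j - 1)"
proof -
  define C where "C = {y :: nat \<Rightarrow> nat \<Rightarrow> real. 0 \<le> y i j \<and> y i j \<le> z 1 j - z 1 (j - 1)}"
  have "convex C"
    unfolding convex_def
  proof safe
    fix y y' :: "nat \<Rightarrow> nat \<Rightarrow> real" and u v :: real
    assume *: "y \<in> C" "y' \<in> C" "0 \<le> u" "0 \<le> v" "u + v = 1"
    let ?D = "z 1 j - z 1 (j - 1)"
    have "u * y i j + v * y' i j \<le> u * ?D + v * ?D"
      using * by (intro add_mono mult_left_mono) (auto simp: C_def)
    also have "\<dots> = ?D" using * by (metis distrib_right mult_1)
    finally show "u *\<^sub>R y + v *\<^sub>R y' \<in> C"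
      using * by (auto simp: C_def plus_fun_def scaleR_fun_def)
  qed
  moreover have "folding I J z ` {lower I \<Theta>..upper I \<Theta>} \<subseteq> C"
    using i j breakpoints_same[OF i] z_le[of "j - 1" j] by (auto simp: C_def folding_def)
  ultimately have "x \<in> C" using x_hull hull_minimal by blast
  then show "0 \<le> x i j" "x i j \<le> z 1 j - z 1 (j - 1)" by (auto simp: C_def)
qed

lemma x_monotone_fill:
  assumes "i \<in> {1..I}" and "j \<in> {1..K}" "k \<in> {1..K}" "j \<le> k"
    and "z 1 k - z 1 (k - 1) = z 1 j - z 1 (j - 1)"
  shows "x i k \<le> x i j"
proof -
  define C where "C = {y :: nat \<Rightarrow> nat \<Rightarrow> real. y i k \<le> y i j}"
  have "convex C"
    unfolding convex_def C_def
    by (auto simp: plus_fun_def scaleR_fun_def intro!: add_mono mult_left_mono)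
  moreover have "folding I J z ` {lower I \<Theta>..upper I \<Theta>} \<subseteq> C"
    using folding_monotone_fill[OF assms] by (auto simp: C_def)
  ultimately have "x \<in> C" using x_hull hull_minimal by blast
  then show ?thesis by (auto simp: C_def)
qed

text \<open>
  What coordinate \<open>i\<close> adds to the lifted distance when its interval shrinks from level \<open>j - 1\<close> to
  level \<open>j\<close>: the outermost segments on the two sides, \<open>K + 1 - j\<close> above and \<open>j\<close> below, become exterior.
\<close>
definition gain :: "nat \<Rightarrow> nat \<Rightarrow> real"
  where "gain i j = x i (K + 1 - j) + (z 1 j - z 1 (j - 1)) - x i j"

definition total_gain :: "nat \<Rightarrow> nat \<Rightarrow> real"
  where "total_gain i k = (\<Sum>j\<in>{1..k}. gain i j)"

text \<open>
  The upper bound is where the hull of the folded box matters: the segments \<open>j\<close> and \<open>K + 1 - j\<close> are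
  mirror images, so that \<open>x i (K + 1 - j) \<le> x i j\<close>.
\<close>
lemma gain_bounds:
  assumes i: "i \<in> {1..I}" and j: "j \<in> {1..h}"
  shows "0 \<le> gain i j" "gain i j \<le> z 1 j - z 1 (j - 1)"
proof -
  have jK: "j \<le> K" "1 \<le> j" "K + 1 - j \<in> {1..K}" "j \<le> K + 1 - j" "j \<in> {1..K}"
    using j K_even by auto
  show "0 \<le> gain i j" using x_bounds[OF i, of j] x_bounds[OF i jK(3)] jK
    by (auto simp: gain_def)
  have "z 1 (K + 1 - j) - z 1 (K + 1 - j - 1) = z 1 j - z 1 (j - 1)"
    using z_reflect[of "j - 1"] z_reflect[of j] jK by (simp add: Suc_diff_le)
  then have "x i (K + 1 - j) \<le> x i j"
    by (rule x_monotone_fill[OF i jK(5,3,4)])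
  then show "gain i j \<le> z 1 j - z 1 (j - 1)" by (simp add: gain_def)
qed

lemma total_gain_0 [simp]: "total_gain i 0 = 0"
  by (simp add: total_gain_def)

lemma total_gain_step: "1 \<le> j \<Longrightarrow> total_gain i j = total_gain i (j - 1) + gain i j"
  by (cases j) (auto simp: total_gain_def)

lemma total_gain_mono:
  assumes i: "i \<in> {1..I}" and "j \<le> k" "k \<le> h"
  shows "total_gain i j \<le> total_gain i k"
    and "total_gain i k \<le> total_gain i j + (z 1 k - z 1 j)"
proof -
  have "total_gain i j \<le> total_gain i k \<and> total_gain i k \<le> total_gain i j + (z 1 k - z 1 j)"
    using assms(2,3)
  proof (induction rule: dec_induct)
    case (step k)
    have "0 \<le> gain i (Suc k)" "gain i (Suc k) \<le> z 1 (Suc k) - z 1 k"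
      using gain_bounds[OF i, of "Suc k"] step.prems by auto
    then show ?case using step total_gain_step[of "Suc k" i] by simp
  qed simp
  then show "total_gain i j \<le> total_gain i k"
    and "total_gain i k \<le> total_gain i j + (z 1 k - z 1 j)" by auto
qed

text \<open>
  The share of coordinate \<open>i\<close> in the lifted distance from a box with corners \<open>z i m\<close> and \<open>z i p\<close>. Writing
  \<open>zm i - lower i\<close> as a sum of segment lengths makes both terms sums of nonnegative numbers.
\<close>
definition contribution :: "nat \<Rightarrow> nat \<Rightarrow> nat \<Rightarrow> real"
  where "contribution i m p =
    (\<Sum>j\<in>{p<..K}. x i j) + (\<Sum>j\<in>{1..m}. z 1 j - z 1 (j - 1) - x i j)"

lemma contribution_symmetric:
  assumes "k \<le> h"
  shows "contribution i k (K - k) = total_gain i k"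
  using assms
proof (induction k)
  case (Suc k)
  have "{K - Suc k<..K} = insert (K - k) {K - k<..K}" using Suc.prems K_even by auto
  then have "contribution i (Suc k) (K - Suc k) = contribution i k (K - k) + gain i (Suc k)"
    by (simp add: contribution_def gain_def)
  then show ?case using Suc total_gain_step[of "Suc k" i] by simp
qed (simp add: contribution_def)

lemma contribution_antimono:
  assumes i: "i \<in> {1..I}" and "m' \<le> m" "p \<le> p'" "m \<le> K"
  shows "contribution i m' p' \<le> contribution i m p"
  unfolding contribution_def
  by (intro add_mono sum_mono2) (use assms x_bounds[OF i] in \<open>force+\<close>)

lemma sum_x_le:
  assumes i: "i \<in> {1..I}" and "p \<le> q" "q \<le> K"
  shows "(\<Sum>j\<in>{p<..q}. x i j) \<le> z 1 q - z 1 p"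
    and "(\<Sum>j\<in>{p<..q}. z 1 j - z 1 (j - 1) - x i j) \<le> z 1 q - z 1 p"
proof -
  have "(\<Sum>j\<in>{p<..q}. x i j) \<le> z 1 q - z 1 p \<and>
    (\<Sum>j\<in>{p<..q}. z 1 j - z 1 (j - 1) - x i j) \<le> z 1 q - z 1 p"
    using assms(2,3)
  proof (induction rule: dec_induct)
    case (step q)
    have "{p<..Suc q} = insert (Suc q) {p<..q}" using step by auto
    moreover have "0 \<le> x i (Suc q)" "x i (Suc q) \<le> z 1 (Suc q) - z 1 q"
      using x_bounds[OF i, of "Suc q"] step.prems by auto
    ultimately show ?case using step by simp
  qed simp
  then show "(\<Sum>j\<in>{p<..q}. x i j) \<le> z 1 q - z 1 p"
    and "(\<Sum>j\<in>{p<..q}. z 1 j - z 1 (j - 1) - x i j) \<le> z 1 q - z 1 p" by auto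
qed

text \<open>
  Compares an arbitrary interval with the symmetric one of level \<open>k\<close>. Cutting the longer side of an
  interval around 0 back to its shorter side only helps, and widening costs at most the increase in half-width
  by \<open>total_gain_mono\<close>. For an interval that misses 0 the minimum on the right is negative; it is first
  moved to the origin.
\<close>
lemma contribution_le:
  assumes i: "i \<in> {1..I}" and mp: "m \<le> p" "p \<le> K" and k: "k \<le> h"
  shows "contribution i m p \<le> total_gain i k + max 0 (- z 1 k - min (z 1 p) (- z 1 m))"
proof -
  have zz: "z 1 (K - m) = - z 1 m" using mp by (intro z_reflect) auto
  define r where "r = min p (K - m)"
  have rK: "r \<le> K" using mp by (auto simp: r_def)
  have a: "min (z 1 p) (- z 1 m) = z 1 r"
    unfolding r_def zz[symmetric] using z_le[of p "K - m"] z_le[of "K - m" p] mp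
    by (auto simp: min_def)
  show ?thesis
  proof (cases "h \<le> r")
    case True
    have "contribution i m p \<le> contribution i (K - r) (K - (K - r))"
      by (rule contribution_antimono[OF i]) (use mp rK in \<open>auto simp: r_def\<close>)
    also have "\<dots> = total_gain i (K - r)"
      using True K_even by (intro contribution_symmetric) auto
    also have "\<dots> \<le> total_gain i k + max 0 (- z 1 k - z 1 r)"
    proof (cases "K - r \<le> k")
      case True
      then show ?thesis using total_gain_mono(1)[OF i True k] by linarith
    next
      case F: False
      then have "total_gain i (K - r) \<le> total_gain i k + (z 1 (K - r) - z 1 k)"
        using True K_even by (intro total_gain_mono(2)[OF i]) auto
      then show ?thesis using z_reflect[OF rK] by linarith
    qed
    finally show ?thesis unfolding a .
  next
    case False
    have mid: "contribution i h h = total_gain i h"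
      using contribution_symmetric[of h i] arg_cong[OF K_even, of "\<lambda>k. k - h"] by simp
    have "contribution i m p \<le> contribution i h h - z 1 r"
    proof (cases "p < h")
      case True
      then have r: "r = p" using mp K_even by (auto simp: r_def)
      have "contribution i m p \<le> contribution i h p"
        by (rule contribution_antimono[OF i]) (use mp True K_even in auto)
      also have split: "{p<..K} = {p<..h} \<union> {h<..K}" using True K_even by auto
      have "contribution i h p = contribution i h h + (\<Sum>j\<in>{p<..h}. x i j)"
        unfolding contribution_def split by (subst sum.union_disjoint) auto
      also have "(\<Sum>j\<in>{p<..h}. x i j) \<le> - z 1 p"
        using sum_x_le(1)[OF i, of p h] True K_even z_middle by auto
      finally show ?thesis by (simp add: r)
    next
      case F: False
      then have r: "r = K - m" "h < m" using False mp K_even by (auto simp: r_def min_def split: if_splits)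
      have "contribution i m p \<le> contribution i m h"
        by (rule contribution_antimono[OF i]) (use mp F K_even in auto)
      also have split: "{1..m} = {1..h} \<union> {h<..m}" using r by auto
      have "contribution i m h = contribution i h h + (\<Sum>j\<in>{h<..m}. z 1 j - z 1 (j - 1) - x i j)"
        unfolding contribution_def split by (subst sum.union_disjoint) auto
      also have "(\<Sum>j\<in>{h<..m}. z 1 j - z 1 (j - 1) - x i j) \<le> z 1 m"
        using sum_x_le(2)[OF i, of h m] r mp K_even z_middle by auto
      finally show ?thesis using zz by (simp add: r)
    qed
    also have "contribution i h h \<le> total_gain i k - z 1 k"
      using mid total_gain_mono(2)[OF i k] z_middle by simp
    finally show ?thesis unfolding a by linarith
  qed
qed

lemma rectangle_indices:
  assumes "(zm, zp) \<in> rectangles I J z"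
  shows "\<exists>m p. \<forall>i\<in>{1..I}. m i \<le> p i \<and> p i \<le> K \<and> zm i = z 1 (m i) \<and> zp i = z 1 (p i)"
proof -
  have "\<exists>m p. m \<le> p \<and> p \<le> K \<and> zm i = z 1 m \<and> zp i = z 1 p" if i: "i \<in> {1..I}" for i
  proof -
    have "zm i \<in> z i ` {0..J i}" "zp i \<in> z i ` {0..J i}" "zm i \<le> zp i"
      using assms i by (auto simp: rectangles_def grid_def le_fun_def)
    then obtain m p where mp: "m \<le> K" "p \<le> K" "zm i = z 1 m" "zp i = z 1 p"
      using breakpoints_same[OF i] by (auto; metis)
    then have "m \<le> p" using z_less[of p m] \<open>zm i \<le> zp i\<close> by force
    then show ?thesis using mp by blast
  qed
  then show ?thesis by metis
qed

lemma dlift_eq: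
  assumes idx: "\<forall>i\<in>{1..I}. m i \<le> p i \<and> p i \<le> K \<and> zm i = z 1 (m i) \<and> zp i = z 1 (p i)"
  shows "dlift I \<Theta> J z x (zm, zp) = (\<Sum>i\<in>{1..I}. contribution i (m i) (p i))"
  unfolding dlift_def prod.case
proof (rule sum.cong)
  fix i assume i: "i \<in> {1..I}"
  have ip: "m i \<le> p i" "p i \<le> K" "zm i = z 1 (m i)" "zp i = z 1 (p i)" using idx i by auto
  have zi: "z i j = z 1 j" if "j \<in> {1..K}" for j using breakpoints_same[OF i] that by auto
  have 1: "{j. j \<in> {1..J i} \<and> zp i < z i j} = {p i<..K}"
    using ip zi z_less_iff[of "p i"] breakpoints_same(1)[OF i] by auto
  have 2: "{j. j \<in> {1..J i} \<and> z i j \<le> zm i} = {1..m i}"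
    using ip zi z_less_iff[of "m i"] breakpoints_same(1)[OF i]
    by (auto simp: not_less[symmetric])
  have "(\<Sum>j\<in>{1..m'}. z 1 j - z 1 (j - 1)) = z 1 m' - z 1 0" for m'
    by (induction m') auto
  then have 3: "(\<Sum>j\<in>{1..m i}. z 1 j - z 1 (j - 1) - x i j) = z 1 (m i) - z 1 0 - (\<Sum>j\<in>{1..m i}. x i j)"
    by (simp add: sum_subtractf)
  show "(\<Sum>j | j \<in> {1..J i} \<and> zp i < z i j. x i j) + zm i - lower I \<Theta> i
      - (\<Sum>j | j \<in> {1..J i} \<and> zm i \<ge> z i j. x i j) = contribution i (m i) (p i)"
    unfolding 1 2 contribution_def 3 using ip lower_eq[OF i] by simp
qed simp


subsection \<open>Distances to hyperrectangles\<close>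

definition outside :: "(nat \<Rightarrow> real) \<times> (nat \<Rightarrow> real) \<Rightarrow> (nat \<Rightarrow> real) \<Rightarrow> real"
  where "outside R \<theta> = (\<Sum>i\<in>{1..I}. max 0 (max (\<theta> i - snd R i) (fst R i - \<theta> i)))"

text \<open>
  The nearest point of a box is found by clamping each coordinate.
\<close>
lemma INF_l1_dist:
  assumes R: "(zm, zp) \<in> rectangles I J z" and \<theta>: "\<theta> \<in> rspace I"
  shows "(INF \<theta>'\<in>{zm..zp}. l1_dist I \<theta> \<theta>') = outside (zm, zp) \<theta>"
proof (rule cInf_eq_minimum)
  have le: "zm i \<le> zp i" for i using R by (auto simp: rectangles_def le_fun_def)
  define p where "p = (\<lambda>i. max (zm i) (min (zp i) (\<theta> i)))"
  have "p \<in> {zm..zp}" using le by (auto simp: p_def le_fun_def)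
  moreover have "l1_dist I \<theta> p = outside (zm, zp) \<theta>"
    unfolding l1_dist_def outside_def
  proof (rule sum.cong)
    fix i
    show "\<bar>\<theta> i - p i\<bar> = max 0 (max (\<theta> i - snd (zm, zp) i) (fst (zm, zp) i - \<theta> i))"
      using le[of i] by (auto simp: p_def max_def min_def)
  qed simp
  ultimately show "outside (zm, zp) \<theta> \<in> l1_dist I \<theta> ` {zm..zp}" by (metis imageI)
next
  fix v assume "v \<in> l1_dist I \<theta> ` {zm..zp}"
  then obtain p where p: "zm \<le> p" "p \<le> zp" "v = l1_dist I \<theta> p" by auto
  have "max 0 (max (\<theta> i - snd (zm, zp) i) (fst (zm, zp) i - \<theta> i)) \<le> \<bar>\<theta> i - p i\<bar>" for i
    using le_funD[OF p(1), of i] le_funD[OF p(2), of i] by auto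
  then show "outside (zm, zp) \<theta> \<le> v"
    unfolding p(3) outside_def l1_dist_def by (intro sum_mono)
qed

lemma dbar_eq_SUP_outside:
  assumes "R \<in> rectangles I J z"
  shows "dbar I \<Theta> {fst R..snd R} = (SUP \<theta>\<in>\<Theta>. outside R \<theta>)"
  unfolding dbar_def using assms by (intro SUP_cong refl) (cases R, simp add: INF_l1_dist \<Theta>_rspace)

lemma outside_bdd: "bdd_above (outside R ` \<Theta>)"
proof -
  obtain B where B: "\<And>\<theta> i. \<theta> \<in> \<Theta> \<Longrightarrow> \<bar>\<theta> i\<bar> \<le> B" using \<Theta>_bounded by blast
  show ?thesis
  proof (rule bdd_aboveI2)
    fix \<theta> assume "\<theta> \<in> \<Theta>"
    then have "max 0 (max (\<theta> i - snd R i) (fst R i - \<theta> i)) \<le> B + \<bar>snd R i\<bar> + \<bar>fst R i\<bar>" for i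
      using B[of \<theta> i] by linarith
    then show "outside R \<theta> \<le> (\<Sum>i\<in>{1..I}. B + \<bar>snd R i\<bar> + \<bar>fst R i\<bar>)"
      unfolding outside_def by (intro sum_mono)
  qed
qed

lemma eta_bdd: "bdd_above ((\<lambda>\<theta>. \<Sum>k\<in>{1..u}. \<bar>\<theta> k\<bar>) ` \<Theta>)"
proof -
  obtain B where B: "\<And>\<theta> i. \<theta> \<in> \<Theta> \<Longrightarrow> \<bar>\<theta> i\<bar> \<le> B" using \<Theta>_bounded by blast
  show ?thesis
    by (rule bdd_aboveI2[where M = "\<Sum>k\<in>{1..u}. B"]) (intro sum_mono B)
qed

lemma eta_upper: "\<theta> \<in> \<Theta> \<Longrightarrow> (\<Sum>k\<in>{1..u}. \<bar>\<theta> k\<bar>) \<le> eta \<Theta> u"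
  unfolding eta_def by (rule cSUP_upper[OF _ eta_bdd])

lemma eta_0 [simp]: "eta \<Theta> 0 = 0"
  using \<Theta>_nonempty by (simp add: eta_def)

lemma eta_eq_sum_\<delta>: "eta \<Theta> t = sum \<delta> {1..t}"
  by (induction t) (auto simp: \<delta>_def)

lemma \<delta>_nonneg: "0 \<le> \<delta> u"
proof -
  have "eta \<Theta> (u - 1) \<le> eta \<Theta> u"
    unfolding eta_def
    by (rule cSUP_subset_mono[OF \<Theta>_nonempty eta_bdd order_refl]) (auto intro!: sum_mono2)
  then show ?thesis by (simp add: \<delta>_def)
qed

lemma \<delta>_antimono:
  assumes "1 \<le> u" "u \<le> v" "v \<le> I" shows "\<delta> v \<le> \<delta> u"
  using assms(2,3)
proof (induction rule: dec_induct)
  case (step v)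
  have "eta \<Theta> (v + 1) - eta \<Theta> v \<le> eta \<Theta> v - eta \<Theta> (v - 1)"
    using sym step.hyps step.prems assms(1) unfolding symmetric_instance_def by auto
  then have "\<delta> (Suc v) \<le> \<delta> v" by (simp add: \<delta>_def Suc_eq_plus1)
  then show ?case using step by auto
qed auto

lemma \<Theta>_component_le: "\<theta> \<in> \<Theta> \<Longrightarrow> i \<in> {1..I} \<Longrightarrow> \<bar>\<theta> i\<bar> \<le> - z 1 0"
proof -
  assume \<theta>: "\<theta> \<in> \<Theta>" and i: "i \<in> {1..I}"
  obtain B where B: "\<And>\<theta> i. \<theta> \<in> \<Theta> \<Longrightarrow> \<bar>\<theta> i\<bar> \<le> B" using \<Theta>_bounded by blast
  have "bdd_above ((\<lambda>\<theta>. \<theta> i) ` \<Theta>)" using B by (intro bdd_aboveI2[where M = B]) (simp add: abs_le_iff)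
  then have "\<theta> i \<le> (SUP \<theta>\<in>\<Theta>. \<theta> i)" by (rule cSUP_upper[OF \<theta>])
  then have "\<theta> i \<le> upper I \<Theta> i" using i by (simp add: upper_def restrict_vec_def)
  moreover have "bdd_below ((\<lambda>\<theta>. \<theta> i) ` \<Theta>)"
    using B[THEN abs_le_D2] by (intro bdd_belowI2[where m = "- B"]) (simp add: minus_le_iff)
  then have "(INF \<theta>\<in>\<Theta>. \<theta> i) \<le> \<theta> i" by (rule cINF_lower[OF _ \<theta>])
  then have "lower I \<Theta> i \<le> \<theta> i" using i by (simp add: lower_def restrict_vec_def)
  ultimately show ?thesis using upper_eq[OF i] lower_eq[OF i] by linarith
qed

lemma \<delta>_1_le: "\<delta> 1 \<le> - z 1 0"
proof -
  have "eta \<Theta> 1 \<le> - z 1 0"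
    unfolding eta_def using \<Theta>_nonempty \<Theta>_component_le[of _ 1] I_pos by (intro cSUP_least) auto
  then show ?thesis by (simp add: \<delta>_def)
qed

text \<open>
  Given a point of \<open>\<Theta>\<close>, move its \<open>u\<close>-th coordinate to position \<open>\<sigma> u\<close> and give it the sign that
  points to the nearer face of the box.
\<close>
lemma dbar_ge_prefix:
  assumes R: "R \<in> rectangles I J z" and \<sigma>: "bij_betw \<sigma> {1..I} {1..I}" and t: "t \<le> I"
  shows "(\<Sum>u\<in>{1..t}. \<delta> u - min (snd R (\<sigma> u)) (- fst R (\<sigma> u))) \<le> dbar I \<Theta> {fst R..snd R}"
proof -
  define a where "a i = min (snd R i) (- fst R i)" for i
  have "eta \<Theta> t \<le> dbar I \<Theta> {fst R..snd R} + (\<Sum>u\<in>{1..t}. a (\<sigma> u))"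
    unfolding eta_def
  proof (rule cSUP_least[OF \<Theta>_nonempty])
    fix \<theta> assume \<theta>: "\<theta> \<in> \<Theta>"
    define \<pi> where "\<pi> = inv_into {1..I} \<sigma>"
    have \<pi>: "bij_betw \<pi> {1..I} {1..I}" unfolding \<pi>_def by (rule bij_betw_inv_into[OF \<sigma>])
    have \<pi>\<sigma>: "\<pi> (\<sigma> u) = u" if "u \<in> {1..I}" for u
      unfolding \<pi>_def using bij_betw_inv_into_left[OF \<sigma> that] .
    \<comment> \<open>the sign that makes \<open>e i * \<theta> (\<pi> i)\<close> point upwards exactly when the upper face is the nearer one\<close>
    define e :: "nat \<Rightarrow> real" where
      "e i = (if (snd R i \<le> - fst R i) = (0 \<le> \<theta> (\<pi> i)) then 1 else -1)" for i
    define \<theta>' where "\<theta>' = restrict_vec I (\<lambda>i. e i * \<theta> (\<pi> i))"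
    have \<theta>': "\<theta>' \<in> \<Theta>" unfolding \<theta>'_def by (rule \<Theta>_signed_permutation[OF \<theta> \<pi>]) (simp add: e_def)
    have bij_t: "inj_on \<sigma> {1..t}"
      by (rule inj_on_subset[OF bij_betw_imp_inj_on[OF \<sigma>]]) (use t in auto)
    have img_t: "\<sigma> ` {1..t} \<subseteq> {1..I}" using bij_betw_imp_surj_on[OF \<sigma>] t by auto
    have "(\<Sum>u\<in>{1..t}. \<bar>\<theta> u\<bar> - a (\<sigma> u))
        \<le> (\<Sum>u\<in>{1..t}. max 0 (max (\<theta>' (\<sigma> u) - snd R (\<sigma> u)) (fst R (\<sigma> u) - \<theta>' (\<sigma> u))))"
    proof (rule sum_mono)
      fix u assume u: "u \<in> {1..t}"
      then have "\<sigma> u \<in> {1..I}" using img_t by blast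
      then have "\<theta>' (\<sigma> u) = e (\<sigma> u) * \<theta> u"
        using \<pi>\<sigma>[of u] u t by (simp add: \<theta>'_def restrict_vec_def)
      then show "\<bar>\<theta> u\<bar> - a (\<sigma> u)
          \<le> max 0 (max (\<theta>' (\<sigma> u) - snd R (\<sigma> u)) (fst R (\<sigma> u) - \<theta>' (\<sigma> u)))"
        using \<pi>\<sigma>[of u] u t by (auto simp: e_def a_def)
    qed
    also have "\<dots> = (\<Sum>i\<in>\<sigma> ` {1..t}. max 0 (max (\<theta>' i - snd R i) (fst R i - \<theta>' i)))"
      by (simp add: sum.reindex[OF bij_t])
    also have "\<dots> \<le> outside R \<theta>'"
      unfolding outside_def by (rule sum_mono2) (use img_t in auto)
    also have "\<dots> \<le> dbar I \<Theta> {fst R..snd R}"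
      unfolding dbar_eq_SUP_outside[OF R] by (rule cSUP_upper[OF \<theta>' outside_bdd])
    finally show "(\<Sum>k\<in>{1..t}. \<bar>\<theta> k\<bar>) \<le> dbar I \<Theta> {fst R..snd R} + (\<Sum>u\<in>{1..t}. a (\<sigma> u))"
      by (simp add: sum_subtractf)
  qed
  then show ?thesis by (simp add: sum_subtractf eta_eq_sum_\<delta> a_def)
qed

lemma dbar_ge_sorted:
  assumes R: "R \<in> rectangles I J z" and \<sigma>: "bij_betw \<sigma> {1..I} {1..I}"
    and mono: "mono_on {1..I} (\<lambda>u. min (snd R (\<sigma> u)) (- fst R (\<sigma> u)))"
  shows "(\<Sum>u\<in>{1..I}. max 0 (\<delta> u - min (snd R (\<sigma> u)) (- fst R (\<sigma> u)))) \<le> dbar I \<Theta> {fst R..snd R}"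
proof -
  define c where "c u = \<delta> u - min (snd R (\<sigma> u)) (- fst R (\<sigma> u))" for u
  have "c v \<le> c u" if "1 \<le> u" "u \<le> v" "v \<le> I" for u v
    using \<delta>_antimono[OF that] mono_onD[OF mono, of u v] that unfolding c_def by fastforce
  then obtain t where "t \<le> I" "(\<Sum>u\<in>{1..I}. max 0 (c u)) = sum c {1..t}"
    using sum_positive_part_antimono[of I c] by blast
  then show ?thesis using dbar_ge_prefix[OF R \<sigma>, of t] by (simp add: c_def)
qed

text \<open>
  Sorting the coordinates by decreasing absolute value stays inside \<open>\<Theta>\<close> and collects at least as much
  in the first \<open>card T\<close> positions as was in \<open>T\<close>.
\<close>
lemma sum_abs_le_eta:
  assumes \<theta>: "\<theta> \<in> \<Theta>" and T: "T \<subseteq> {1..I}"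
  shows "(\<Sum>i\<in>T. \<bar>\<theta> i\<bar>) \<le> eta \<Theta> (card T)"
proof -
  obtain \<rho> where \<rho>: "bij_betw \<rho> {1..I} {1..I}" "mono_on {1..I} (\<lambda>u. - \<bar>\<theta> (\<rho> u)\<bar>)"
    using sorting_permutation[of I "\<lambda>i. - \<bar>\<theta> i\<bar>"] by (elim exE conjE) (rule that)
  define X where "X = {u \<in> {1..I}. \<rho> u \<in> T}"
  have X: "bij_betw \<rho> X T" unfolding X_def by (rule bij_betw_preimage[OF \<rho>(1) T])
  have cX: "card X = card T" "card X \<le> I"
    using bij_betw_same_card[OF X] card_mono[OF _ T] by auto
  have "(\<Sum>u\<in>{1..card X}. - \<bar>\<theta> (\<rho> u)\<bar>) \<le> (\<Sum>u\<in>X. - \<bar>\<theta> (\<rho> u)\<bar>)"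
    by (rule sum_initial_segment_le[OF \<rho>(2)]) (auto simp: X_def)
  then have "(\<Sum>i\<in>T. \<bar>\<theta> i\<bar>) \<le> (\<Sum>u\<in>{1..card T}. \<bar>\<theta> (\<rho> u)\<bar>)"
    by (simp add: sum_negf cX sum.reindex_bij_betw[OF X, of "\<lambda>i. \<bar>\<theta> i\<bar>"])
  also have "\<dots> = (\<Sum>u\<in>{1..card T}. \<bar>restrict_vec I (\<lambda>i. 1 * \<theta> (\<rho> i)) u\<bar>)"
    using cX by (intro sum.cong) (auto simp: restrict_vec_def)
  also have "\<dots> \<le> eta \<Theta> (card T)"
    using \<Theta>_signed_permutation[OF \<theta> \<rho>(1), of "\<lambda>_. 1"] by (intro eta_upper) simp
  finally show ?thesis .
qed

text \<open>
  For the upper bound, only the coordinates \<open>T\<close> of a point that stick out of the box count; their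
  half-widths sum to at least that of the \<open>card T\<close> smallest ones.
\<close>
lemma dbar_symmetric_box:
  assumes R: "(\<lambda>i. - a i, a) \<in> rectangles I J z" and \<sigma>: "bij_betw \<sigma> {1..I} {1..I}"
    and mono: "mono_on {1..I} (\<lambda>u. a (\<sigma> u))"
  shows "dbar I \<Theta> {\<lambda>i. - a i..a} = (\<Sum>u\<in>{1..I}. max 0 (\<delta> u - a (\<sigma> u)))"
proof (rule antisym)
  show "(\<Sum>u\<in>{1..I}. max 0 (\<delta> u - a (\<sigma> u))) \<le> dbar I \<Theta> {\<lambda>i. - a i..a}"
    using dbar_ge_sorted[OF R \<sigma>] mono by simp
  have a0: "0 \<le> a i" for i using R by (auto simp: rectangles_def le_fun_def dest!: spec[of _ i])
  have "outside (\<lambda>i. - a i, a) \<theta> \<le> (\<Sum>u\<in>{1..I}. max 0 (\<delta> u - a (\<sigma> u)))" if \<theta>: "\<theta> \<in> \<Theta>" for \<theta>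
  proof -
    define T where "T = {i \<in> {1..I}. a i < \<bar>\<theta> i\<bar>}"
    define X where "X = {u \<in> {1..I}. \<sigma> u \<in> T}"
    have T: "T \<subseteq> {1..I}" by (auto simp: T_def)
    have X: "bij_betw \<sigma> X T" unfolding X_def by (rule bij_betw_preimage[OF \<sigma> T])
    have cX: "card X = card T" "card T \<le> I"
      using bij_betw_same_card[OF X] card_mono[OF _ T] by auto
    have "outside (\<lambda>i. - a i, a) \<theta> = (\<Sum>i\<in>T. \<bar>\<theta> i\<bar> - a i)"
      unfolding outside_def
    proof (rule sum.mono_neutral_cong_right)
      show "\<forall>i\<in>{1..I} - T. max 0 (max (\<theta> i - snd (\<lambda>i. - a i, a) i) (fst (\<lambda>i. - a i, a) i - \<theta> i)) = 0"
        by (auto simp: T_def)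
      show "max 0 (max (\<theta> i - snd (\<lambda>i. - a i, a) i) (fst (\<lambda>i. - a i, a) i - \<theta> i)) = \<bar>\<theta> i\<bar> - a i"
        if "i \<in> T" for i
        using that a0[of i] by (auto simp: T_def)
    qed (use T in auto)
    also have "\<dots> = (\<Sum>i\<in>T. \<bar>\<theta> i\<bar>) - (\<Sum>u\<in>X. a (\<sigma> u))"
      by (simp add: sum_subtractf sum.reindex_bij_betw[OF X])
    also have "\<dots> \<le> eta \<Theta> (card T) - (\<Sum>u\<in>{1..card X}. a (\<sigma> u))"
      by (intro diff_mono sum_abs_le_eta[OF \<theta> T] sum_initial_segment_le[OF mono]) (auto simp: X_def)
    also have "\<dots> = (\<Sum>u\<in>{1..card T}. \<delta> u - a (\<sigma> u))"
      by (simp add: eta_eq_sum_\<delta> sum_subtractf cX)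
    also have "\<dots> \<le> (\<Sum>u\<in>{1..card T}. max 0 (\<delta> u - a (\<sigma> u)))" by (intro sum_mono) simp
    also have "\<dots> \<le> (\<Sum>u\<in>{1..I}. max 0 (\<delta> u - a (\<sigma> u)))"
      by (rule sum_mono2) (use cX in auto)
    finally show ?thesis .
  qed
  then show "dbar I \<Theta> {\<lambda>i. - a i..a} \<le> (\<Sum>u\<in>{1..I}. max 0 (\<delta> u - a (\<sigma> u)))"
    using dbar_eq_SUP_outside[OF R] \<Theta>_nonempty by (auto intro!: cSUP_least)
qed


subsection \<open>Reduction to two adjacent widths\<close>

definition two_level :: "nat \<Rightarrow> nat set \<Rightarrow> (nat \<Rightarrow> real) \<times> (nat \<Rightarrow> real)"
  where "two_level j S =
    (restrict_vec I (\<lambda>i. if i \<in> S then z 1 j else z 1 (j - 1)),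
     restrict_vec I (\<lambda>i. if i \<in> S then - z 1 j else - z 1 (j - 1)))"

definition two_level_value :: "nat \<Rightarrow> nat set \<Rightarrow> real"
  where "two_level_value j S =
    (\<Sum>i\<in>{1..I}. if i \<in> S then total_gain i j else total_gain i (j - 1))
    - (\<Sum>u\<in>{1..I}. max 0 (\<delta> u + (if u \<le> card S then z 1 j else z 1 (j - 1))))"

definition square_value :: "nat \<Rightarrow> real"
  where "square_value k =
    (\<Sum>i\<in>{1..I}. total_gain i k) - (\<Sum>u\<in>{1..I}. max 0 (\<delta> u + z 1 k))"

lemma two_level_indices:
  assumes j: "j \<in> {1..h}"
  shows "\<forall>i\<in>{1..I}. (if i \<in> S then j else j - 1) \<le> K - (if i \<in> S then j else j - 1) \<and>
    K - (if i \<in> S then j else j - 1) \<le> K \<and>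
    fst (two_level j S) i = z 1 (if i \<in> S then j else j - 1) \<and>
    snd (two_level j S) i = z 1 (K - (if i \<in> S then j else j - 1))"
proof -
  have "j \<le> K - j" "j - 1 \<le> K - (j - 1)" "j \<le> K" "j - 1 \<le> K" using j K_even by auto
  then show ?thesis by (auto simp: two_level_def restrict_vec_def z_reflect)
qed

lemma two_level_rectangle:
  assumes j: "j \<in> {1..h}"
  shows "two_level j S \<in> rectangles I J z"
proof -
  note idx = two_level_indices[OF j, of S]
  have out: "fst (two_level j S) i = 0" "snd (two_level j S) i = 0" if "i \<notin> {1..I}" for i
    using that by (auto simp: two_level_def restrict_vec_def)
  have grid: "z 1 k \<in> z i ` {0..J i}" if "i \<in> {1..I}" "k \<le> K" for i k
    using breakpoints_same[OF that(1)] that(2) by auto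
  have jK: "j \<le> K" "j - 1 \<le> K" using j K_even by auto
  have "fst (two_level j S) i \<in> z i ` {0..J i}" "snd (two_level j S) i \<in> z i ` {0..J i}"
    if i: "i \<in> {1..I}" for i
    using bspec[OF idx i] grid[OF i] jK by auto
  moreover have "fst (two_level j S) i \<le> snd (two_level j S) i" for i
  proof (cases "i \<in> {1..I}")
    case True
    then show ?thesis using bspec[OF idx True] by (auto intro!: z_le split del: if_split)
  qed (simp add: out)
  ultimately have "(fst (two_level j S), snd (two_level j S)) \<in> rectangles I J z"
    using out unfolding rectangles_def grid_def rspace_def le_fun_def by blast
  then show ?thesis by simp
qed

text \<open>
  Any permutation that sorts the half-widths lists the coordinates of \<open>S\<close> first.
\<close>
lemma obj_two_level:
  assumes j: "j \<in> {1..h}" and S: "S \<subseteq> {1..I}"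
  shows "obj (two_level j S) = two_level_value j S"
proof -
  have jK: "j \<le> h" "j - 1 \<le> h" "j \<le> K" "j - 1 \<le> K" using j K_even by auto
  have zj: "z 1 (j - 1) < z 1 j" using j jK by (intro z_less) auto
  define a where "a = snd (two_level j S)"
  have tl: "two_level j S = (\<lambda>i. - a i, a)"
    by (auto simp: a_def two_level_def restrict_vec_def)
  have ain: "a i = (if i \<in> S then - z 1 j else - z 1 (j - 1))" if "i \<in> {1..I}" for i
    using that by (auto simp: a_def two_level_def restrict_vec_def)
  obtain \<sigma> where \<sigma>: "bij_betw \<sigma> {1..I} {1..I}" and mono: "mono_on {1..I} (\<lambda>u. a (\<sigma> u))"
    using sorting_permutation[of I a] by blast
  have \<sigma>_in: "\<sigma> u \<in> {1..I}" if "u \<in> {1..I}" for u using bij_betwE[OF \<sigma>] that by blast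
  define X where "X = {u \<in> {1..I}. \<sigma> u \<in> S}"
  have "card X = card S"
    using bij_betw_same_card[OF bij_betw_preimage[OF \<sigma> S]] by (simp add: X_def)
  moreover have "X = {1..card X}"
  proof (rule down_closed_eq_initial_segment)
    show "X \<subseteq> {1..I}" by (auto simp: X_def)
    fix u v assume v: "v \<in> X" and u: "1 \<le> u" "u \<le> v"
    then have uv: "u \<in> {1..I}" "v \<in> {1..I}" "\<sigma> v \<in> S" by (auto simp: X_def)
    have "a (\<sigma> u) \<le> a (\<sigma> v)" using mono_onD[OF mono uv(1,2) u(2)] .
    then have "\<sigma> u \<in> S"
      using ain[OF \<sigma>_in[OF uv(1)]] ain[OF \<sigma>_in[OF uv(2)]] uv(3) zj by (simp split: if_splits)
    then show "u \<in> X" using uv by (simp add: X_def)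
  qed
  ultimately have X: "X = {1..card S}" by simp
  have a\<sigma>: "a (\<sigma> u) = - (if u \<le> card S then z 1 j else z 1 (j - 1))" if u: "u \<in> {1..I}" for u
  proof -
    have "\<sigma> u \<in> S \<longleftrightarrow> u \<le> card S" using X u by (auto simp: X_def set_eq_iff)
    then show ?thesis using ain[OF \<sigma>_in[OF u]] by simp
  qed
  have "dbar I \<Theta> {\<lambda>i. - a i..a} = (\<Sum>u\<in>{1..I}. max 0 (\<delta> u - a (\<sigma> u)))"
    by (rule dbar_symmetric_box[OF _ \<sigma> mono]) (use two_level_rectangle[OF j, of S] tl in simp)
  also have "\<dots> = (\<Sum>u\<in>{1..I}. max 0 (\<delta> u + (if u \<le> card S then z 1 j else z 1 (j - 1))))"
    by (intro sum.cong refl) (simp add: a\<sigma>)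
  finally have D: "dbar I \<Theta> {\<lambda>i. - a i..a} = \<dots>" .
  have "dlift I \<Theta> J z x (fst (two_level j S), snd (two_level j S))
      = (\<Sum>i\<in>{1..I}. contribution i (if i \<in> S then j else j - 1) (K - (if i \<in> S then j else j - 1)))"
    by (rule dlift_eq) (rule two_level_indices[OF j])
  also have "\<dots> = (\<Sum>i\<in>{1..I}. if i \<in> S then total_gain i j else total_gain i (j - 1))"
    by (intro sum.cong refl) (simp add: contribution_symmetric jK)
  finally show ?thesis
    unfolding separation_objective_def two_level_value_def using D tl by simp
qed

lemma square_eq_two_level:
  shows "1 \<le> k \<Longrightarrow> square I z k = two_level k {1..I}" and "square I z 0 = two_level 1 {}"
  by (auto simp: square_def two_level_def restrict_vec_def)

lemma square_rectangle: "k \<le> h \<Longrightarrow> square I z k \<in> rectangles I J z"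
  using square_eq_two_level two_level_rectangle[of k] two_level_rectangle[of 1] h_pos
  by (cases "k = 0") auto

lemma two_level_value_square:
  shows "two_level_value k {1..I} = square_value k" and "two_level_value j {} = square_value (j - 1)"
  unfolding two_level_value_def square_value_def
  by (auto intro!: arg_cong2[where f = "(-)"] sum.cong)

lemma obj_square:
  assumes "k \<le> h" shows "obj (square I z k) = square_value k"
proof (cases "k = 0")
  case True
  then show ?thesis
    using obj_two_level[of 1 "{}"] h_pos two_level_value_square(2)[of 1] square_eq_two_level(2) by simp
next
  case False
  then show ?thesis
    using obj_two_level[of k "{1..I}"] assms two_level_value_square(1)[of k] square_eq_two_level(1)[of k]
    by simp
qed

lemma square_value_0 [simp]: "square_value 0 = 0"
proof -
  have "\<delta> u + z 1 0 \<le> 0" if "u \<in> {1..I}" for u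
    using \<delta>_antimono[of 1 u] \<delta>_1_le that by auto
  then have "(\<Sum>u\<in>{1..I}. max 0 (\<delta> u + z 1 0)) = 0" by (intro sum.neutral) auto
  then show ?thesis by (simp add: square_value_def)
qed

text \<open>
  The level \<open>j\<close> is the last one at which every sorted half-width above \<open>- z 1 j\<close> meets a \<open>\<delta> u\<close> of at
  most \<open>- z 1 (j - 1)\<close>. Half-widths up to \<open>- z 1 j\<close> are rounded to \<open>- z 1 j\<close>, the others to \<open>- z 1 (j - 1)\<close>,
  and both roundings improve the objective coordinate by coordinate. The last conclusion
  records the choice of \<open>j\<close> for the case of squares.
\<close>
lemma rectangle_le_two_level:
  assumes R: "R \<in> rectangles I J z"
  obtains j S where "j \<in> {1..h}" "S \<subseteq> {1..I}" "obj R \<le> two_level_value j S"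
    "\<And>u. card S < u \<Longrightarrow> u \<le> I \<Longrightarrow> \<delta> u \<le> - z 1 (j - 1)"
proof -
  obtain zm zp where Req: "R = (zm, zp)" by (cases R)
  obtain m p where idx: "\<forall>i\<in>{1..I}. m i \<le> p i \<and> p i \<le> K \<and> zm i = z 1 (m i) \<and> zp i = z 1 (p i)"
    using rectangle_indices R Req by blast
  define a where "a i = min (zp i) (- zm i)" for i
  have a_grid: "\<exists>r\<le>K. a i = z 1 r" if i: "i \<in> {1..I}" for i
  proof -
    have "m i \<le> p i" "p i \<le> K" "zm i = z 1 (m i)" "zp i = z 1 (p i)" using idx i by auto
    moreover from this have "m i \<le> K" by linarith
    moreover from this have "z 1 (K - m i) = - z 1 (m i)" by (rule z_reflect)
    ultimately show ?thesis unfolding a_def min_def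
      by (metis diff_le_self)
  qed
  obtain \<sigma> where \<sigma>: "bij_betw \<sigma> {1..I} {1..I}" and mono: "mono_on {1..I} (\<lambda>u. a (\<sigma> u))"
    using sorting_permutation[of I a] by blast
  have \<sigma>_in: "\<sigma> u \<in> {1..I}" if "u \<in> {1..I}" for u using bij_betwE[OF \<sigma>] that by blast
  define b where "b u = a (\<sigma> u)" for u
  have b_mono: "b u \<le> b v" if "u \<in> {1..I}" "v \<in> {1..I}" "u \<le> v" for u v
    using mono_onD[OF mono that] by (simp add: b_def)
  \<comment> \<open>no grid value lies strictly between consecutive half-widths\<close>
  have b_gap: "- z 1 j \<le> b u" if u: "u \<in> {1..I}" and j: "j < K" "- z 1 (Suc j) < b u" for u j
  proof -
    obtain r where r: "r \<le> K" "b u = z 1 r" using a_grid[OF \<sigma>_in[OF u]] by (auto simp: b_def)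
    have "z 1 (K - Suc j) < z 1 r" using r j z_reflect[of "Suc j"] by simp
    then have "K - j \<le> r" using z_less_iff[of "K - Suc j" r] r j by simp
    then show ?thesis using z_le[of "K - j" r] r z_reflect[of j] j by simp
  qed
  define P where "P j \<longleftrightarrow> (\<forall>u\<in>{1..I}. - z 1 j < b u \<longrightarrow> \<delta> u \<le> - z 1 (j - 1))" for j
  have "P 1" using \<delta>_antimono[of 1] \<delta>_1_le by (force simp: P_def)
  \<comment> \<open>the set is nonempty because \<open>\<delta> 1\<close> does not exceed the half-width of the whole box\<close>
  define j where "j = Max {j \<in> {1..h}. P j}"
  have fin: "finite {j \<in> {1..h}. P j}" by simp
  have "1 \<in> {j \<in> {1..h}. P j}" using \<open>P 1\<close> h_pos by simp
  then have "j \<in> {j \<in> {1..h}. P j}" unfolding j_def by (intro Max_in fin) blast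
  then have j: "j \<in> {1..h}" "P j" by auto
  have j_max: "\<not> P (Suc j)" if "Suc j \<le> h"
  proof
    assume "P (Suc j)"
    then have "Suc j \<in> {j \<in> {1..h}. P j}" using that by simp
    from Max_ge[OF fin this] show False unfolding j_def[symmetric] by simp
  qed
  have jK: "j \<le> h" "j - 1 \<le> h" "j \<le> K" "j < K" "j - 1 < K" using j K_even h_pos by auto
  have zj: "z 1 (j - 1) < z 1 j" using j jK by (intro z_less) auto
  \<comment> \<open>the narrow coordinates that get widened face a \<open>\<delta> u\<close> of at least their new half-width\<close>
  have low: "- z 1 j \<le> \<delta> u" if u: "u \<in> {1..I}" and bu: "b u < - z 1 j" for u
  proof (cases "j = h")
    case True
    then show ?thesis using z_middle \<delta>_nonneg[of u] by simp
  next
    case False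
    then obtain v where v: "v \<in> {1..I}" "- z 1 (Suc j) < b v" "- z 1 j < \<delta> v"
      using j_max jK by (auto simp: P_def not_le)
    have "\<not> v \<le> u" using b_mono[OF v(1) u] b_gap[OF v(1) jK(4) v(2)] bu by linarith
    then have "\<delta> v \<le> \<delta> u" using u v(1) by (intro \<delta>_antimono) auto
    then show ?thesis using v(3) by simp
  qed
  define U where "U = {u \<in> {1..I}. b u \<le> - z 1 j}"
  have U: "U = {1..card U}"
  proof (rule down_closed_eq_initial_segment)
    show "U \<subseteq> {1..I}" by (auto simp: U_def)
    fix u v assume "v \<in> U" "1 \<le> u" "u \<le> v"
    then show "u \<in> U" using b_mono[of u v] by (auto simp: U_def)
  qed
  define S where "S = \<sigma> ` U"
  have inj: "inj_on \<sigma> {1..I}" using \<sigma> by (rule bij_betw_imp_inj_on)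
  have S: "S \<subseteq> {1..I}" using \<sigma>_in unfolding S_def U_def by blast
  have cS: "card S = card U"
    unfolding S_def by (rule card_image) (rule inj_on_subset[OF inj], auto simp: U_def)
  have \<sigma>S: "\<sigma> u \<in> S \<longleftrightarrow> u \<in> U" if "u \<in> {1..I}" for u
    unfolding S_def by (rule inj_on_image_mem_iff[OF inj that]) (auto simp: U_def)
  have inU: "u \<in> U \<longleftrightarrow> u \<le> card S" if "u \<in> {1..I}" for u
    using U that cS by (auto simp: set_eq_iff)
  have high: "\<delta> u \<le> - z 1 (j - 1)" if "u \<in> {1..I}" "u \<notin> U" for u
    using j(2) that by (auto simp: P_def U_def)
  have "obj R = (\<Sum>i\<in>{1..I}. contribution i (m i) (p i)) - dbar I \<Theta> {fst R..snd R}"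
    unfolding separation_objective_def Req dlift_eq[OF idx] by simp
  also have "\<dots> \<le> (\<Sum>i\<in>{1..I}. contribution i (m i) (p i)) - (\<Sum>u\<in>{1..I}. max 0 (\<delta> u - b u))"
    using dbar_ge_sorted[OF R \<sigma>] mono by (simp add: Req a_def b_def)
  also have "\<dots> = (\<Sum>u\<in>{1..I}. contribution (\<sigma> u) (m (\<sigma> u)) (p (\<sigma> u)) - max 0 (\<delta> u - b u))"
    by (simp add: sum_subtractf sum.reindex_bij_betw[OF \<sigma>, of "\<lambda>i. contribution i (m i) (p i)"])
  also have "\<dots> \<le> (\<Sum>u\<in>{1..I}. (if \<sigma> u \<in> S then total_gain (\<sigma> u) j else total_gain (\<sigma> u) (j - 1))
      - max 0 (\<delta> u + (if u \<le> card S then z 1 j else z 1 (j - 1))))"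
  proof (rule sum_mono)
    fix u assume u: "u \<in> {1..I}"
    have cl: "contribution (\<sigma> u) (m (\<sigma> u)) (p (\<sigma> u)) \<le> total_gain (\<sigma> u) k + max 0 (- z 1 k - b u)"
      if "k \<le> h" for k
      unfolding b_def a_def using contribution_le[OF \<sigma>_in[OF u] _ _ that] idx \<sigma>_in[OF u] by simp
    show "contribution (\<sigma> u) (m (\<sigma> u)) (p (\<sigma> u)) - max 0 (\<delta> u - b u)
      \<le> (if \<sigma> u \<in> S then total_gain (\<sigma> u) j else total_gain (\<sigma> u) (j - 1))
        - max 0 (\<delta> u + (if u \<le> card S then z 1 j else z 1 (j - 1)))"
    proof (cases "u \<in> U")
      case True
      then have "b u \<le> - z 1 j" by (simp add: U_def)
      then show ?thesis
        using cl[OF jK(1)] low[OF u] \<sigma>S[OF u] inU[OF u] True by (cases "b u = - z 1 j") auto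
    next
      case False
      then have "- z 1 (j - 1) \<le> b u" using b_gap[OF u jK(5)] u j by (auto simp: U_def)
      then show ?thesis
        using cl[OF jK(2)] high[OF u False] \<sigma>S[OF u] inU[OF u] False by auto
    qed
  qed
  also have "\<dots> = two_level_value j S"
    unfolding two_level_value_def
    by (simp add: sum_subtractf
        sum.reindex_bij_betw[OF \<sigma>, of "\<lambda>i. if i \<in> S then total_gain i j else total_gain i (j - 1)"])
  finally have "obj R \<le> two_level_value j S" .
  then show thesis
    using that[OF j(1) S] high inU by force
qed

text \<open>
  If the last narrow coordinate faces \<open>\<delta> n \<ge> - z 1 (j - 1)\<close>, all narrow ones may be widened; if the
  first wide one faces \<open>\<delta> (n + 1) < - z 1 j\<close>, all wide ones may be narrowed. Otherwise \<open>\<delta> n\<close> and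
  \<open>\<delta> (n + 1)\<close> lie in the same half-open cell of the grid, which the hypothesis excludes.
\<close>
lemma rectangle_le_square:
  assumes R: "R \<in> rectangles I J z"
    and few: "\<forall>j\<in>{1..J 1}. card {i\<in>{1..I}. eta \<Theta> i - eta \<Theta> (i - 1) \<in> {z 1 (j - 1)..<z 1 j}} \<le> 1"
  shows "\<exists>k\<le>h. obj R \<le> obj (square I z k)"
proof -
  obtain j S where j: "j \<in> {1..h}" and S: "S \<subseteq> {1..I}" and le: "obj R \<le> two_level_value j S"
    and high: "\<And>u. card S < u \<Longrightarrow> u \<le> I \<Longrightarrow> \<delta> u \<le> - z 1 (j - 1)"
    using rectangle_le_two_level[OF R] by blast
  have jK: "j \<le> h" "j - 1 \<le> h" "j \<le> K" "j - 1 \<le> K" using j K_even by auto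
  have zj: "z 1 (j - 1) < z 1 j" using j jK by (intro z_less) auto
  define n where "n = card S"
  have nI: "n \<le> I" unfolding n_def using card_mono[OF _ S] by simp
  have gains: "total_gain i (j - 1) \<le> total_gain i j"
    "total_gain i j \<le> total_gain i (j - 1) + (z 1 j - z 1 (j - 1))" if "i \<in> {1..I}" for i
    using total_gain_mono[OF that, of "j - 1" j] jK by auto
  have to_wide: "two_level_value j S \<le> square_value (j - 1)"
    if *: "\<And>u. u \<in> {1..n} \<Longrightarrow> - z 1 (j - 1) \<le> \<delta> u"
  proof -
    have "(\<Sum>i\<in>{1..I}. if i \<in> S then total_gain i j else total_gain i (j - 1))
      \<le> (\<Sum>i\<in>{1..I}. total_gain i (j - 1) + (if i \<in> S then z 1 j - z 1 (j - 1) else 0))"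
      by (rule sum_mono) (use gains in auto)
    also have "\<dots> = (\<Sum>i\<in>{1..I}. total_gain i (j - 1)) + n * (z 1 j - z 1 (j - 1))"
      using S by (simp add: sum.distrib sum.If_cases Int_absorb1 n_def)
    finally have 1: "(\<Sum>i\<in>{1..I}. if i \<in> S then total_gain i j else total_gain i (j - 1)) \<le> \<dots>" .
    have "(\<Sum>u\<in>{1..I}. max 0 (\<delta> u + (if u \<le> n then z 1 j else z 1 (j - 1))))
      = (\<Sum>u\<in>{1..I}. max 0 (\<delta> u + z 1 (j - 1)) + (if u \<le> n then z 1 j - z 1 (j - 1) else 0))"
    proof (rule sum.cong)
      fix u assume "u \<in> {1..I}"
      then show "max 0 (\<delta> u + (if u \<le> n then z 1 j else z 1 (j - 1)))
        = max 0 (\<delta> u + z 1 (j - 1)) + (if u \<le> n then z 1 j - z 1 (j - 1) else 0)"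
        using *[of u] zj by auto
    qed simp
    also have "\<dots> = (\<Sum>u\<in>{1..I}. max 0 (\<delta> u + z 1 (j - 1))) + n * (z 1 j - z 1 (j - 1))"
    proof -
      have "{1..I} \<inter> {u. u \<le> n} = {1..n}" using nI by auto
      then show ?thesis by (simp add: sum.distrib sum.If_cases)
    qed
    finally show ?thesis using 1 unfolding two_level_value_def square_value_def n_def by linarith
  qed
  have to_narrow: "two_level_value j S \<le> square_value j"
    if *: "\<And>u. n < u \<Longrightarrow> u \<le> I \<Longrightarrow> \<delta> u \<le> - z 1 j"
    unfolding two_level_value_def square_value_def n_def[symmetric]
  proof (intro diff_mono sum_mono)
    fix u assume "u \<in> {1..I}"
    then show "max 0 (\<delta> u + z 1 j) \<le> max 0 (\<delta> u + (if u \<le> n then z 1 j else z 1 (j - 1)))"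
      using *[of u] by auto
  qed (use gains in auto)
  show ?thesis
  proof (cases "n = 0 \<or> n = I")
    case True
    then have "two_level_value j S \<le> square_value (j - 1) \<or> two_level_value j S \<le> square_value j"
      using to_wide to_narrow by auto
    then show ?thesis using le jK obj_square[of j] obj_square[of "j - 1"] by (metis order_trans)
  next
    case False
    then have n: "n \<in> {1..I}" "n + 1 \<in> {1..I}" using nI by auto
    define A where "A = {i\<in>{1..I}. \<delta> i \<in> {z 1 (K - j)..<z 1 (K - (j - 1))}}"
    have k: "K - (j - 1) \<in> {1..K}" "K - (j - 1) - 1 = K - j" using j jK by auto
    have "card A \<le> 1" using bspec[OF few k(1)] unfolding A_def \<delta>_def k(2) .
    have "\<not> (n \<in> A \<and> n + 1 \<in> A)"
    proof
      assume "n \<in> A \<and> n + 1 \<in> A"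
      then have "card {n, n + 1} \<le> card A" by (intro card_mono) (auto simp: A_def)
      then show False using \<open>card A \<le> 1\<close> by simp
    qed
    moreover have "\<delta> (n + 1) \<le> \<delta> n" using \<delta>_antimono[of n "n + 1"] n by auto
    ultimately have "- z 1 (j - 1) \<le> \<delta> n \<or> \<delta> (n + 1) < - z 1 j"
      using n high[of "n + 1"] by (auto simp: A_def z_reflect jK n_def[symmetric])
    then have "two_level_value j S \<le> square_value (j - 1) \<or> two_level_value j S \<le> square_value j"
    proof
      assume "- z 1 (j - 1) \<le> \<delta> n"
      then have "- z 1 (j - 1) \<le> \<delta> u" if "u \<in> {1..n}" for u
        using \<delta>_antimono[of u n] that nI by auto
      then show ?thesis using to_wide by blast
    next
      assume "\<delta> (n + 1) < - z 1 j"
      then have "\<delta> u \<le> - z 1 j" if "n < u" "u \<le> I" for u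
        using \<delta>_antimono[of "n + 1" u] that by auto
      then show ?thesis using to_narrow by blast
    qed
    then show ?thesis using le jK obj_square[of j] obj_square[of "j - 1"] by (metis order_trans)
  qed
qed

lemma separation_solution_iff:
  "separation_solution I \<Theta> J z \<xi> s R \<longleftrightarrow>
    R \<in> rectangles I J z \<and> (\<forall>R'\<in>rectangles I J z. obj R' \<le> obj R)"
  by (auto simp: separation_solution_def is_arg_max_def not_less)

lemma square_solution:
  assumes few: "\<forall>j\<in>{1..J 1}. card {i\<in>{1..I}. eta \<Theta> i - eta \<Theta> (i - 1) \<in> {z 1 (j - 1)..<z 1 j}} \<le> 1"
  shows "\<exists>k\<le>h. separation_solution I \<Theta> J z \<xi> s (square I z k)"
proof -
  define M where "M = Max ((\<lambda>k. obj (square I z k)) ` {..h})"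
  have "M \<in> (\<lambda>k. obj (square I z k)) ` {..h}" unfolding M_def by (intro Max_in) auto
  then obtain k where k: "k \<le> h" "obj (square I z k) = M" by auto
  have "obj R \<le> obj (square I z k)" if R: "R \<in> rectangles I J z" for R
  proof -
    obtain k' where k': "k' \<le> h" "obj R \<le> obj (square I z k')"
      using rectangle_le_square[OF R few] by blast
    have "obj (square I z k') \<le> M" unfolding M_def using k'(1) by (intro Max_ge) auto
    then show ?thesis using k' k by linarith
  qed
  then show ?thesis using k square_rectangle separation_solution_iff by blast
qed

subsection \<open>Choosing the coordinates greedily\<close>

text \<open>
  The growth of the distance term when the \<open>u\<close>-th coordinate in sorted order is narrowed.
\<close>
definition cut :: "nat \<Rightarrow> nat \<Rightarrow> real"
  where "cut j u = max 0 (\<delta> u + z 1 j) - max 0 (\<delta> u + z 1 (j - 1))"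

lemma two_level_value_eq:
  assumes j: "1 \<le> j" and S: "S \<subseteq> {1..I}"
  shows "two_level_value j S = square_value (j - 1) + (\<Sum>i\<in>S. gain i j) - (\<Sum>u\<in>{1..card S}. cut j u)"
proof -
  have "(\<Sum>i\<in>{1..I}. if i \<in> S then total_gain i j else total_gain i (j - 1))
      = (\<Sum>i\<in>{1..I}. total_gain i (j - 1) + (if i \<in> S then gain i j else 0))"
    by (rule sum.cong) (auto simp: total_gain_step[OF j])
  also have "\<dots> = (\<Sum>i\<in>{1..I}. total_gain i (j - 1)) + (\<Sum>i\<in>S. gain i j)"
    using S by (simp add: sum.distrib sum.If_cases Int_absorb1)
  finally have 1: "(\<Sum>i\<in>{1..I}. if i \<in> S then total_gain i j else total_gain i (j - 1)) = \<dots>" .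
  have "{1..I} \<inter> {u. u \<le> card S} = {1..card S}" using card_mono[OF _ S] by auto
  then have "(\<Sum>u\<in>{1..I}. max 0 (\<delta> u + z 1 (j - 1)) + (if u \<le> card S then cut j u else 0))
    = (\<Sum>u\<in>{1..I}. max 0 (\<delta> u + z 1 (j - 1))) + (\<Sum>u\<in>{1..card S}. cut j u)"
    by (simp add: sum.distrib sum.If_cases)
  moreover have "(\<Sum>u\<in>{1..I}. max 0 (\<delta> u + (if u \<le> card S then z 1 j else z 1 (j - 1))))
    = (\<Sum>u\<in>{1..I}. max 0 (\<delta> u + z 1 (j - 1)) + (if u \<le> card S then cut j u else 0))"
    by (rule sum.cong) (auto simp: cut_def)
  ultimately show ?thesis using 1 by (simp add: two_level_value_def square_value_def)
qed

text \<open>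
  The distance term sees only the cardinality of \<open>S\<close>, so the coordinates with the largest gains are best.
\<close>
lemma two_level_value_le_greedy:
  assumes j: "1 \<le> j" and S: "S \<subseteq> {1..I}" and \<sigma>: "bij_betw \<sigma> {1..I} {1..I}"
    and mono: "mono_on {1..I} (\<lambda>u. - gain (\<sigma> u) j)"
  shows "two_level_value j S
    \<le> square_value (j - 1) + (\<Sum>u\<in>{1..card S}. gain (\<sigma> u) j - cut j u)"
proof -
  define X where "X = {u \<in> {1..I}. \<sigma> u \<in> S}"
  have X: "bij_betw \<sigma> X S" unfolding X_def by (rule bij_betw_preimage[OF \<sigma> S])
  have "(\<Sum>u\<in>{1..card X}. - gain (\<sigma> u) j) \<le> (\<Sum>u\<in>X. - gain (\<sigma> u) j)"
    by (rule sum_initial_segment_le[OF mono]) (auto simp: X_def)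
  then have "(\<Sum>i\<in>S. gain i j) \<le> (\<Sum>u\<in>{1..card S}. gain (\<sigma> u) j)"
    by (simp add: sum_negf bij_betw_same_card[OF X] sum.reindex_bij_betw[OF X, of "\<lambda>i. gain i j"])
  then show ?thesis by (simp add: two_level_value_eq[OF j S] sum_subtractf)
qed

lemma greedy_value:
  assumes j: "1 \<le> j" and \<sigma>: "bij_betw \<sigma> {1..I} {1..I}" and t: "t \<le> I"
  shows "two_level_value j (\<sigma> ` {1..t}) = square_value (j - 1) + (\<Sum>u\<in>{1..t}. gain (\<sigma> u) j - cut j u)"
proof -
  have inj: "inj_on \<sigma> {1..t}"
    by (rule inj_on_subset[OF bij_betw_imp_inj_on[OF \<sigma>]]) (use t in auto)
  have "\<sigma> ` {1..t} \<subseteq> {1..I}" using bij_betw_imp_surj_on[OF \<sigma>] t by auto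
  then show ?thesis
    using inj by (simp add: two_level_value_eq[OF j] sum.reindex card_image sum_subtractf)
qed

end

section \<open>Reasoning about programs\<close>

text \<open>
  Postconditions speak about the running time as well, so that the laws for the single commands are
  equations that the simplifier can use to execute straight-line code symbolically.
\<close>
definition runs :: "com \<Rightarrow> state \<Rightarrow> (nat \<Rightarrow> state \<Rightarrow> bool) \<Rightarrow> bool"
  where "runs c st Q \<longleftrightarrow> (\<exists>t st'. exec c st t st' \<and> Q t st')"

fun writes :: "com \<Rightarrow> string set" where
  "writes Skip = {}"
| "writes (NSet x e1 e2) = {x}"
| "writes (RSet x e1 e2 r) = {x}"
| "writes (Seq c1 c2) = writes c1 \<union> writes c2"
| "writes (Cond b c1 c2) = writes c1 \<union> writes c2"
| "writes (While b c) = writes c"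

text \<open>
  Array names of both kinds are kept in one set; the program uses no name for two arrays.
\<close>
definition agree :: "string set \<Rightarrow> state \<Rightarrow> state \<Rightarrow> bool"
  where "agree X st st' \<longleftrightarrow> (\<forall>y. y \<notin> X \<longrightarrow> fst st' y = fst st y \<and> snd st' y = snd st y)"

lemma agreeD:
  assumes "agree X st st'" "y \<notin> X"
  shows "fst st' y = fst st y" "snd st' y = snd st y"
  using assms by (auto simp: agree_def)

lemma agree_refl [simp]: "agree X st st"
  by (simp add: agree_def)

lemma agree_trans: "agree X st st1 \<Longrightarrow> agree X st1 st2 \<Longrightarrow> agree X st st2"
  by (simp add: agree_def)

lemma fst_nupdate [simp]: "fst (nupdate x i v st) = (fst st)(x := (fst st x)(i := v))"
  and snd_nupdate [simp]: "snd (nupdate x i v st) = snd st"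
  and fst_rupdate [simp]: "fst (rupdate x i j r st) = fst st"
  and snd_rupdate [simp]: "snd (rupdate x i j r st) = (snd st)(x := (snd st x)(i := (snd st x i)(j := r)))"
  by (simp_all add: nupdate_def rupdate_def)

lemma exec_agree: "exec c st t st' \<Longrightarrow> agree (writes c) st st'"
  by (induction rule: exec.induct) (auto simp: agree_def)

lemma runs_iff:
  assumes "exec c st t st'"
  shows "runs c st Q \<longleftrightarrow> Q t st'"
  unfolding runs_def using assms exec_deterministic by blast

lemma runs_Skip [simp]: "runs Skip st Q \<longleftrightarrow> Q 1 st"
  by (rule runs_iff[OF exec.Skip])

lemma runs_NSet [simp]: "runs (NSet x e1 e2) st Q \<longleftrightarrow>
    Q (ncost e1 + ncost e2 + 1) (nupdate x (nval e1 st) (nval e2 st) st)"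
  by (rule runs_iff[OF exec.NSet])

lemma runs_RSet [simp]: "runs (RSet x e1 e2 r) st Q \<longleftrightarrow>
    Q (ncost e1 + ncost e2 + rcost r + 1) (rupdate x (nval e1 st) (nval e2 st) (rval r st) st)"
  by (rule runs_iff[OF exec.RSet])

lemma runs_Seq: "runs (Seq c1 c2) st Q \<longleftrightarrow>
    runs c1 st (\<lambda>t1 st1. runs c2 st1 (\<lambda>t2. Q (t1 + t2)))"
  unfolding runs_def by (blast elim: exec_elims intro: exec.intros)

lemma runs_Cond: "runs (Cond b c1 c2) st Q \<longleftrightarrow>
    (if bval b st then runs c1 st (\<lambda>t. Q (bcost b + t)) else runs c2 st (\<lambda>t. Q (bcost b + t)))"
proof (cases "bval b st")
  case True
  then show ?thesis unfolding runs_def by (simp, blast elim: exec_elims intro: exec.CondTrue)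
next
  case False
  then show ?thesis unfolding runs_def by (simp, blast elim: exec_elims intro: exec.CondFalse)
qed

lemma runs_mono:
  assumes "runs c st P" and "\<And>t st'. P t st' \<Longrightarrow> agree (writes c) st st' \<Longrightarrow> Q t st'"
  shows "runs c st Q"
  using assms exec_agree unfolding runs_def by blast

lemma runs_SeqI:
  assumes "runs c1 st P"
    and "\<And>t1 st1. P t1 st1 \<Longrightarrow> agree (writes c1) st st1 \<Longrightarrow> runs c2 st1 (\<lambda>t2. Q (t1 + t2))"
  shows "runs (Seq c1 c2) st Q"
  unfolding runs_Seq by (rule runs_mono[OF assms(1)]) (rule assms(2))

lemma runs_While_aux:
  assumes "Inv st1" "agree (writes c) st st1"
    and step: "\<And>st1. Inv st1 \<Longrightarrow> agree (writes c) st st1 \<Longrightarrow> bval b st1 \<Longrightarrow>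
      runs c st1 (\<lambda>t st2. t \<le> T \<and> Inv st2 \<and> \<mu> st2 < \<mu> st1)"
  shows "runs (While b c) st1 (\<lambda>t st2. Inv st2 \<and> agree (writes c) st st2 \<and> \<not> bval b st2 \<and>
    t \<le> \<mu> st1 * (T + bcost b) + bcost b)"
  using assms(1,2)
proof (induction "\<mu> st1" arbitrary: st1 rule: less_induct)
  case less
  show ?case
  proof (cases "bval b st1")
    case False
    then have "exec (While b c) st1 (bcost b) st1" by (rule exec.WhileFalse)
    then show ?thesis unfolding runs_def
      by (intro exI[of _ "bcost b"] exI[of _ st1]) (simp add: False less.prems)
  next
    case True
    obtain t2 st2 where 2: "exec c st1 t2 st2" "t2 \<le> T" "Inv st2" "\<mu> st2 < \<mu> st1"
      using step[OF less.prems True] unfolding runs_def by blast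
    have "agree (writes c) st st2"
      using agree_trans[OF less.prems(2) exec_agree[OF 2(1)]] .
    from less.hyps[OF 2(4,3) this] obtain t3 st3 where 3: "exec (While b c) st2 t3 st3"
      "Inv st3" "agree (writes c) st st3" "\<not> bval b st3"
      "t3 \<le> \<mu> st2 * (T + bcost b) + bcost b"
      unfolding runs_def by blast
    have ex: "exec (While b c) st1 (bcost b + t2 + t3) st3"
      using True 2(1) 3(1) by (rule exec.WhileTrue)
    have "(\<mu> st2 + 1) * (T + bcost b) \<le> \<mu> st1 * (T + bcost b)"
      using 2(4) by (intro mult_right_mono) auto
    then have "bcost b + t2 + t3 \<le> \<mu> st1 * (T + bcost b) + bcost b"
      using 2(2) 3(5) by (simp add: algebra_simps)
    then show ?thesis using ex 3 unfolding runs_def by blast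
  qed
qed

text \<open>
  A loop rule with invariant and variant \<open>\<mu>\<close>, which also bounds the number of iterations. The frame
  condition that everything outside \<open>writes c\<close> is unchanged comes for free, so that invariants need only
  mention what the loop modifies.
\<close>
lemma runs_While:
  assumes "Inv st"
    and "\<And>st1. Inv st1 \<Longrightarrow> agree (writes c) st st1 \<Longrightarrow> bval b st1 \<Longrightarrow>
      runs c st1 (\<lambda>t st2. t \<le> T \<and> Inv st2 \<and> \<mu> st2 < \<mu> st1)"
    and "\<And>t st1. Inv st1 \<Longrightarrow> agree (writes c) st st1 \<Longrightarrow> \<not> bval b st1 \<Longrightarrow>
      t \<le> \<mu> st * (T + bcost b) + bcost b \<Longrightarrow> Q t st1"
  shows "runs (While b c) st Q"
  by (rule runs_mono[OF runs_While_aux[where Inv = Inv and st = st and T = T and \<mu> = \<mu>]])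
    (use assms in auto)

section \<open>Tournament trees\<close>

text \<open>
  A tournament among \<open>n\<close> players is stored as an array: node \<open>q\<close> has the children \<open>2 q\<close> and \<open>2 q + 1\<close>, player
  \<open>i\<close> sits at the leaf \<open>n + i - 1\<close>, and every inner node \<open>q < n\<close> copies the value \<open>v\<close> and the player \<open>w\<close> from its
  better child. Storing the values in the nodes makes the condition local: after a change at
  one node only its parent can be wrong.
\<close>
definition node_ok :: "(nat \<Rightarrow> real) \<Rightarrow> (nat \<Rightarrow> nat) \<Rightarrow> nat \<Rightarrow> bool"
  where "node_ok v w q \<longleftrightarrow>
    (let r = (if v (q + q) < v (q + q + 1) then q + q + 1 else q + q) in v q = v r \<and> w q = w r)"

lemma node_ok_cong:
  assumes "node_ok v w q" and "\<And>r. r \<in> {q, q + q, q + q + 1} \<Longrightarrow> v' r = v r \<and> w' r = w r"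
  shows "node_ok v' w' q"
  using assms unfolding node_ok_def Let_def by (auto split: if_splits)

lemma tournament_winner:
  assumes tree: "\<forall>q\<in>{1..<n}. node_ok v w q"
    and leaf: "\<forall>i\<in>{1..n}. w (n + i - 1) = i" and q: "q \<in> {1..<n + n}"
  shows "w q \<in> {1..n} \<and> v q = v (n + w q - 1)"
  using q
proof (induction "n + n - q" arbitrary: q rule: less_induct)
  case less
  show ?case
  proof (cases "q < n")
    case True
    define r where "r = (if v (q + q) < v (q + q + 1) then q + q + 1 else q + q)"
    have "n + n - r < n + n - q" "r \<in> {1..<n + n}" using True less.prems by (auto simp: r_def)
    from less.hyps[OF this] show ?thesis
      using bspec[OF tree, of q] True less.prems unfolding node_ok_def Let_def r_def[symmetric] by auto
  next
    case False
    then have "q + 1 - n \<in> {1..n}" "n + (q + 1 - n) - 1 = q" using less.prems by auto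
    then show ?thesis using bspec[OF leaf, of "q + 1 - n"] by simp
  qed
qed

lemma tournament_max:
  assumes tree: "\<forall>q\<in>{1..<n}. node_ok v w q" and q: "q \<in> {1..<n + n}"
  shows "v q \<le> v 1"
  using q
proof (induction q rule: less_induct)
  case (less q)
  show ?case
  proof (cases "q = 1")
    case False
    then have p: "q div 2 \<in> {1..<n}" "q div 2 < q" "q div 2 \<in> {1..<n + n}" using less.prems by auto
    have "q = q div 2 + q div 2 \<or> q = q div 2 + q div 2 + 1" by linarith
    then have "v q \<le> v (q div 2)"
      using bspec[OF tree p(1)] unfolding node_ok_def Let_def by (auto split: if_splits)
    then show ?thesis using less.IH[OF p(2,3)] by linarith
  qed simp
qed

section \<open>The program\<close>

abbreviation nvar :: "string \<Rightarrow> nexp" where "nvar x \<equiv> NGet x (NConst 0)"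
abbreviation rvar :: "string \<Rightarrow> rexp" where "rvar x \<equiv> RGet x (NConst 0) (NConst 0)"
abbreviation set_nvar :: "string \<Rightarrow> nexp \<Rightarrow> com" where "set_nvar x e \<equiv> NSet x (NConst 0) e"
abbreviation set_rvar :: "string \<Rightarrow> rexp \<Rightarrow> com" where "set_rvar x r \<equiv> RSet x (NConst 0) (NConst 0) r"
abbreviation incr :: "string \<Rightarrow> com" where "incr x \<equiv> set_nvar x (NAdd (nvar x) (NConst 1))"
abbreviation at_most :: "nexp \<Rightarrow> nexp \<Rightarrow> bexp" where "at_most e1 e2 \<equiv> BNot (NLess e2 e1)"
abbreviation leaf :: "nexp \<Rightarrow> nexp" where "leaf e \<equiv> NSub (NAdd (nvar ''I'') e) (NConst 1)"

abbreviation val :: "state \<Rightarrow> nat \<Rightarrow> real" where "val st \<equiv> \<lambda>q. snd st ''val'' q 0"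

definition copy_node :: "nexp \<Rightarrow> com"
  where "copy_node e = Seq (RSet ''val'' (nvar ''p'') (NConst 0) (RGet ''val'' e (NConst 0)))
    (NSet ''idx'' (nvar ''p'') (NGet ''idx'' e))"

definition play_node :: com
  where "play_node = (let l = NAdd (nvar ''p'') (nvar ''p''); r = NAdd l (NConst 1) in
    Cond (RLess (RGet ''val'' l (NConst 0)) (RGet ''val'' r (NConst 0))) (copy_node r) (copy_node l))"

lemma writes_play_node [simp]: "writes play_node = {''val'', ''idx''}"
  by (auto simp: play_node_def copy_node_def Let_def)

lemma runs_play_node:
  assumes "1 \<le> fst st ''p'' 0"
  shows "runs play_node st (\<lambda>t st'. t \<le> 50 \<and> node_ok (val st') (fst st' ''idx'') (fst st ''p'' 0) \<and>
    (\<forall>q. q \<noteq> fst st ''p'' 0 \<longrightarrow> val st' q = val st q \<and> fst st' ''idx'' q = fst st ''idx'' q))"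
  using assms
  by (auto simp: play_node_def copy_node_def runs_Cond runs_Seq node_ok_def Let_def)

text \<open>
  The machine has no division of indices, so the parents of all nodes are tabulated once; the root
  gets the parent 0, at which walks towards the root stop.
\<close>
definition init_half :: com
  where "init_half = Seq (NSet ''half'' (NConst 1) (NConst 0)) (Seq (set_nvar ''p'' (NConst 1))
    (While (NLess (nvar ''p'') (nvar ''I''))
      (Seq (NSet ''half'' (NAdd (nvar ''p'') (nvar ''p'')) (nvar ''p''))
      (Seq (NSet ''half'' (NAdd (NAdd (nvar ''p'') (nvar ''p'')) (NConst 1)) (nvar ''p''))
      (incr ''p'')))))"

lemma runs_init_half:
  assumes n: "fst st ''I'' 0 = n" "1 \<le> n"
  shows "runs init_half st (\<lambda>t st'. t \<le> 100 * n \<and> (\<forall>q\<in>{1..<n + n}. fst st' ''half'' q = q div 2))"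
proof -
  define Inv where "Inv st \<longleftrightarrow> (let p = fst st ''p'' 0 in 1 \<le> p \<and> p \<le> n \<and>
    (\<forall>q\<in>{1..<p + p}. fst st ''half'' q = q div 2))" for st :: state
  show ?thesis
    unfolding init_half_def
    apply (simp add: runs_Seq)
    apply (rule runs_While[where Inv = Inv and T = 50 and \<mu> = "\<lambda>st. n - fst st ''p'' 0"])
    subgoal using n by (auto simp: Inv_def)
    subgoal for st1
      using n agreeD(1)[of _ _ st1 "''I''"]
      by (auto simp: Inv_def runs_Seq Let_def less_Suc_eq)
    subgoal for t st1
      using n agreeD(1)[of _ _ st1 "''I''"]
      by (auto simp: Inv_def Let_def)
    done
qed


definition widest_box :: com
  where "widest_box = Seq (set_nvar ''i'' (NConst 1))
    (While (at_most (nvar ''i'') (nvar ''I''))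
      (Seq (RSet ''zplus'' (nvar ''i'') (NConst 0) (RGet ''z'' (NConst 1) (NGet ''J'' (NConst 1))))
      (Seq (RSet ''zminus'' (nvar ''i'') (NConst 0) (RGet ''z'' (NConst 1) (NConst 0)))
      (incr ''i''))))"

lemma runs_widest_box:
  assumes n: "fst st ''I'' 0 = n" "1 \<le> n"
  shows "runs widest_box st (\<lambda>t st'. t \<le> 100 * n \<and> (\<forall>i\<in>{1..n}.
    snd st' ''zplus'' i 0 = snd st ''z'' 1 (fst st ''J'' 1) \<and> snd st' ''zminus'' i 0 = snd st ''z'' 1 0))"
proof -
  define Inv where "Inv st' \<longleftrightarrow> (let k = fst st' ''i'' 0 in 1 \<le> k \<and> k \<le> n + 1 \<and> (\<forall>i\<in>{1..<k}.
    snd st' ''zplus'' i 0 = snd st ''z'' 1 (fst st ''J'' 1) \<and> snd st' ''zminus'' i 0 = snd st ''z'' 1 0))"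
    for st' :: state
  show ?thesis
    unfolding widest_box_def
    apply (simp add: runs_Seq)
    apply (rule runs_While[where Inv = Inv and T = 40 and \<mu> = "\<lambda>st. n + 1 - fst st ''i'' 0"])
    subgoal by (auto simp: Inv_def)
    subgoal for st1
      using n agreeD[of _ _ st1 "''I''"] agreeD[of _ _ st1 "''J''"] agreeD[of _ _ st1 "''z''"]
      by (auto simp: Inv_def runs_Seq Let_def less_Suc_eq)
    subgoal for t st1
      using n agreeD[of _ _ st1 "''I''"]
      by (auto simp: Inv_def Let_def)
    done
qed

definition leaf_value :: rexp
  where "leaf_value = RSub (RAdd
      (RDiv (RGet ''xi'' (nvar ''i'') (NSub (NAdd (NGet ''J'' (NConst 1)) (NConst 1)) (nvar ''j''))) (rvar ''s''))
      (RSub (RGet ''z'' (NConst 1) (nvar ''j'')) (RGet ''z'' (NConst 1) (NSub (nvar ''j'') (NConst 1)))))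
    (RDiv (RGet ''xi'' (nvar ''i'') (nvar ''j'')) (rvar ''s''))"

definition fill_leaves :: com
  where "fill_leaves = Seq (set_nvar ''i'' (NConst 1))
    (While (at_most (nvar ''i'') (nvar ''I''))
      (Seq (RSet ''val'' (leaf (nvar ''i'')) (NConst 0) leaf_value)
      (Seq (NSet ''idx'' (leaf (nvar ''i'')) (nvar ''i''))
      (incr ''i''))))"

lemma runs_fill_leaves:
  assumes n: "fst st ''I'' 0 = n" "1 \<le> n"
    and d: "\<And>i. d i = snd st ''xi'' i (fst st ''J'' 1 + 1 - fst st ''j'' 0) / snd st ''s'' 0 0
      + (snd st ''z'' 1 (fst st ''j'' 0) - snd st ''z'' 1 (fst st ''j'' 0 - 1))
      - snd st ''xi'' i (fst st ''j'' 0) / snd st ''s'' 0 0"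
  shows "runs fill_leaves st (\<lambda>t st'. t \<le> 200 * n \<and> (\<forall>i\<in>{1..n}.
    val st' (n + i - 1) = d i \<and> fst st' ''idx'' (n + i - 1) = i))"
proof -
  define Inv where "Inv st' \<longleftrightarrow> (let k = fst st' ''i'' 0 in 1 \<le> k \<and> k \<le> n + 1 \<and> (\<forall>i\<in>{1..<k}.
    val st' (n + i - 1) = d i \<and> fst st' ''idx'' (n + i - 1) = i))" for st' :: state
  have leaf_eq: "fst st ''I'' 0 + i - 1 = fst st ''I'' 0 + k - 1 \<longleftrightarrow> i = k" if "1 \<le> i" "1 \<le> k" for i k
    using that by auto
  show ?thesis
    unfolding fill_leaves_def
    apply (simp add: runs_Seq)
    apply (rule runs_While[where Inv = Inv and T = 120 and \<mu> = "\<lambda>st. n + 1 - fst st ''i'' 0"])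
    subgoal by (auto simp: Inv_def)
    subgoal for st1
      using n agreeD[of _ _ st1 "''I''"] agreeD[of _ _ st1 "''J''"] agreeD[of _ _ st1 "''j''"]
        agreeD[of _ _ st1 "''z''"] agreeD[of _ _ st1 "''xi''"] agreeD[of _ _ st1 "''s''"]
      by (auto simp: Inv_def runs_Seq Let_def less_Suc_eq leaf_value_def d leaf_eq)
    subgoal for t st1
      using n agreeD[of _ _ st1 "''I''"]
      by (auto simp: Inv_def Let_def)
    done
qed

definition build_tree :: com
  where "build_tree = Seq (set_nvar ''p'' (NSub (nvar ''I'') (NConst 1)))
    (While (NLess (NConst 0) (nvar ''p''))
      (Seq play_node (set_nvar ''p'' (NSub (nvar ''p'') (NConst 1)))))"

lemma runs_build_tree:
  assumes n: "fst st ''I'' 0 = n" "1 \<le> n"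
  shows "runs build_tree st (\<lambda>t st'. t \<le> 100 * n \<and>
    (\<forall>q\<in>{1..<n}. node_ok (val st') (fst st' ''idx'') q) \<and>
    (\<forall>q\<ge>n. val st' q = val st q \<and> fst st' ''idx'' q = fst st ''idx'' q))"
proof -
  define Inv where "Inv st' \<longleftrightarrow> fst st' ''p'' 0 < n \<and>
    (\<forall>q\<in>{fst st' ''p'' 0<..<n}. node_ok (val st') (fst st' ''idx'') q) \<and>
    (\<forall>q\<ge>n. val st' q = val st q \<and> fst st' ''idx'' q = fst st ''idx'' q)" for st' :: state
  show ?thesis
    unfolding build_tree_def
    apply (simp add: runs_Seq)
    apply (rule runs_While[where Inv = Inv and T = 60 and \<mu> = "\<lambda>st. fst st ''p'' 0"])
    subgoal using n by (auto simp: Inv_def)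
    subgoal premises prems for st1
    proof -
      let ?p = "fst st1 ''p'' 0"
      have p: "1 \<le> ?p" "?p < n" using prems(1,3) by (auto simp: Inv_def)
      show ?thesis
        unfolding runs_Seq
      proof (rule runs_mono[OF runs_play_node[OF p(1)]])
        fix t :: nat and st2 :: state
        assume 2: "t \<le> 50 \<and> node_ok (val st2) (fst st2 ''idx'') ?p \<and>
          (\<forall>q. q \<noteq> ?p \<longrightarrow> val st2 q = val st1 q \<and> fst st2 ''idx'' q = fst st1 ''idx'' q)"
          and ag: "agree (writes play_node) st1 st2"
        have p2: "fst st2 ''p'' 0 = ?p" using agreeD(1)[OF ag, of "''p''"] by simp
        have "node_ok (val st2) (fst st2 ''idx'') q" if q: "q \<in> {?p - 1<..<n}" for q
        proof (cases "q = ?p")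
          case False
          then have "q \<in> {?p<..<n}" using q by auto
          then have "node_ok (val st1) (fst st1 ''idx'') q" using prems(1) by (simp add: Inv_def)
          then show ?thesis
            by (rule node_ok_cong) (use 2 \<open>q \<in> {?p<..<n}\<close> in auto)
        qed (use 2 in simp)
        then show "runs (set_nvar ''p'' (NSub (nvar ''p'') (NConst 1))) st2
          (\<lambda>ta st2. t + ta \<le> 60 \<and> Inv st2 \<and> fst st2 ''p'' 0 < fst st1 ''p'' 0)"
          using 2 p prems(1) by (auto simp: Inv_def p2)
      qed
    qed
    subgoal for t st1
      using n by (auto simp: Inv_def)
    done
qed

text \<open>
  Restores the tree after a leaf has changed, upwards from its parent.
\<close>
definition replay_path :: com
  where "replay_path = While (NLess (NConst 0) (nvar ''p''))
    (Seq play_node (set_nvar ''p'' (NGet ''half'' (nvar ''p''))))"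

lemma writes_replay_path [simp]: "writes replay_path = {''val'', ''idx'', ''p''}"
  by (auto simp: replay_path_def)

lemma runs_replay_path:
  assumes half: "\<And>q. q \<in> {1..<n + n} \<Longrightarrow> fst st ''half'' q = q div 2"
    and p: "fst st ''p'' 0 < n"
    and tree: "\<And>q. q \<in> {1..<n} \<Longrightarrow> q \<noteq> fst st ''p'' 0 \<Longrightarrow> node_ok (val st) (fst st ''idx'') q"
  shows "runs replay_path st (\<lambda>t st'. t \<le> floorlog 2 n * 100 + 10 \<and>
    (\<forall>q\<in>{1..<n}. node_ok (val st') (fst st' ''idx'') q) \<and>
    (\<forall>q\<ge>n. val st' q = val st q \<and> fst st' ''idx'' q = fst st ''idx'' q))"
proof -
  define Inv where "Inv st' \<longleftrightarrow> fst st' ''p'' 0 < n \<and>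
    (\<forall>q\<in>{1..<n}. q \<noteq> fst st' ''p'' 0 \<longrightarrow> node_ok (val st') (fst st' ''idx'') q) \<and>
    (\<forall>q\<ge>n. val st' q = val st q \<and> fst st' ''idx'' q = fst st ''idx'' q)" for st' :: state
  show ?thesis
    unfolding replay_path_def
    apply (rule runs_While[where Inv = Inv and T = 60 and \<mu> = "\<lambda>st. floorlog 2 (fst st ''p'' 0)"])
    subgoal using p tree by (auto simp: Inv_def)
    subgoal premises prems for st1
    proof -
      let ?p = "fst st1 ''p'' 0"
      have p: "1 \<le> ?p" "?p < n" using prems(1,3) by (auto simp: Inv_def)
      \<comment> \<open>one level of the tree per iteration: halving shortens the binary representation\<close>
      have mu: "floorlog 2 (?p div 2) < floorlog 2 ?p"
        using p by (subst (2) compute_floorlog) simp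
      have half1: "fst st1 ''half'' ?p = ?p div 2"
        using half[of ?p] p agreeD(1)[OF prems(2), of "''half''"] by simp
      show ?thesis
        unfolding runs_Seq
      proof (rule runs_mono[OF runs_play_node[OF p(1)]])
        fix t :: nat and st2 :: state
        assume 2: "t \<le> 50 \<and> node_ok (val st2) (fst st2 ''idx'') ?p \<and>
          (\<forall>q. q \<noteq> ?p \<longrightarrow> val st2 q = val st1 q \<and> fst st2 ''idx'' q = fst st1 ''idx'' q)"
          and ag: "agree (writes play_node) st1 st2"
        have p2: "fst st2 ''p'' 0 = ?p" "fst st2 ''half'' = fst st1 ''half''"
          using agreeD(1)[OF ag, of "''p''"] agreeD(1)[OF ag, of "''half''"] by simp_all
        have "node_ok (val st2) (fst st2 ''idx'') q" if q: "q \<in> {1..<n}" "q \<noteq> ?p div 2" for q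
        proof (cases "q = ?p")
          case False
          then have "node_ok (val st1) (fst st1 ''idx'') q" using prems(1) q by (simp add: Inv_def)
          moreover have "?p \<notin> {q, q + q, q + q + 1}" using False q by auto
          ultimately show ?thesis by (elim node_ok_cong) (use 2 in metis)
        qed (use 2 in simp)
        then show "runs (set_nvar ''p'' (NGet ''half'' (nvar ''p''))) st2
          (\<lambda>ta st2. t + ta \<le> 60 \<and> Inv st2 \<and> floorlog 2 (fst st2 ''p'' 0) < floorlog 2 (fst st1 ''p'' 0))"
          using 2 p prems(1) mu by (auto simp: Inv_def p2 half1)
      qed
    qed
    subgoal premises prems for t st1
    proof -
      have "floorlog 2 (fst st ''p'' 0) \<le> floorlog 2 n" by (rule floorlog_mono) (use p in simp)
      then have "floorlog 2 (fst st ''p'' 0) * 64 \<le> floorlog 2 n * 100" by (intro mult_mono) auto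
      then show ?thesis using prems by (auto simp: Inv_def)
    qed
    done
qed


text \<open>
  The value of the box increases by the extracted gain, which is the value at the root, and decreases
  by the positive part of \<open>\<delta> t + z 1 j\<close> less that of \<open>\<delta> t + z 1 (j - 1)\<close>.
\<close>
definition add_increment :: com
  where "add_increment = (let d = RSub (RGet ''eta'' (nvar ''t'') (NConst 0))
        (RGet ''eta'' (NSub (nvar ''t'') (NConst 1)) (NConst 0)) in
    Seq (set_rvar ''a'' (RAdd d (RGet ''z'' (NConst 1) (nvar ''j''))))
    (Seq (Cond (RLess (rvar ''a'') RZero) (set_rvar ''a'' RZero) Skip)
    (Seq (set_rvar ''b'' (RAdd d (RGet ''z'' (NConst 1) (NSub (nvar ''j'') (NConst 1)))))
    (Seq (Cond (RLess (rvar ''b'') RZero) (set_rvar ''b'' RZero) Skip)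
    (set_rvar ''V'' (RSub (RAdd (rvar ''V'') (RGet ''val'' (NConst 1) (NConst 0)))
      (RSub (rvar ''a'') (rvar ''b''))))))))"

text \<open>
  An extracted player gets the value \<open>-1\<close>, below all gains, and thus never wins again.
\<close>
definition extract_max :: com
  where "extract_max =
    Seq (set_nvar ''m'' (NGet ''idx'' (NConst 1)))
    (Seq (NSet ''sig'' (nvar ''t'') (nvar ''m''))
    (Seq add_increment
    (Seq (Cond (RLess (rvar ''value'') (rvar ''V''))
      (Seq (set_rvar ''value'' (rvar ''V'')) (set_nvar ''bt'' (nvar ''t''))) Skip)
    (Seq (RSet ''val'' (leaf (nvar ''m'')) (NConst 0) (RSub RZero ROne))
    (set_nvar ''p'' (NGet ''half'' (leaf (nvar ''m''))))))))"

definition increment :: "state \<Rightarrow> nat \<Rightarrow> real"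
  where "increment st u =
    max 0 (snd st ''eta'' u 0 - snd st ''eta'' (u - 1) 0 + snd st ''z'' 1 (fst st ''j'' 0))
    - max 0 (snd st ''eta'' u 0 - snd st ''eta'' (u - 1) 0 + snd st ''z'' 1 (fst st ''j'' 0 - 1))"

lemma writes_add_increment [simp]: "writes add_increment = {''a'', ''b'', ''V''}"
  by (auto simp: add_increment_def Let_def)

lemma writes_extract_max [simp]:
  "writes extract_max = {''m'', ''sig'', ''a'', ''b'', ''V'', ''value'', ''bt'', ''val'', ''p''}"
  by (auto simp: extract_max_def)

lemma runs_add_increment:
  "runs add_increment st (\<lambda>s st'. s \<le> 100 \<and>
    snd st' ''V'' 0 0 = snd st ''V'' 0 0 + val st 1 - increment st (fst st ''t'' 0))"
  unfolding add_increment_def increment_def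
  by (simp add: runs_Seq runs_Cond Let_def max_def)

lemma runs_extract_max:
  fixes st :: state
  defines "l \<equiv> fst st ''I'' 0 + fst st ''idx'' 1 - 1"
    and "w \<equiv> snd st ''value'' 0 0"
    and "V' \<equiv> snd st ''V'' 0 0 + val st 1 - increment st (fst st ''t'' 0)"
  shows "runs extract_max st (\<lambda>s st'. s \<le> 200 \<and>
    fst st' ''sig'' = (fst st ''sig'')(fst st ''t'' 0 := fst st ''idx'' 1) \<and>
    snd st' ''V'' 0 0 = V' \<and>
    snd st' ''value'' 0 0 = (if w < V' then V' else w) \<and>
    fst st' ''bt'' 0 = (if w < V' then fst st ''t'' 0 else fst st ''bt'' 0) \<and>
    val st' = (val st)(l := -1) \<and> fst st' ''p'' 0 = fst st ''half'' l)"
proof -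
  define st1 where "st1 = nupdate ''sig'' (fst st ''t'' 0) (fst st ''idx'' 1)
    (nupdate ''m'' 0 (fst st ''idx'' 1) st)"
  have V': "snd st1 ''V'' 0 0 + val st1 1 - increment st1 (fst st1 ''t'' 0) = V'"
    by (simp add: st1_def V'_def increment_def)
  have main: "runs (Seq add_increment (Seq (Cond (RLess (rvar ''value'') (rvar ''V''))
      (Seq (set_rvar ''value'' (rvar ''V'')) (set_nvar ''bt'' (nvar ''t''))) Skip)
    (Seq (RSet ''val'' (leaf (nvar ''m'')) (NConst 0) (RSub RZero ROne))
    (set_nvar ''p'' (NGet ''half'' (leaf (nvar ''m''))))))) st1 (\<lambda>s st'. s \<le> 180 \<and>
    fst st' ''sig'' = (fst st ''sig'')(fst st ''t'' 0 := fst st ''idx'' 1) \<and>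
    snd st' ''V'' 0 0 = V' \<and>
    snd st' ''value'' 0 0 = (if w < V' then V' else w) \<and>
    fst st' ''bt'' 0 = (if w < V' then fst st ''t'' 0 else fst st ''bt'' 0) \<and>
    val st' = (val st)(l := -1) \<and> fst st' ''p'' 0 = fst st ''half'' l)"
  proof (rule runs_SeqI[OF runs_add_increment], goal_cases)
    case (1 s2 st2)
    have keep: "fst st2 ''t'' = fst st1 ''t''" "fst st2 ''bt'' = fst st1 ''bt''" "fst st2 ''m'' = fst st1 ''m''"
      "fst st2 ''I'' = fst st1 ''I''" "fst st2 ''sig'' = fst st1 ''sig''" "fst st2 ''half'' = fst st1 ''half''"
      "snd st2 ''value'' = snd st ''value''" "snd st2 ''val'' = snd st ''val''"
      using agreeD[OF 1(2)] by (simp_all add: st1_def)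
    show ?case using 1(1) unfolding V'
      by (simp add: runs_Seq runs_Cond keep w_def l_def fun_eq_iff) (simp add: st1_def)
  qed
  show ?thesis
    unfolding extract_max_def runs_Seq[of "set_nvar ''m'' _"] runs_Seq[of "NSet ''sig'' _ _"]
    by (simp add: st1_def[symmetric] split del: if_split) (rule runs_mono[OF main], simp split del: if_split)
qed

text \<open>
  The state after \<open>t\<close> extractions: \<open>\<sigma>\<close> lists the extracted players, \<open>v\<close> and \<open>w\<close> are the tree, \<open>V\<close> is the current
  value and \<open>best\<close> the largest value seen, attained after \<open>k\<close> extractions; \<open>k = 0\<close> means that no
  value has exceeded the initial \<open>w0\<close>. Here \<open>d\<close> are the gains and \<open>c\<close> the costs.
\<close>
definition selected ::
  "nat \<Rightarrow> (nat \<Rightarrow> real) \<Rightarrow> (nat \<Rightarrow> real) \<Rightarrow> real \<Rightarrow> real \<Rightarrow>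
   nat \<Rightarrow> (nat \<Rightarrow> nat) \<Rightarrow> (nat \<Rightarrow> real) \<Rightarrow> (nat \<Rightarrow> nat) \<Rightarrow> real \<Rightarrow> nat \<Rightarrow> real \<Rightarrow> bool"
  where "selected n d c V0 w0 t \<sigma> v w V k best \<longleftrightarrow>
    t \<le> n \<and> inj_on \<sigma> {1..t} \<and> \<sigma> ` {1..t} \<subseteq> {1..n} \<and>
    (\<forall>i\<in>{1..n}. v (n + i - 1) = (if i \<in> \<sigma> ` {1..t} then -1 else d i) \<and> w (n + i - 1) = i) \<and>
    (\<forall>q\<in>{1..<n}. node_ok v w q) \<and>
    (\<forall>u\<in>{1..t}. \<forall>i\<in>{1..n} - \<sigma> ` {1..<u}. d i \<le> d (\<sigma> u)) \<and>
    V = V0 + (\<Sum>u\<in>{1..t}. d (\<sigma> u) - c u) \<and>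
    k \<le> t \<and> best = (if k = 0 then w0 else V0 + (\<Sum>u\<in>{1..k}. d (\<sigma> u) - c u)) \<and>
    w0 \<le> best \<and> (\<forall>k\<in>{1..t}. V0 + (\<Sum>u\<in>{1..k}. d (\<sigma> u) - c u) \<le> best)"

text \<open>
  Some player is left with a gain of at least 0, so the winner at the root is not an extracted one.
\<close>
lemma selected_winner:
  assumes sel: "selected n d c V0 w0 t \<sigma> v w V k best" and t: "t < n"
    and nonneg: "\<forall>i\<in>{1..n}. 0 \<le> d i"
  shows "w 1 \<in> {1..n} - \<sigma> ` {1..t}" "v 1 = d (w 1)"
    "\<And>i. i \<in> {1..n} - \<sigma> ` {1..t} \<Longrightarrow> d i \<le> d (w 1)"
proof -
  have tree: "\<forall>q\<in>{1..<n}. node_ok v w q"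
    and leaf: "\<forall>i\<in>{1..n}. w (n + i - 1) = i"
    and val: "\<forall>i\<in>{1..n}. v (n + i - 1) = (if i \<in> \<sigma> ` {1..t} then -1 else d i)"
    and inj: "inj_on \<sigma> {1..t}"
    using sel unfolding selected_def by blast+
  have win: "w 1 \<in> {1..n}" "v 1 = v (n + w 1 - 1)"
    using tournament_winner[OF tree leaf, of 1] t by auto
  have le: "d i \<le> v 1" if i: "i \<in> {1..n} - \<sigma> ` {1..t}" for i
  proof -
    have "v (n + i - 1) \<le> v 1" by (rule tournament_max[OF tree]) (use i in auto)
    then show ?thesis using bspec[OF val, of i] i by simp
  qed
  have "card (\<sigma> ` {1..t}) < card {1..n}" using card_image[OF inj] t by simp
  then have "\<not> {1..n} \<subseteq> \<sigma> ` {1..t}"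
    by (intro notI) (drule card_mono[OF finite_imageI[OF finite_atLeastAtMost]], linarith)
  then obtain i where "i \<in> {1..n} - \<sigma> ` {1..t}" by blast
  then have "d i \<le> v 1" "0 \<le> d i" using le nonneg by blast+
  then have "0 \<le> v 1" by linarith
  then have "w 1 \<notin> \<sigma> ` {1..t}" using bspec[OF val win(1)] win(2) by auto
  then show "w 1 \<in> {1..n} - \<sigma> ` {1..t}" using win(1) by blast
  show v1: "v 1 = d (w 1)" using bspec[OF val win(1)] win(2) \<open>w 1 \<notin> \<sigma> ` {1..t}\<close> by simp
  show "\<And>i. i \<in> {1..n} - \<sigma> ` {1..t} \<Longrightarrow> d i \<le> d (w 1)" using le v1 by simp
qed

lemma selected_step:
  assumes sel: "selected n d c V0 w0 t \<sigma> v w V k best" and t: "t < n"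
    and nonneg: "\<forall>i\<in>{1..n}. 0 \<le> d i"
    and tree': "\<And>q. q \<in> {1..<n} \<Longrightarrow> node_ok v' w' q"
    and leaf': "\<And>i. i \<in> {1..n} \<Longrightarrow>
      v' (n + i - 1) = (if i = w 1 then -1 else v (n + i - 1)) \<and> w' (n + i - 1) = w (n + i - 1)"
    and V': "V' = V + v 1 - c (t + 1)"
  shows "selected n d c V0 w0 (t + 1) (\<sigma>(t + 1 := w 1)) v' w' V'
    (if best < V' then t + 1 else k) (if best < V' then V' else best)"
proof -
  note win = selected_winner[OF sel t nonneg]
  let ?m = "w 1"
  let ?\<sigma> = "\<sigma>(t + 1 := ?m)"
  have old: "inj_on \<sigma> {1..t}" "\<sigma> ` {1..t} \<subseteq> {1..n}" "k \<le> t"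
    "\<forall>i\<in>{1..n}. v (n + i - 1) = (if i \<in> \<sigma> ` {1..t} then -1 else d i) \<and> w (n + i - 1) = i"
    "\<forall>u\<in>{1..t}. \<forall>i\<in>{1..n} - \<sigma> ` {1..<u}. d i \<le> d (\<sigma> u)"
    "V = V0 + (\<Sum>u\<in>{1..t}. d (\<sigma> u) - c u)"
    "best = (if k = 0 then w0 else V0 + (\<Sum>u\<in>{1..k}. d (\<sigma> u) - c u))"
    "w0 \<le> best" "\<forall>k\<in>{1..t}. V0 + (\<Sum>u\<in>{1..k}. d (\<sigma> u) - c u) \<le> best"
    using sel unfolding selected_def by blast+
  have ins: "{1..t + 1} = insert (t + 1) {1..t}" by auto
  have img: "?\<sigma> ` {1..u} = \<sigma> ` {1..u}" "?\<sigma> ` {1..<u + 1} = \<sigma> ` {1..<u + 1}" if "u \<le> t" for u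
    using that by (auto simp: image_iff)
  have img': "?\<sigma> ` {1..t + 1} = insert ?m (\<sigma> ` {1..t})" unfolding ins using img[of t] by auto
  have sum_old: "(\<Sum>u\<in>{1..k}. d (?\<sigma> u) - c u) = (\<Sum>u\<in>{1..k}. d (\<sigma> u) - c u)" if "k \<le> t" for k
    using that by (intro sum.cong) auto
  have sum_new: "V0 + (\<Sum>u\<in>{1..t + 1}. d (?\<sigma> u) - c u) = V'"
  proof -
    have "(\<Sum>u\<in>{1..t + 1}. d (?\<sigma> u) - c u) = d ?m - c (t + 1) + (\<Sum>u\<in>{1..t}. d (?\<sigma> u) - c u)"
      unfolding ins by simp
    then show ?thesis using sum_old[OF order_refl] V' old(6) win(2) by linarith
  qed
  have inj': "inj_on ?\<sigma> {1..t + 1}"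
  proof -
    have "inj_on ?\<sigma> {1..t} \<longleftrightarrow> inj_on \<sigma> {1..t}" by (rule inj_on_cong) auto
    then have "inj_on ?\<sigma> {1..t}" using old(1) by simp
    moreover have "?\<sigma> (t + 1) \<notin> ?\<sigma> ` {1..t}" using win(1) img[of t] by auto
    ultimately show ?thesis unfolding ins by (auto simp: inj_on_insert)
  qed
  have order: "d i \<le> d (?\<sigma> u)" if u: "u \<in> {1..t + 1}" and i: "i \<in> {1..n} - ?\<sigma> ` {1..<u}" for u i
  proof (cases "u = t + 1")
    case True
    have "{1..<t + 1} = {1..t}" by auto
    then show ?thesis using win(3)[of i] i img[of t] True by auto
  next
    case False
    then have "u \<in> {1..t}" "u - 1 \<le> t" "u - 1 + 1 = u" using u by auto
    then show ?thesis using old(5) i img(2)[of "u - 1"] by auto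
  qed
  have leaves: "v' (n + i - 1) = (if i \<in> ?\<sigma> ` {1..t + 1} then -1 else d i) \<and> w' (n + i - 1) = i"
    if "i \<in> {1..n}" for i
    using leaf'[OF that] bspec[OF old(4) that] unfolding img' by auto
  have best: "V0 + (\<Sum>u\<in>{1..k}. d (?\<sigma> u) - c u) \<le> (if best < V' then V' else best)"
    if k: "k \<in> {1..t + 1}" for k
  proof (cases "k = t + 1")
    case True
    then show ?thesis using sum_new by simp
  next
    case False
    then show ?thesis using bspec[OF old(9), of k] sum_old[of k] k by auto
  qed
  show ?thesis
    unfolding selected_def
  proof (intro conjI)
    show "?\<sigma> ` {1..t + 1} \<subseteq> {1..n}" unfolding img' using win(1) old(2) by blast
    show "(if best < V' then V' else best) = (if (if best < V' then t + 1 else k) = 0 then w0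
      else V0 + (\<Sum>u\<in>{1..if best < V' then t + 1 else k}. d (?\<sigma> u) - c u))"
      using sum_new sum_old[OF old(3)] old(7) by simp
    show "V' = V0 + (\<Sum>u\<in>{1..t + 1}. d (?\<sigma> u) - c u)" using sum_new ..
  qed (use t inj' order leaves best tree' old(3,8) in auto)
qed

definition select_all :: com
  where "select_all = Seq (set_nvar ''bt'' (NConst 0)) (Seq (set_nvar ''t'' (NConst 1))
    (While (at_most (nvar ''t'') (nvar ''I'')) (Seq extract_max (Seq replay_path (incr ''t'')))))"

lemma runs_select_all:
  assumes n: "fst st ''I'' 0 = n" "1 \<le> n"
    and half: "\<And>q. q \<in> {1..<n + n} \<Longrightarrow> fst st ''half'' q = q div 2"
    and tree: "\<And>q. q \<in> {1..<n} \<Longrightarrow> node_ok (val st) (fst st ''idx'') q"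
    and leaf: "\<And>i. i \<in> {1..n} \<Longrightarrow> val st (n + i - 1) = d i \<and> fst st ''idx'' (n + i - 1) = i"
    and nonneg: "\<forall>i\<in>{1..n}. 0 \<le> d i"
    and c: "\<And>u. u \<in> {1..n} \<Longrightarrow> increment st u = c u"
  shows "runs select_all st (\<lambda>t st'. t \<le> n * (100 * floorlog 2 n + 300) \<and>
    selected n d c (snd st ''V'' 0 0) (snd st ''value'' 0 0) n (fst st' ''sig'') (val st') (fst st' ''idx'')
      (snd st' ''V'' 0 0) (fst st' ''bt'' 0) (snd st' ''value'' 0 0))"
proof -
  define V0 where "V0 = snd st ''V'' 0 0"
  define w0 where "w0 = snd st ''value'' 0 0"
  define Inv where "Inv st' \<longleftrightarrow> 1 \<le> fst st' ''t'' 0 \<and>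
    selected n d c V0 w0 (fst st' ''t'' 0 - 1) (fst st' ''sig'') (val st') (fst st' ''idx'')
      (snd st' ''V'' 0 0) (fst st' ''bt'' 0) (snd st' ''value'' 0 0)" for st' :: state
  show ?thesis
    unfolding select_all_def V0_def[symmetric] w0_def[symmetric]
    apply (simp add: runs_Seq[of "set_nvar _ _"])
    apply (rule runs_While[where Inv = Inv and T = "100 * floorlog 2 n + 240" and \<mu> = "\<lambda>st. n + 1 - fst st ''t'' 0"])
    subgoal using tree leaf by (auto simp: Inv_def selected_def V0_def w0_def)
    subgoal premises prems for st1
    proof -
      define t where "t = fst st1 ''t'' 0 - 1"
      have same: "fst st1 ''I'' 0 = n" "fst st1 ''half'' = fst st ''half''" "fst st1 ''j'' = fst st ''j''"
        "snd st1 ''eta'' = snd st ''eta''" "snd st1 ''z'' = snd st ''z''"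
        using agreeD[OF prems(2)] n by simp_all
      have t: "fst st1 ''t'' 0 = t + 1" "t < n"
        using prems(1,3) same by (auto simp: Inv_def t_def)
      have sel: "selected n d c V0 w0 t (fst st1 ''sig'') (val st1) (fst st1 ''idx'')
        (snd st1 ''V'' 0 0) (fst st1 ''bt'' 0) (snd st1 ''value'' 0 0)"
        using prems(1) by (simp add: Inv_def t_def)
      define m where "m = fst st1 ''idx'' 1"
      have m: "m \<in> {1..n}" using selected_winner(1)[OF sel t(2) nonneg] by (simp add: m_def)
      have tree1: "node_ok (val st1) (fst st1 ''idx'') q" if "q \<in> {1..<n}" for q
        using sel that by (simp add: selected_def)
      define V' where "V' = snd st1 ''V'' 0 0 + val st1 1 - c (t + 1)"
      have cV: "snd st1 ''V'' 0 0 + val st1 1 - increment st1 (fst st1 ''t'' 0) = V'"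
        using c[of "t + 1"] t by (simp add: V'_def increment_def same)
      let ?w = "snd st1 ''value'' 0 0"
      show ?thesis
      proof (rule runs_SeqI[OF runs_extract_max], goal_cases)
        case (1 s2 st2)
        then have 2: "s2 \<le> 200" "fst st2 ''sig'' = (fst st1 ''sig'')(t + 1 := m)" "snd st2 ''V'' 0 0 = V'"
          "snd st2 ''value'' 0 0 = (if ?w < V' then V' else ?w)"
          "fst st2 ''bt'' 0 = (if ?w < V' then t + 1 else fst st1 ''bt'' 0)"
          "val st2 = (val st1)(n + m - 1 := -1)" "fst st2 ''p'' 0 = fst st ''half'' (n + m - 1)"
          unfolding cV by (simp_all add: t same m_def)
        have keep: "fst st2 ''t'' = fst st1 ''t''" "fst st2 ''half'' = fst st ''half''"
          "fst st2 ''idx'' = fst st1 ''idx''"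
          using agreeD(1)[OF 1(2)] same by simp_all
        have "n + m - 1 \<in> {1..<n + n}" using m t by auto
        then have p: "fst st2 ''p'' 0 = (n + m - 1) div 2"
          using half[of "n + m - 1"] 2(7) by simp
        show ?case
        proof (rule runs_SeqI[OF runs_replay_path[where n = n]], goal_cases)
          case (1 q)
          then show ?case using half keep by simp
        next
          case 2
          then show ?case using p m by auto
        next
          case (3 q)
          show ?case
          proof (rule node_ok_cong[OF tree1[OF 3(1)]])
            fix r assume "r \<in> {q, q + q, q + q + 1}"
            then have "r \<noteq> n + m - 1" using 3 p m by auto
            then show "val st2 r = val st1 r \<and> fst st2 ''idx'' r = fst st1 ''idx'' r"
              using fun_cong[OF 2(6), of r] keep(3) by simp
          qed
        next
          case (4 s3 st3)
          have keep3: "fst st3 ''t'' = fst st1 ''t''" "fst st3 ''sig'' = fst st2 ''sig''"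
            "snd st3 ''V'' = snd st2 ''V''" "snd st3 ''value'' = snd st2 ''value''"
            "fst st3 ''bt'' = fst st2 ''bt''"
            using agreeD[OF 4(2)] keep by simp_all
          have "selected n d c V0 w0 (t + 1) ((fst st1 ''sig'')(t + 1 := m)) (val st3) (fst st3 ''idx'') V'
            (if ?w < V' then t + 1 else fst st1 ''bt'' 0) (if ?w < V' then V' else ?w)"
            unfolding m_def
          proof (rule selected_step[OF sel t(2) nonneg])
            show "node_ok (val st3) (fst st3 ''idx'') q" if "q \<in> {1..<n}" for q
              using 4(1) that by simp
            fix i assume i: "i \<in> {1..n}"
            then have "n \<le> n + i - 1" by auto
            then have "val st3 (n + i - 1) = val st2 (n + i - 1)"
              "fst st3 ''idx'' (n + i - 1) = fst st1 ''idx'' (n + i - 1)"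
              using 4(1) keep(3) by simp_all
            moreover have "n + i - 1 = n + m - 1 \<longleftrightarrow> i = m" using i m by auto
            ultimately show "val st3 (n + i - 1) = (if i = fst st1 ''idx'' 1 then -1 else val st1 (n + i - 1)) \<and>
              fst st3 ''idx'' (n + i - 1) = fst st1 ''idx'' (n + i - 1)"
              using fun_cong[OF 2(6), of "n + i - 1"] by (simp add: m_def[symmetric])
          qed (auto simp: V'_def)
          then show ?case
            using 4(1) 2(1-5) t by (simp add: Inv_def keep3)
        qed
      qed
    qed
    subgoal premises prems for s1 st1
    proof -
      have I: "fst st1 ''I'' 0 = n" using agreeD(1)[OF prems(2), of "''I''"] n by simp
      have "fst st1 ''t'' 0 - 1 = n" using prems(1,3) I by (auto simp: Inv_def selected_def)
      moreover have "n * (100 * floorlog 2 n + 300) = n * (100 * floorlog 2 n + 246) + n * 54"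
        "s1 \<le> n * (100 * floorlog 2 n + 246) + 6"
        using prems(4) by (simp_all add: algebra_simps)
      then have "6 + s1 \<le> n * (100 * floorlog 2 n + 300)" using n(2) by linarith
      ultimately show ?thesis using prems(1) by (simp add: Inv_def)
    qed
    done
qed

definition write_row :: "nexp \<Rightarrow> com"
  where "write_row e = Seq
    (RSet ''zplus'' (NGet ''sig'' (nvar ''t'')) (NConst 0) (RSub RZero (RGet ''z'' (NConst 1) e)))
    (RSet ''zminus'' (NGet ''sig'' (nvar ''t'')) (NConst 0) (RGet ''z'' (NConst 1) e))"

text \<open>
  Nothing is written when the level brought no improvement.
\<close>
definition write_box :: com
  where "write_box = Cond (NLess (NConst 0) (nvar ''bt''))
    (Seq (set_nvar ''t'' (NConst 1)) (While (at_most (nvar ''t'') (nvar ''I''))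
      (Seq (Cond (at_most (nvar ''t'') (nvar ''bt'')) (write_row (nvar ''j''))
        (write_row (NSub (nvar ''j'') (NConst 1)))) (incr ''t''))))
    Skip"

lemma runs_write_box:
  assumes n: "fst st ''I'' 0 = n" "1 \<le> n" and inj: "inj_on (fst st ''sig'') {1..n}"
  defines "y \<equiv> \<lambda>u. snd st ''z'' 1 (if u \<le> fst st ''bt'' 0 then fst st ''j'' 0 else fst st ''j'' 0 - 1)"
  shows "runs write_box st (\<lambda>t st'. t \<le> 100 * n \<and>
    (if fst st ''bt'' 0 = 0 then snd st' ''zplus'' = snd st ''zplus'' \<and> snd st' ''zminus'' = snd st ''zminus''
     else \<forall>u\<in>{1..n}. snd st' ''zplus'' (fst st ''sig'' u) 0 = - y u \<and>
       snd st' ''zminus'' (fst st ''sig'' u) 0 = y u))"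
proof (cases "fst st ''bt'' 0 = 0")
  case True
  then show ?thesis using n by (simp add: write_box_def runs_Cond)
next
  case False
  let ?\<sigma> = "fst st ''sig''"
  define Inv where "Inv st' \<longleftrightarrow> (let k = fst st' ''t'' 0 in 1 \<le> k \<and> k \<le> n + 1 \<and> (\<forall>u\<in>{1..<k}.
    snd st' ''zplus'' (?\<sigma> u) 0 = - y u \<and> snd st' ''zminus'' (?\<sigma> u) 0 = y u))" for st' :: state
  have neq: "?\<sigma> u \<noteq> ?\<sigma> k" if "1 \<le> u" "u < k" "k \<le> n" for u k
    using inj_onD[OF inj, of u k] that by auto
  have ins: "{1..<k + 1} = insert k {1..<k}" if "1 \<le> k" for k :: nat
    using that by auto
  show ?thesis
    using False
    unfolding write_box_def write_row_def
    apply (simp add: runs_Seq runs_Cond)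
    apply (rule runs_While[where Inv = Inv and T = 60 and \<mu> = "\<lambda>st. n + 1 - fst st ''t'' 0"])
    subgoal by (auto simp: Inv_def)
    subgoal for st1
      using n neq agreeD[of _ _ st1 "''I''"] agreeD[of _ _ st1 "''sig''"] agreeD[of _ _ st1 "''z''"]
        agreeD[of _ _ st1 "''bt''"] agreeD[of _ _ st1 "''j''"]
      by (auto simp: Inv_def runs_Seq runs_Cond Let_def ins y_def)
    subgoal for t st1
      using n agreeD[of _ _ st1 "''I''"]
      by (auto simp: Inv_def Let_def)
    done
qed

text \<open>
  The value \<open>V\<close> is not reset between levels: narrowing all coordinates at level \<open>j\<close> gives the same
  square as narrowing none at level \<open>j + 1\<close>.
\<close>
definition level_step :: com
  where "level_step = Seq fill_leaves (Seq build_tree (Seq select_all (Seq write_box (incr ''j''))))"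

text \<open>
  The entry \<open>eta 0 = 0\<close> is not part of the input. The search starts from the whole box, which has
  objective value 0.
\<close>
definition separation_program :: com
  where "separation_program =
    Seq (RSet ''eta'' (NConst 0) (NConst 0) RZero)
    (Seq (set_rvar ''value'' RZero)
    (Seq (set_rvar ''V'' RZero)
    (Seq init_half
    (Seq widest_box
    (Seq (set_nvar ''j'' (NConst 1))
    (While (at_most (NAdd (nvar ''j'') (nvar ''j'')) (NGet ''J'' (NConst 1))) level_step))))))"

section \<open>Correctness and running time\<close>

context symmetric_separation
begin

definition prepared :: "state \<Rightarrow> bool"
  where "prepared st \<longleftrightarrow> fst st ''I'' 0 = I \<and> fst st ''J'' 1 = K \<and> snd st ''s'' 0 0 = s \<and>
    (\<forall>u\<le>I. snd st ''eta'' u 0 = eta \<Theta> u) \<and> (\<forall>j\<le>K. snd st ''z'' 1 j = z 1 j) \<and>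
    (\<forall>i\<in>{1..I}. \<forall>j\<in>{1..K}. snd st ''xi'' i j = \<xi> i j) \<and>
    (\<forall>q\<in>{1..<I + I}. fst st ''half'' q = q div 2)"

lemma prepared_agree:
  assumes "prepared st" "agree X st st'"
    and "X \<inter> {''I'', ''J'', ''s'', ''eta'', ''z'', ''xi'', ''half''} = {}"
  shows "prepared st'"
proof -
  have "y \<notin> X" if "y \<in> {''I'', ''J'', ''s'', ''eta'', ''z'', ''xi'', ''half''}" for y
    using assms(3) that by blast
  then have "fst st' y = fst st y" "snd st' y = snd st y"
    if "y \<in> {''I'', ''J'', ''s'', ''eta'', ''z'', ''xi'', ''half''}" for y
    using agreeD[OF assms(2)] that by blast+
  then show ?thesis using assms(1) unfolding prepared_def by simp
qed

text \<open>
  The invariant of the main loop: the output is the best among all two-level boxes of the levels below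
  \<open>j\<close>, and at least as good as the square of level \<open>j - 1\<close>, which is the starting point of level \<open>j\<close>.
\<close>
definition explored :: "nat \<Rightarrow> state \<Rightarrow> bool"
  where "explored j st \<longleftrightarrow> 1 \<le> j \<and> j \<le> h + 1 \<and> fst st ''j'' 0 = j \<and>
    snd st ''V'' 0 0 = square_value (j - 1) \<and> square_value (j - 1) \<le> output_value st \<and>
    (\<forall>j'\<in>{1..<j}. \<forall>S. S \<subseteq> {1..I} \<longrightarrow> two_level_value j' S \<le> output_value st) \<and>
    output_rectangle I st \<in> rectangles I J z \<and> obj (output_rectangle I st) = output_value st"

text \<open>
  The case \<open>S = {}\<close> is the square of the previous level, which \<open>w0\<close> already accounts for; the other
  sets are beaten by the extraction of \<open>card S\<close> players.
\<close>
lemma selected_all: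
  assumes j: "j \<in> {1..h}" and w0: "square_value (j - 1) \<le> w0"
    and sel: "selected I (\<lambda>i. gain i j) (cut j) (square_value (j - 1)) w0 I \<sigma> v w V k best"
  shows "bij_betw \<sigma> {1..I} {1..I}" "V = square_value j" "V \<le> best" "w0 \<le> best" "k \<le> I"
    "S \<subseteq> {1..I} \<Longrightarrow> two_level_value j S \<le> best"
    "best = (if k = 0 then w0 else two_level_value j (\<sigma> ` {1..k}))"
proof -
  note sel' = sel[unfolded selected_def]
  have inj: "inj_on \<sigma> {1..I}" and img: "\<sigma> ` {1..I} \<subseteq> {1..I}"
    and order: "\<forall>u\<in>{1..I}. \<forall>i\<in>{1..I} - \<sigma> ` {1..<u}. gain i j \<le> gain (\<sigma> u) j"
    and V: "V = square_value (j - 1) + (\<Sum>u\<in>{1..I}. gain (\<sigma> u) j - cut j u)"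
    and best: "best = (if k = 0 then w0 else square_value (j - 1) + (\<Sum>u\<in>{1..k}. gain (\<sigma> u) j - cut j u))"
    and max: "\<forall>k\<in>{1..I}. square_value (j - 1) + (\<Sum>u\<in>{1..k}. gain (\<sigma> u) j - cut j u) \<le> best"
    using sel' by blast+
  show le: "w0 \<le> best" and k: "k \<le> I" using sel' by blast+
  have surj: "\<sigma> ` {1..I} = {1..I}" by (rule endo_inj_surj[OF _ img inj]) simp
  then show \<sigma>: "bij_betw \<sigma> {1..I} {1..I}" using inj by (simp add: bij_betw_def)
  have mono: "mono_on {1..I} (\<lambda>u. - gain (\<sigma> u) j)"
  proof (rule mono_onI)
    fix u v assume uv: "u \<in> {1..I}" "v \<in> {1..I}" "u \<le> v"
    have "\<sigma> v \<notin> \<sigma> ` {1..<u}"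
    proof
      assume "\<sigma> v \<in> \<sigma> ` {1..<u}"
      then obtain u' where "u' \<in> {1..<u}" "\<sigma> v = \<sigma> u'" by blast
      moreover from this have "u' \<in> {1..I}" using uv by auto
      ultimately show False using inj_onD[OF inj, of v u'] uv by auto
    qed
    moreover have "\<sigma> v \<in> {1..I}" using img uv by blast
    ultimately show "- gain (\<sigma> u) j \<le> - gain (\<sigma> v) j" using order uv(1) by auto
  qed
  have j1: "1 \<le> j" using j by simp
  have gv: "two_level_value j (\<sigma> ` {1..t}) = square_value (j - 1) + (\<Sum>u\<in>{1..t}. gain (\<sigma> u) j - cut j u)"
    if "t \<le> I" for t by (rule greedy_value[OF j1 \<sigma> that])
  show "V = square_value j"
    using V gv[of I] two_level_value_square(1)[of j] by (simp add: surj)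
  show "V \<le> best" using V bspec[OF max, of I] I_pos by simp
  show "best = (if k = 0 then w0 else two_level_value j (\<sigma> ` {1..k}))" using best gv[OF k] by simp
  assume S: "S \<subseteq> {1..I}"
  show "two_level_value j S \<le> best"
  proof (cases "card S = 0")
    case True
    then have "S = {}" using finite_subset[OF S] by simp
    then show ?thesis using two_level_value_square(2)[of j] w0 le by simp
  next
    case False
    then have "card S \<in> {1..I}" using card_mono[OF _ S] by simp
    then show ?thesis
      using two_level_value_le_greedy[OF j1 S \<sigma> mono] bspec[OF max, of "card S"] by linarith
  qed
qed

lemma runs_level_step:
  assumes prep: "prepared st" and expl: "explored j st" and jh: "j \<le> h"
  shows "runs level_step st (\<lambda>t st'. t \<le> I * (100 * floorlog 2 I + 710) \<and> explored (j + 1) st')"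
proof -
  have j: "j \<in> {1..h}" "fst st ''j'' 0 = j" using expl jh by (auto simp: explored_def)
  have jK: "j \<le> K" "j - 1 \<le> K" "K + 1 - j \<in> {1..K}" "j \<in> {1..K}" using j K_even by auto
  have n: "fst st ''I'' 0 = I" using prep by (simp add: prepared_def)
  define w0 where "w0 = output_value st"
  have V0: "snd st ''V'' 0 0 = square_value (j - 1)" "square_value (j - 1) \<le> w0"
    "snd st ''value'' 0 0 = w0"
    using expl by (auto simp: explored_def w0_def output_value_def)
  have gain_eq: "snd st ''xi'' i (fst st ''J'' 1 + 1 - fst st ''j'' 0) / snd st ''s'' 0 0
      + (snd st ''z'' 1 (fst st ''j'' 0) - snd st ''z'' 1 (fst st ''j'' 0 - 1))
      - snd st ''xi'' i (fst st ''j'' 0) / snd st ''s'' 0 0 = gain i j" if "i \<in> {1..I}" for i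
    using prep that jK by (simp add: prepared_def j(2) gain_def scaleR_fun_def divide_inverse)
  show ?thesis
    unfolding level_step_def
  proof (rule runs_SeqI[OF runs_fill_leaves[OF n I_pos refl]], goal_cases)
    case (1 t1 st1)
    have n1: "fst st1 ''I'' 0 = I" using agreeD(1)[OF 1(2), of "''I''"] n by (simp add: fill_leaves_def)
    show ?case
    proof (rule runs_SeqI[OF runs_build_tree[OF n1 I_pos]], goal_cases)
      case (1 t2 st2)
      note st1 = \<open>t1 \<le> 200 * I \<and> _\<close> \<open>agree (writes fill_leaves) st st1\<close> and st2 = 1
      have ag2: "agree {''i'', ''val'', ''idx'', ''p''} st st2"
        using st1(2) st2(2) by (auto simp: agree_def fill_leaves_def build_tree_def)
      have prep2: "prepared st2" by (rule prepared_agree[OF prep ag2]) simp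
      have same2: "fst st2 ''j'' = fst st ''j''" "snd st2 ''V'' = snd st ''V''"
        "snd st2 ''value'' = snd st ''value''" "snd st2 ''zplus'' = snd st ''zplus''"
        "snd st2 ''zminus'' = snd st ''zminus''"
        using agreeD[OF ag2] by simp_all
      have n2: "fst st2 ''I'' 0 = I" using prep2 by (simp add: prepared_def)
      have leaf2: "val st2 (I + i - 1) = gain i j \<and> fst st2 ''idx'' (I + i - 1) = i" if i: "i \<in> {1..I}" for i
      proof -
        have "I \<le> I + i - 1" using i by auto
        then show ?thesis using st1(1) st2(1) i gain_eq[OF i] by simp
      qed
      have inc: "increment st2 u = cut j u" if "u \<in> {1..I}" for u
      proof -
        have "u \<le> I" "u - 1 \<le> I" using that by auto
        then show ?thesis
          using prep2 jK by (simp add: prepared_def increment_def cut_def \<delta>_def same2 j)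
      qed
      have pos: "\<forall>i\<in>{1..I}. 0 \<le> gain i j" using gain_bounds(1) j(1) by blast
      show ?case
      proof (rule runs_SeqI[OF runs_select_all[OF n2 I_pos, where d = "\<lambda>i. gain i j" and c = "cut j"]], goal_cases)
        case (1 q) then show ?case using prep2 by (simp add: prepared_def)
      next
        case (2 q) then show ?case using st2 by simp
      next
        case (3 i) then show ?case by (rule leaf2)
      next
        case 4 show ?case by (rule pos)
      next
        case (5 u) then show ?case by (rule inc)
      next
        case (6 t3 st3)
        define \<sigma> where "\<sigma> = fst st3 ''sig''"
        define k where "k = fst st3 ''bt'' 0"
        have sel: "selected I (\<lambda>i. gain i j) (cut j) (square_value (j - 1)) w0 I \<sigma>
          (val st3) (fst st3 ''idx'') (snd st3 ''V'' 0 0) k (output_value st3)"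
          using 6(1) by (simp add: same2 V0 \<sigma>_def k_def output_value_def)
        note all = selected_all[OF j(1) V0(2) sel]
        have ag3: "agree (writes select_all) st2 st3" by (rule 6(2))
        have prep3: "prepared st3"
          by (rule prepared_agree[OF prep2 ag3]) (simp add: select_all_def)
        have same3: "fst st3 ''j'' = fst st ''j''" "snd st3 ''zplus'' = snd st ''zplus''"
          "snd st3 ''zminus'' = snd st ''zminus''"
          using agreeD[OF ag3] same2 by (simp_all add: select_all_def)
        have n3: "fst st3 ''I'' 0 = I" using prep3 by (simp add: prepared_def)
        have inj3: "inj_on (fst st3 ''sig'') {1..I}"
          using bij_betw_imp_inj_on[OF all(1)] by (simp add: \<sigma>_def)
        show ?case
        proof (rule runs_SeqI[OF runs_write_box[OF n3 I_pos inj3]], goal_cases)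
          case (1 t4 st4)
          have same4: "fst st4 ''j'' = fst st ''j''" "snd st4 ''V'' = snd st3 ''V''"
            "output_value st4 = output_value st3"
            using agreeD[OF 1(2)] same3 by (simp_all add: write_box_def write_row_def output_value_def)
          have zr: "snd st3 ''z'' 1 (if u \<le> k then fst st3 ''j'' 0 else fst st3 ''j'' 0 - 1)
            = (if u \<le> k then z 1 j else z 1 (j - 1))" for u
            using prep3 jK by (simp add: prepared_def same3 j)
          have out: "output_rectangle I st4 \<in> rectangles I J z \<and>
            obj (output_rectangle I st4) = output_value st4"
          proof (cases "k = 0")
            case True
            then have "output_rectangle I st4 = output_rectangle I st"
              using 1(1) by (simp add: output_rectangle_def k_def same3)
            moreover have "output_value st4 = output_value st"
              using all(7) True by (simp add: same4 w0_def)
            ultimately show ?thesis using expl by (simp add: explored_def)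
          next
            case False
            have zp: "snd st4 ''zplus'' (\<sigma> u) 0 = - (if u \<le> k then z 1 j else z 1 (j - 1))"
              "snd st4 ''zminus'' (\<sigma> u) 0 = (if u \<le> k then z 1 j else z 1 (j - 1))"
              if "u \<in> {1..I}" for u
              using 1(1) False that unfolding k_def[symmetric] \<sigma>_def[symmetric] zr by auto
            have "output_rectangle I st4 = two_level j (\<sigma> ` {1..k})"
            proof -
              have "snd st4 ''zplus'' i 0 = (if i \<in> \<sigma> ` {1..k} then - z 1 j else - z 1 (j - 1)) \<and>
                snd st4 ''zminus'' i 0 = (if i \<in> \<sigma> ` {1..k} then z 1 j else z 1 (j - 1))"
                if i: "i \<in> {1..I}" for i
              proof -
                obtain u where u: "u \<in> {1..I}" "i = \<sigma> u"
                  using bij_betw_imp_surj_on[OF all(1)] i by blast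
                have "i \<in> \<sigma> ` {1..k} \<longleftrightarrow> u \<in> {1..k}"
                  unfolding u(2) by (rule inj_on_image_mem_iff[OF bij_betw_imp_inj_on[OF all(1)] u(1)])
                    (use all(5) in auto)
                then show ?thesis using zp[OF u(1)] u by simp
              qed
              then show ?thesis
                by (auto simp: output_rectangle_def two_level_def restrict_vec_def fun_eq_iff)
            qed
            moreover have "\<sigma> ` {1..k} \<subseteq> {1..I}"
              using bij_betw_imp_surj_on[OF all(1)] all(5) by auto
            moreover have "output_value st4 = two_level_value j (\<sigma> ` {1..k})"
              using all(7) False by (simp add: same4)
            ultimately show ?thesis using two_level_rectangle[OF j(1)] obj_two_level[OF j(1)] by simp
          qed
          have level_values: "snd st4 ''V'' 0 0 = square_value j" "square_value j \<le> output_value st4"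
            "w0 \<le> output_value st4"
            using all(2-4) by (simp_all add: same4)
          have all_j: "two_level_value j' S \<le> output_value st4"
            if j': "j' \<in> {1..<j + 1}" and S: "S \<subseteq> {1..I}" for j' S
          proof (cases "j' = j")
            case True
            then show ?thesis using all(6)[OF S] by (simp add: same4)
          next
            case False
            then have "two_level_value j' S \<le> w0"
              using expl j' S by (auto simp: explored_def w0_def)
            then show ?thesis using level_values(3) by linarith
          qed
          define st5 where "st5 = nupdate ''j'' 0 (j + 1) st4"
          have "output_rectangle I st5 = output_rectangle I st4" "output_value st5 = output_value st4"
            by (simp_all add: st5_def output_rectangle_def output_value_def)
          then have "explored (j + 1) st5"
            using out level_values(1,2) all_j j(1) by (simp add: explored_def) (simp add: st5_def)
          moreover have "t1 + (t2 + (t3 + (t4 + 6))) \<le> I * (100 * floorlog 2 I + 710)"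
          proof -
            have "I * (100 * floorlog 2 I + 710) = I * (100 * floorlog 2 I + 300) + I * 410"
              by (simp add: algebra_simps)
            moreover have "t1 \<le> 200 * I" "t2 \<le> 100 * I" "t3 \<le> I * (100 * floorlog 2 I + 300)" "t4 \<le> 100 * I"
              using st1(1) st2(1) 6(1) 1(1) by blast+
            ultimately show ?thesis using I_pos by linarith
          qed
          ultimately show ?case by (simp add: same4 j(2) st5_def)
        qed
      qed
    qed
  qed
qed

lemma runs_separation_program:
  assumes input: "separation_input I \<Theta> J z \<xi> s st"
  shows "runs separation_program st (\<lambda>t st'. t \<le> h * (I * (100 * floorlog 2 I + 1000)) \<and>
    separation_solution I \<Theta> J z \<xi> s (output_rectangle I st') \<and>
    output_value st' = obj (output_rectangle I st'))"
proof -
  define st0 where "st0 = rupdate ''V'' 0 0 0 (rupdate ''value'' 0 0 0 (rupdate ''eta'' 0 0 0 st))"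
  have inp: "fst st ''I'' 0 = I" "snd st ''s'' 0 0 = s"
    and coord: "fst st ''J'' i = J i" "snd st ''eta'' i 0 = eta \<Theta> i"
      "\<forall>j\<in>{0..J i}. snd st ''z'' i j = z i j" "\<forall>j\<in>{1..J i}. snd st ''xi'' i j = \<xi> i j"
    if "i \<in> {1..I}" for i
    using input that unfolding separation_input_def by blast+
  have one: "1 \<in> {1..I}" using I_pos by simp
  have in0: "fst st0 ''I'' 0 = I" "fst st0 ''J'' 1 = K" "snd st0 ''s'' 0 0 = s"
    "\<forall>j\<le>K. snd st0 ''z'' 1 j = z 1 j" "snd st0 ''V'' 0 0 = 0" "snd st0 ''value'' 0 0 = 0"
    using inp[OF one] coord[OF one] by (simp_all add: st0_def)
  have eta0: "\<forall>u\<le>I. snd st0 ''eta'' u 0 = eta \<Theta> u"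
    using coord(2) by (auto simp: st0_def)
  have xi0: "\<forall>i\<in>{1..I}. \<forall>j\<in>{1..K}. snd st0 ''xi'' i j = \<xi> i j"
  proof
    fix i assume i: "i \<in> {1..I}"
    show "\<forall>j\<in>{1..K}. snd st0 ''xi'' i j = \<xi> i j"
      using coord(4)[OF i] unfolding breakpoints_same(1)[OF i] by (simp add: st0_def)
  qed
  have "runs (Seq init_half (Seq widest_box (Seq (set_nvar ''j'' (NConst 1))
      (While (at_most (NAdd (nvar ''j'') (nvar ''j'')) (NGet ''J'' (NConst 1))) level_step)))) st0
    (\<lambda>t st'. t + 12 \<le> h * (I * (100 * floorlog 2 I + 1000)) \<and>
      separation_solution I \<Theta> J z \<xi> s (output_rectangle I st') \<and>
      output_value st' = obj (output_rectangle I st'))"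
  proof (rule runs_SeqI[OF runs_init_half[OF in0(1) I_pos]], goal_cases)
    case (1 t1 st1)
    have ag1: "agree {''half'', ''p''} st0 st1" using 1(2) by (auto simp: agree_def init_half_def)
    have prep1: "prepared st1"
      using in0 eta0 xi0 1(1) agreeD[OF ag1] by (simp add: prepared_def)
    have n1: "fst st1 ''I'' 0 = I" using prep1 by (simp add: prepared_def)
    show ?case
    proof (rule runs_SeqI[OF runs_widest_box[OF n1 I_pos]], goal_cases)
      case (1 t2 st2)
      have ag2: "agree {''i'', ''zplus'', ''zminus''} st1 st2" using 1(2) by (auto simp: agree_def widest_box_def)
      have prep2: "prepared st2" by (rule prepared_agree[OF prep1 ag2]) simp
      have zero2: "snd st2 ''V'' 0 0 = 0" "snd st2 ''value'' 0 0 = 0"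
        using agreeD[OF ag2] agreeD[OF ag1] in0 by simp_all
      have "output_rectangle I st2 = square I z 0"
        using 1(1) prep1 z_reflect[of 0]
        by (auto simp: output_rectangle_def square_def restrict_vec_def prepared_def fun_eq_iff)
      then have out2: "output_rectangle I st2 \<in> rectangles I J z" "obj (output_rectangle I st2) = 0"
        using square_rectangle[of 0] obj_square[of 0] by simp_all
      define st3 where "st3 = nupdate ''j'' 0 1 st2"
      have prep3: "prepared st3" using prep2 by (simp add: prepared_def st3_def)
      have expl3: "explored 1 st3"
        using out2 zero2 by (simp add: explored_def output_rectangle_def output_value_def st3_def)
      have "runs (While (at_most (NAdd (nvar ''j'') (nvar ''j'')) (NGet ''J'' (NConst 1))) level_step) st3
        (\<lambda>t st'. t1 + (t2 + (3 + t)) + 12 \<le> h * (I * (100 * floorlog 2 I + 1000)) \<and>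
          separation_solution I \<Theta> J z \<xi> s (output_rectangle I st') \<and>
          output_value st' = obj (output_rectangle I st'))"
      proof (rule runs_While[where Inv = "\<lambda>st. explored (fst st ''j'' 0) st"
            and T = "I * (100 * floorlog 2 I + 710)" and \<mu> = "\<lambda>st. h + 1 - fst st ''j'' 0"], goal_cases)
        case 1
        then show ?case using expl3 by (simp add: st3_def)
      next
        case (2 st4)
        let ?j = "fst st4 ''j'' 0"
        have prep4: "prepared st4"
          by (rule prepared_agree[OF prep3 2(2)])
            (simp add: level_step_def fill_leaves_def build_tree_def select_all_def write_box_def write_row_def)
        have "?j + ?j \<le> K" using 2(3) prep4 by (simp add: prepared_def)
        then have "?j \<le> h" by linarith
        from runs_level_step[OF prep4 2(1) \<open>?j \<le> h\<close>] show ?case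
          by (rule runs_mono) (use \<open>?j \<le> h\<close> in \<open>auto simp: explored_def\<close>)
      next
        case (3 t st4)
        let ?j = "fst st4 ''j'' 0"
        have prep4: "prepared st4"
          by (rule prepared_agree[OF prep3 3(2)])
            (simp add: level_step_def fill_leaves_def build_tree_def select_all_def write_box_def write_row_def)
        have "\<not> ?j + ?j \<le> K" "?j \<le> h + 1"
          using 3(1,3) prep4 by (simp_all add: prepared_def explored_def)
        then have "?j = h + 1" using K_even by linarith
        then have expl: "explored (h + 1) st4" using 3(1) by simp
        have "obj R \<le> obj (output_rectangle I st4)" if R: "R \<in> rectangles I J z" for R
        proof -
          obtain j S where jS: "j \<in> {1..h}" "S \<subseteq> {1..I}" "obj R \<le> two_level_value j S"
            by (rule rectangle_le_two_level[OF R]) (rule that)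
          then have "two_level_value j S \<le> output_value st4" using expl by (simp add: explored_def)
          then show ?thesis using jS(3) expl by (simp add: explored_def)
        qed
        then have sol: "separation_solution I \<Theta> J z \<xi> s (output_rectangle I st4)"
          using expl by (simp add: separation_solution_iff explored_def)
        define A where "A = I * (100 * floorlog 2 I + 710)"
        have t: "t \<le> h * (A + 9) + 9"
          using 3(4) by (simp add: st3_def A_def)
        have "h * (I * (100 * floorlog 2 I + 1000)) = h * A + h * (I * 290)"
          by (simp add: A_def algebra_simps)
        moreover have "h * (A + 9) = h * A + h * 9" by (simp add: algebra_simps)
        moreover have "h * 9 \<le> h * (I * 9)" "I * 281 \<le> h * (I * 281)"
          using I_pos h_pos by simp_all
        moreover have "h * (I * 290) = h * (I * 281) + h * (I * 9)" by (simp add: algebra_simps)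
        moreover have "t1 \<le> 100 * I" "t2 \<le> 100 * I" using \<open>t1 \<le> 100 * I \<and> _\<close> 1(1) by blast+
        ultimately have "t1 + (t2 + (3 + t)) + 12 \<le> h * (I * (100 * floorlog 2 I + 1000))"
          using t I_pos by linarith
        then show ?case using sol expl by (simp add: explored_def)
      qed
      then show ?case by (simp add: st3_def runs_Seq)
    qed
  qed
  then show ?thesis
    unfolding separation_program_def
    by (simp add: runs_Seq[of "RSet _ _ _ _"] st0_def[symmetric] add.commute)
qed

lemma square_solution_exists:
  assumes few: "\<forall>j\<in>{1..J 1}. card {i\<in>{1..I}. eta \<Theta> i - eta \<Theta> (i - 1) \<in> {z 1 (j - 1)..<z 1 j}} \<le> 1"
  shows "(\<exists>j\<in>{0..J 1 div 2}. separation_solution I \<Theta> J z \<xi> s (square I z j)) \<and>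
    ((\<exists>R\<in>rectangles I J z. 0 < obj R) \<longrightarrow>
      (\<exists>j\<in>{1..J 1 div 2}. separation_solution I \<Theta> J z \<xi> s (square I z j)))"
proof -
  obtain k where k: "k \<le> h" "separation_solution I \<Theta> J z \<xi> s (square I z k)"
    using square_solution[OF few] by blast
  have "1 \<le> k" if R: "R \<in> rectangles I J z" "0 < obj R" for R
  proof (rule ccontr)
    assume "\<not> 1 \<le> k"
    then have "k = 0" by simp
    then have "obj (square I z k) = 0" using obj_square[of 0] by simp
    then show False using R k(2) by (force simp: separation_solution_iff)
  qed
  then show ?thesis using k by auto
qed

end

theorem theorem2:
  shows
    "(\<exists>(prog :: com) (C :: real). \<forall>N \<Xi> I E \<Theta> J z \<xi> s st.
        separation_instance N \<Xi> I E \<Theta> J z \<xi> s \<longrightarrow> symmetric_instance I \<Theta> J z \<longrightarrow>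
        separation_input I \<Theta> J z \<xi> s st \<longrightarrow>
        (\<exists>t st'. exec prog st t st' \<and>
          separation_solution I \<Theta> J z \<xi> s (output_rectangle I st') \<and>
          output_value st' = separation_objective I \<Theta> J z \<xi> s (output_rectangle I st') \<and>
          real t \<le> C * real I * real (J 1) * max 1 (log 2 (real I))))
     \<and>
     (\<forall>N \<Xi> I E \<Theta> J z \<xi> s.
        separation_instance N \<Xi> I E \<Theta> J z \<xi> s \<longrightarrow> symmetric_instance I \<Theta> J z \<longrightarrow>
        (\<forall>j\<in>{1..J 1}. card {i\<in>{1..I}. eta \<Theta> i - eta \<Theta> (i - 1) \<in> {z 1 (j - 1)..<z 1 j}} \<le> 1) \<longrightarrow>
        (\<exists>j\<in>{0..J 1 div 2}. separation_solution I \<Theta> J z \<xi> s (square I z j)) \<and>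
        ((\<exists>R\<in>rectangles I J z. 0 < separation_objective I \<Theta> J z \<xi> s R) \<longrightarrow>
          (\<exists>j\<in>{1..J 1 div 2}. separation_solution I \<Theta> J z \<xi> s (square I z j))))"
proof (intro conjI)
  show "\<exists>(prog :: com) (C :: real). \<forall>N \<Xi> I E \<Theta> J z \<xi> s st.
        separation_instance N \<Xi> I E \<Theta> J z \<xi> s \<longrightarrow> symmetric_instance I \<Theta> J z \<longrightarrow>
        separation_input I \<Theta> J z \<xi> s st \<longrightarrow>
        (\<exists>t st'. exec prog st t st' \<and>
          separation_solution I \<Theta> J z \<xi> s (output_rectangle I st') \<and>
          output_value st' = separation_objective I \<Theta> J z \<xi> s (output_rectangle I st') \<and>
          real t \<le> C * real I * real (J 1) * max 1 (log 2 (real I)))"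
  proof (rule exI[of _ separation_program], rule exI[of _ 1200], intro allI impI)
    fix N \<Xi> I E \<Theta> J z \<xi> s st
    assume "separation_instance N \<Xi> I E \<Theta> J z \<xi> s" "symmetric_instance I \<Theta> J z"
      and input: "separation_input I \<Theta> J z \<xi> s st"
    then interpret symmetric_separation N \<Xi> I E \<Theta> J z \<xi> s by unfold_locales
    obtain t st' where run: "exec separation_program st t st'"
        "t \<le> h * (I * (100 * floorlog 2 I + 1000))"
        "separation_solution I \<Theta> J z \<xi> s (output_rectangle I st')"
        "output_value st' = obj (output_rectangle I st')"
      using runs_separation_program[OF input] unfolding runs_def by blast
    let ?L = "max 1 (log 2 (real I))"
    have "0 \<le> log 2 (real I)" using I_pos by simp
    then have "real (floorlog 2 I) \<le> log 2 (real I) + 1"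
      using I_pos by (simp add: floorlog_def)
    then have "100 * real (floorlog 2 I) + 1000 \<le> 1200 * ?L" by (simp add: max_def)
    then have "real h * (real I * (100 * real (floorlog 2 I) + 1000)) \<le> real (J 1) * (real I * (1200 * ?L))"
      by (intro mult_mono) auto
    moreover have "real t \<le> real h * (real I * (100 * real (floorlog 2 I) + 1000))"
      using of_nat_mono[OF run(2), where 'a = real] by simp
    ultimately have "real t \<le> 1200 * real I * real (J 1) * ?L" by (simp add: mult_ac)
    with run show "\<exists>t st'. exec separation_program st t st' \<and>
          separation_solution I \<Theta> J z \<xi> s (output_rectangle I st') \<and>
          output_value st' = separation_objective I \<Theta> J z \<xi> s (output_rectangle I st') \<and>
          real t \<le> 1200 * real I * real (J 1) * max 1 (log 2 (real I))" by blast
  qed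
next
  show "\<forall>N \<Xi> I E \<Theta> J z \<xi> s.
        separation_instance N \<Xi> I E \<Theta> J z \<xi> s \<longrightarrow> symmetric_instance I \<Theta> J z \<longrightarrow>
        (\<forall>j\<in>{1..J 1}. card {i\<in>{1..I}. eta \<Theta> i - eta \<Theta> (i - 1) \<in> {z 1 (j - 1)..<z 1 j}} \<le> 1) \<longrightarrow>
        (\<exists>j\<in>{0..J 1 div 2}. separation_solution I \<Theta> J z \<xi> s (square I z j)) \<and>
        ((\<exists>R\<in>rectangles I J z. 0 < separation_objective I \<Theta> J z \<xi> s R) \<longrightarrow>
          (\<exists>j\<in>{1..J 1 div 2}. separation_solution I \<Theta> J z \<xi> s (square I z j)))"
    by (intro allI impI symmetric_separation.square_solution_exists symmetric_separation.intro)
qed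

end
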